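(* The composition monoid $\mathcal{CM}(K)$ of the Kronecker quiver, with generators $i$ and $j$, has defining relations (as a monoid) (1) $i^m j^{m+1} i^{m+1} j^{m+2} = i^{2m+1} j^{2m+3}$ for all $m\ge 0$; (2) $i^{n+2} j^{n+1} i^{n+1} j^{n} = i^{2n+3} j^{2n+1}$ for all $n\ge 0$; (3) $(ij)^m=i^mj^m$ for all $m\ge 1$.
   Context: Let $k$ be an algebraically closed field of characteristic zero and $K$ the Kronecker quiver $i\rightrightarrows j$. For a dimension vector $\alpha=(\alpha_i,\alpha_j)$, let $\mathrm{Rep}(\alpha)$ be the affine space of pairs of $\alpha_j\times\alpha_i$ matrices over $k$, with the action of $\mathrm{GL}(\alpha)=\mathrm{GL}(\alpha_i)\times\mathrm{GL}(\alpha_j)$ by base change, so that orbits correspond to isomorphism classes of representations of dimension vector $\alpha$. The extension monoid has as elements the irreducible closed $\mathrm{GL}(\alpha)$-stable subvarieties of $\mathrm{Rep}(\alpha)$, for all $\alpha$, with the product of $\mathcal{A}\subset\mathrm{Rep}(\alpha)$ and $\mathcal{B}\subset\mathrm{Rep}(\beta)$ given by $$\mathcal{A}\ast\mathcal{B}=\{X\in\mathrm{Rep}(\alpha+\beta): \exists\text{ an exact sequence }0\to B\to X\to A\to 0\text{ with }A\in\mathcal{A},B\in\mathcal{B}\},$$ and unit $\mathrm{Rep}(0)$ (this is a known well-defined monoid). The composition monoid $\mathcal{CM}(K)$ is the submonoid generated by $i:=\mathrm{Rep}((1,0))$ and $j:=\mathrm{Rep}((0,1))$; products and powers are taken with respect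 to $\ast$. *)

theory Defs
  imports
    "HOL-Algebra.Group"
    "HOL-Computational_Algebra.Computational_Algebra"
    "Jordan_Normal_Form.Matrix"
    "Jordan_Normal_Form.Matrix_Kernel"
begin

section \<open>Representations of the Kronecker quiver\<close>

datatype kvertex = Vi | Vj

text \<open>
  A dimension vector is the pair \<open>(a\<^sub>i, a\<^sub>j)\<close>. Matrices record their numbers of rows and columns,
  also when one of them is 0, so the sets \<open>Rep \<alpha>\<close> are pairwise disjoint and a nonempty
  subset of \<open>Rep \<alpha>\<close> determines \<open>\<alpha>\<close>.
\<close>

type_synonym dimvec = "nat \<times> nat"

type_synonym 'k krep = "'k mat \<times> 'k mat"

definition Rep :: "dimvec \<Rightarrow> 'k krep set" where
  "Rep \<alpha> = carrier_mat (snd \<alpha>) (fst \<alpha>) \<times> carrier_mat (snd \<alpha>) (fst \<alpha>)"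

definition dim_add :: "dimvec \<Rightarrow> dimvec \<Rightarrow> dimvec" where
  "dim_add \<alpha> \<beta> = (fst \<alpha> + fst \<beta>, snd \<alpha> + snd \<beta>)"

text \<open>
  A morphism is the pair of its components at \<open>i\<close> and \<open>j\<close>.
\<close>

definition krep_hom :: "dimvec \<Rightarrow> dimvec \<Rightarrow> 'k::field krep \<Rightarrow> 'k krep \<Rightarrow> ('k mat \<times> 'k mat) set" where
  "krep_hom \<alpha> \<beta> X Y =
     {(f, g). f \<in> carrier_mat (fst \<beta>) (fst \<alpha>) \<and> g \<in> carrier_mat (snd \<beta>) (snd \<alpha>) \<and>
        g * fst X = fst Y * f \<and> g * snd X = snd Y * f}"

definition short_exact_mat :: "'k::field mat \<Rightarrow> 'k mat \<Rightarrow> bool" where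
  "short_exact_mat f g \<longleftrightarrow>
     inj_on (\<lambda>v. f *\<^sub>v v) (carrier_vec (dim_col f)) \<and>
     (\<lambda>v. f *\<^sub>v v) ` carrier_vec (dim_col f) = mat_kernel g \<and>
     (\<lambda>v. g *\<^sub>v v) ` carrier_vec (dim_col g) = carrier_vec (dim_row g)"

text \<open>
  \<open>is_extension \<alpha> \<beta> A B X\<close>: there is an exact sequence \<open>0 \<rightarrow> B \<rightarrow> X \<rightarrow> A \<rightarrow> 0\<close>, where \<open>A\<close> and \<open>B\<close>
  have dimension vectors \<open>\<alpha>\<close> and \<open>\<beta>\<close>.
\<close>

definition is_extension :: "dimvec \<Rightarrow> dimvec \<Rightarrow> 'k::field krep \<Rightarrow> 'k krep \<Rightarrow> 'k krep \<Rightarrow> bool" where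
  "is_extension \<alpha> \<beta> A B X \<longleftrightarrow>
     (\<exists>\<phi> \<in> krep_hom \<beta> (dim_add \<alpha> \<beta>) B X. \<exists>\<psi> \<in> krep_hom (dim_add \<alpha> \<beta>) \<alpha> X A.
        short_exact_mat (fst \<phi>) (fst \<psi>) \<and> short_exact_mat (snd \<phi>) (snd \<psi>))"

section \<open>The extension monoid\<close>

text \<open>Regular functions on the affine space \<open>Rep \<alpha>\<close>: polynomials in the matrix entries.\<close>

inductive_set regular_functions :: "dimvec \<Rightarrow> ('k::field krep \<Rightarrow> 'k) set" for \<alpha> :: dimvec where
  const: "(\<lambda>X. c) \<in> regular_functions \<alpha>"
| coord1: "r < snd \<alpha> \<Longrightarrow> s < fst \<alpha> \<Longrightarrow> (\<lambda>X. fst X $$ (r, s)) \<in> regular_functions \<alpha>"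
| coord2: "r < snd \<alpha> \<Longrightarrow> s < fst \<alpha> \<Longrightarrow> (\<lambda>X. snd X $$ (r, s)) \<in> regular_functions \<alpha>"
| add: "p \<in> regular_functions \<alpha> \<Longrightarrow> q \<in> regular_functions \<alpha> \<Longrightarrow>
          (\<lambda>X. p X + q X) \<in> regular_functions \<alpha>"
| mult: "p \<in> regular_functions \<alpha> \<Longrightarrow> q \<in> regular_functions \<alpha> \<Longrightarrow>
          (\<lambda>X. p X * q X) \<in> regular_functions \<alpha>"

definition zariski_closed :: "dimvec \<Rightarrow> 'k::field krep set \<Rightarrow> bool" where
  "zariski_closed \<alpha> S \<longleftrightarrow>
     (\<exists>P \<subseteq> regular_functions \<alpha>. S = {X \<in> Rep \<alpha>. \<forall>p \<in> P. p X = 0})"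

definition zariski_irreducible :: "dimvec \<Rightarrow> 'k::field krep set \<Rightarrow> bool" where
  "zariski_irreducible \<alpha> S \<longleftrightarrow> S \<noteq> {} \<and>
     (\<forall>C D. zariski_closed \<alpha> C \<and> zariski_closed \<alpha> D \<and> S \<subseteq> C \<union> D \<longrightarrow> S \<subseteq> C \<or> S \<subseteq> D)"

text \<open>
  Stability under \<open>(g, h) \<cdot> (M, N) = (h M g\<inverse>, h N g\<inverse>)\<close>, with \<open>g'\<close> the inverse of \<open>g\<close>.
\<close>

definition GL_stable :: "dimvec \<Rightarrow> 'k::field krep set \<Rightarrow> bool" where
  "GL_stable \<alpha> S \<longleftrightarrow>
     (\<forall>X \<in> S. \<forall>g \<in> carrier_mat (fst \<alpha>) (fst \<alpha>). \<forall>g' \<in> carrier_mat (fst \<alpha>) (fst \<alpha>).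
        \<forall>h \<in> carrier_mat (snd \<alpha>) (snd \<alpha>).
        inverts_mat g g' \<and> inverts_mat g' g \<and> invertible_mat h \<longrightarrow>
        (h * fst X * g', h * snd X * g') \<in> S)"

definition ext_prod :: "'k::field krep set \<Rightarrow> 'k krep set \<Rightarrow> 'k krep set" where
  "ext_prod S T =
     {X. \<exists>\<alpha> \<beta>. X \<in> Rep (dim_add \<alpha> \<beta>) \<and>
        (\<exists>A \<in> S \<inter> Rep \<alpha>. \<exists>B \<in> T \<inter> Rep \<beta>. is_extension \<alpha> \<beta> A B X)}"

definition extension_monoid :: "'k::field krep set monoid" where
  "extension_monoid =
     \<lparr>carrier = {S. \<exists>\<alpha>. S \<subseteq> Rep \<alpha> \<and> zariski_closed \<alpha> S \<and> zariski_irreducible \<alpha> S \<and> GL_stable \<alpha> S},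
      mult = ext_prod,
      one = Rep (0, 0)\<rparr>"

section \<open>Generated submonoids and presentations\<close>

inductive_set generated_set :: "('a, 'b) monoid_scheme \<Rightarrow> 'a set \<Rightarrow> 'a set"
  for M :: "('a, 'b) monoid_scheme" and S :: "'a set" where
  one: "\<one>\<^bsub>M\<^esub> \<in> generated_set M S"
| incl: "x \<in> S \<Longrightarrow> x \<in> generated_set M S"
| mult: "x \<in> generated_set M S \<Longrightarrow> y \<in> generated_set M S \<Longrightarrow> x \<otimes>\<^bsub>M\<^esub> y \<in> generated_set M S"

lemma generated_set_eq_Inter_submonoids:
  assumes "monoid M" and "S \<subseteq> carrier M"
  shows "generated_set M S = \<Inter>{H. submonoid H M \<and> S \<subseteq> H}"
proof
  interpret M: monoid M by (rule assms(1))
  show "generated_set M S \<subseteq> \<Inter>{H. submonoid H M \<and> S \<subseteq> H}"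
  proof (rule subsetI, rule InterI)
    fix x H assume x: "x \<in> generated_set M S" and "H \<in> {H. submonoid H M \<and> S \<subseteq> H}"
    then have H: "submonoid H M" and "S \<subseteq> H" by simp_all
    from x show "x \<in> H"
    proof induction
      case one
      show ?case by (rule submonoid.one_closed[OF H])
    next
      case (incl x)
      with \<open>S \<subseteq> H\<close> show ?case by (rule_tac subsetD)
    next
      case (mult x y)
      from mult.IH show ?case by (rule submonoid.m_closed[OF H])
    qed
  qed
  have "x \<in> carrier M" if "x \<in> generated_set M S" for x
    using that
  proof induction
    case one
    show ?case by (rule M.one_closed)
  next
    case (incl x)
    with assms(2) show ?case by (rule_tac subsetD)
  next
    case (mult x y)
    from mult.IH show ?case by (rule M.m_closed)
  qed
  then have "submonoid (generated_set M S) M"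
    by (intro submonoid.intro subsetI generated_set.one generated_set.mult)
  moreover have "S \<subseteq> generated_set M S"
    by (intro subsetI generated_set.incl)
  ultimately show "\<Inter>{H. submonoid H M \<and> S \<subseteq> H} \<subseteq> generated_set M S"
    by (intro Inter_lower CollectI conjI)
qed

definition generated_submonoid :: "('a, 'b) monoid_scheme \<Rightarrow> 'a set \<Rightarrow> ('a, 'b) monoid_scheme" where
  "generated_submonoid M S = M\<lparr>carrier := generated_set M S\<rparr>"

text \<open>Words are the elements of the free monoid; concatenation is the product.\<close>

inductive word_cong :: "('g list \<times> 'g list) set \<Rightarrow> 'g list \<Rightarrow> 'g list \<Rightarrow> bool"
  for R :: "('g list \<times> 'g list) set" where
  rel: "(u, v) \<in> R \<Longrightarrow> word_cong R u v"
| refl: "word_cong R u u"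
| sym: "word_cong R u v \<Longrightarrow> word_cong R v u"
| trans: "word_cong R u v \<Longrightarrow> word_cong R v w \<Longrightarrow> word_cong R u w"
| append: "word_cong R u v \<Longrightarrow> word_cong R u' v' \<Longrightarrow> word_cong R (u @ u') (v @ v')"

definition word_eval :: "('a, 'b) monoid_scheme \<Rightarrow> ('g \<Rightarrow> 'a) \<Rightarrow> 'g list \<Rightarrow> 'a" where
  "word_eval M \<gamma> w = foldr (\<lambda>x y. \<gamma> x \<otimes>\<^bsub>M\<^esub> y) w \<one>\<^bsub>M\<^esub>"

text \<open>
  \<open>M\<close> is generated by the family \<open>\<gamma>\<close> with defining relations \<open>R\<close>: the map from the free monoid
  to \<open>M\<close> extending \<open>\<gamma>\<close> is onto, and its kernel is the congruence generated by \<open>R\<close>.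
\<close>

definition has_presentation ::
  "('a, 'b) monoid_scheme \<Rightarrow> ('g \<Rightarrow> 'a) \<Rightarrow> ('g list \<times> 'g list) set \<Rightarrow> bool" where
  "has_presentation M \<gamma> R \<longleftrightarrow>
     monoid M \<and> range \<gamma> \<subseteq> carrier M \<and> word_eval M \<gamma> ` UNIV = carrier M \<and>
     (\<forall>u v. word_eval M \<gamma> u = word_eval M \<gamma> v \<longleftrightarrow> word_cong R u v)"

section \<open>The composition monoid\<close>

fun simple_class :: "kvertex \<Rightarrow> 'k krep set" where
  "simple_class Vi = Rep (1, 0)"
| "simple_class Vj = Rep (0, 1)"

definition composition_monoid :: "'k::field krep set monoid" where
  "composition_monoid = generated_submonoid extension_monoid {Rep (1, 0), Rep (0, 1)}"

abbreviation wpow :: "'g list \<Rightarrow> nat \<Rightarrow> 'g list" where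
  "wpow w n \<equiv> concat (replicate n w)"

abbreviation "wi \<equiv> [Vi]"
abbreviation "wj \<equiv> [Vj]"

end

theory Submission
  imports Defs "Jordan_Normal_Form.Char_Poly"
begin

text \<open>
  The element of the monoid given by a word \<open>w\<close> is the set of representations with a composition
  series of type \<open>w\<close>, read from the top. Put \<open>p\<^sub>a = i\<^sup>a j\<^bsup>a+1\<^esup>\<close>, \<open>q\<^sub>b = i\<^bsup>b+1\<^esup> j\<^sup>b\<close> and \<open>r = ij\<close>.
  Modulo the relations every word equals some \<open>p\<^bsub>a\<^sub>1\<^esub> \<dots> p\<^bsub>a\<^sub>s\<^esub> r\<^sup>m q\<^bsub>b\<^sub>1\<^esub> \<dots> q\<^bsub>b\<^sub>t\<^esub>\<close> with
  weakly increasing \<open>a\<close>'s and weakly decreasing \<open>b\<close>'s. Such a word is recovered from its set of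
  representations \<open>X\<close>: the minimum of \<open>dim Hom(I\<^sub>k, X)\<close>, where \<open>I\<^sub>k\<close> is the indecomposable
  preinjective of dimension \<open>(k+1, k)\<close>, is the sum of the numbers \<open>max(0, k + 1 - b)\<close> over the
  \<open>b\<close>'s, which determines the \<open>b\<close>'s; transposing matrices exchanges \<open>a\<close>'s and \<open>b\<close>'s, and the
  dimension vector then gives \<open>m\<close>. The homomorphisms \<open>I\<^sub>k \<rightarrow> X\<close> are the vector polynomials of
  degree \<open>\<le> k\<close> annihilated by the pencil \<open>X\<close>. Counting equations shows that they exist, which also
  gives the second family of relations, and by transposition the first.
\<close>

text \<open>Generic representations are never described. For the upper bound on dim Hom(I_k, X), one
  explicit representation per factor suffices: Hom(I_k, -) is left exact, so the bounds add up along
  extensions, whatever the off-diagonal block is. For the lower bound, a representation of dimension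
  (x, y) has at least (k+1)x - (k+2)y independent homomorphisms from I_k, the number of unknowns
  minus the number of equations. For dimension (b+1, b) this is k+1-b, which is of use only when b
  is at most k. Hence the decreasing order of the b's: the factors with b at most k form a tail of
  the word, thus a subrepresentation, and homomorphisms into a subrepresentation are homomorphisms
  into the whole. The two bounds meet.

  For the relations, the same count yields a subrepresentation of dimension (e+1, e), where e may be
  smaller than wanted. The gap (l, l) is filled by square representations, which always contain a
  subrepresentation of dimension (1, 1) because pencils of square matrices have eigenvalues over an
  algebraically closed field.\<close>

no_notation fps_nth (infixl \<open>$\<close> 75)

section \<open>Linear algebra\<close>

text \<open>Gaussian elimination, one equation and one unknown at a time. Equations and unknowns are
  indexed by arbitrary finite sets, so that a system assembled from several kinds of conditions
  needs no numbering.\<close>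

lemma homogeneous_system_nontrivial:
  fixes c :: "'e \<Rightarrow> 'v \<Rightarrow> 'k::field"
  assumes "finite E" "finite V" "card E < card V"
  shows "\<exists>x. (\<exists>v\<in>V. x v \<noteq> 0) \<and> (\<forall>e\<in>E. (\<Sum>v\<in>V. c e v * x v) = 0)"
  using assms
proof (induction E arbitrary: V c rule: finite_induct)
  case empty
  then obtain v where "v \<in> V" by (metis card.empty equals0I less_irrefl)
  then show ?case by (intro exI[of _ "\<lambda>_. 1"]) auto
next
  case (insert e E)
  show ?case
  proof (cases "\<forall>v\<in>V. c e v = 0")
    case True
    have "\<exists>x. (\<exists>v\<in>V. x v \<noteq> 0) \<and> (\<forall>e\<in>E. (\<Sum>v\<in>V. c e v * x v) = 0)"
      using insert.prems insert.hyps by (intro insert.IH) auto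
    with True show ?thesis by auto
  next
    case False
    then obtain p where p: "p \<in> V" "c e p \<noteq> 0" by auto
    define W where "W = V - {p}"
    have W: "finite W" "V = insert p W" "p \<notin> W" using insert.prems p by (auto simp: W_def)
    have "card E < card W" using insert.prems insert.hyps W by auto
    from insert.IH[OF W(1) this, of "\<lambda>f v. c f v - c f p * c e v / c e p"]
    obtain x where x: "\<exists>v\<in>W. x v \<noteq> 0"
      "\<And>f. f \<in> E \<Longrightarrow> (\<Sum>v\<in>W. (c f v - c f p * c e v / c e p) * x v) = 0" by blast
    \<comment> \<open>The eliminated equation \<open>e\<close> is solved for the pivot unknown
      \<open>p\<close>.\<close>
    define y where "y = x(p := - (\<Sum>v\<in>W. c e v * x v) / c e p)"
    have sum_y: "(\<Sum>v\<in>V. c f v * y v) = (\<Sum>v\<in>W. (c f v - c f p * c e v / c e p) * x v)" for f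
    proof -
      have "(\<Sum>v\<in>W. c f v * y v) = (\<Sum>v\<in>W. c f v * x v)"
        using W by (intro sum.cong) (auto simp: y_def)
      then show ?thesis using W
        by (simp add: y_def sum_subtractf left_diff_distrib sum_distrib_left sum_divide_distrib
            mult.assoc)
    qed
    have "(\<Sum>v\<in>V. c e v * y v) = 0" unfolding sum_y using p by simp
    moreover have "\<exists>v\<in>V. y v \<noteq> 0" using x(1) W by (auto simp: y_def)
    ultimately show ?thesis using x(2) sum_y by auto
  qed
qed

section \<open>Invertible matrices carried together with an inverse\<close>

definition inv_pair :: "nat \<Rightarrow> 'k::field mat \<Rightarrow> 'k mat \<Rightarrow> bool" where
  "inv_pair n g g' \<longleftrightarrow>
     g \<in> carrier_mat n n \<and> g' \<in> carrier_mat n n \<and> g * g' = 1\<^sub>m n \<and> g' * g = 1\<^sub>m n"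

lemma inv_pairD:
  assumes "inv_pair n g g'"
  shows "g \<in> carrier_mat n n" "g' \<in> carrier_mat n n" "g * g' = 1\<^sub>m n" "g' * g = 1\<^sub>m n"
  using assms by (auto simp: inv_pair_def)

lemma inv_pair_sym: "inv_pair n g g' \<Longrightarrow> inv_pair n g' g"
  by (auto simp: inv_pair_def)

lemma inv_pair_one: "inv_pair n (1\<^sub>m n) (1\<^sub>m n)"
  by (auto simp: inv_pair_def)

lemma inv_pair_cancel_left:
  assumes "inv_pair n g g'" "M \<in> carrier_mat n p"
  shows "g * (g' * M) = M"
  using assms assoc_mult_mat[of g n n g' n M p] by (auto simp: inv_pair_def)

lemma inv_pair_cancel_right:
  assumes "inv_pair n g g'" "N \<in> carrier_mat p n"
  shows "N * g * g' = N"
  using assms assoc_mult_mat[of N p n g n g' n] by (auto simp: inv_pair_def)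

lemma inv_pair_mult:
  assumes "inv_pair n g g'" "inv_pair n h h'"
  shows "inv_pair n (g * h) (h' * g')"
proof -
  note c = inv_pairD[OF assms(1)] inv_pairD[OF assms(2)]
  have "g * h * (h' * g') = g * (h * (h' * g'))" using c by (intro assoc_mult_mat) auto
  also have "\<dots> = 1\<^sub>m n" using c inv_pair_cancel_left[OF assms(2), of g'] by simp
  finally have 1: "g * h * (h' * g') = 1\<^sub>m n" .
  have "h' * g' * (g * h) = h' * (g' * (g * h))" using c by (intro assoc_mult_mat) auto
  also have "\<dots> = 1\<^sub>m n" using c inv_pair_cancel_left[OF inv_pair_sym[OF assms(1)], of h] by simp
  finally show ?thesis using 1 c by (auto simp: inv_pair_def)
qed

lemma inv_pair_transpose:
  assumes "inv_pair n g g'"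
  shows "inv_pair n (transpose_mat g) (transpose_mat g')"
proof -
  note c = inv_pairD[OF assms]
  have "transpose_mat g * transpose_mat g' = transpose_mat (g' * g)"
    "transpose_mat g' * transpose_mat g = transpose_mat (g * g')"
    using transpose_mult[OF c(2,1)] transpose_mult[OF c(1,2)] by auto
  with c show ?thesis by (auto simp: inv_pair_def transpose_one)
qed

text \<open>The lower left block of the inverse is the solution Y of C g' + h Y = 0.\<close>

lemma inv_pair_four_block:
  fixes g :: "'k::field mat"
  assumes "inv_pair n g g'" "inv_pair m h h'" "C \<in> carrier_mat m n"
  shows "inv_pair (n + m) (four_block_mat g (0\<^sub>m n m) C h) (four_block_mat g' (0\<^sub>m n m) (- (h' * C * g')) h')"
proof -
  note c = inv_pairD[OF assms(1)] inv_pairD[OF assms(2)] assms(3)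
  have 1: "h * (- (h' * C * g')) = - (C * g')"
  proof -
    have "h * (- (h' * C * g')) = - (h * (h' * C * g'))" using c by simp
    also have "h * (h' * C * g') = h * (h' * (C * g'))" using c by (subst assoc_mult_mat) auto
    also have "h * (h' * (C * g')) = C * g'" using c by (intro inv_pair_cancel_left[OF assms(2)]) auto
    finally show ?thesis .
  qed
  have 2: "- (h' * C * g') * g = - (h' * C)"
  proof -
    have "- (h' * C * g') * g = - (h' * C * g' * g)" using c by simp
    also have "\<dots> = - (h' * C)"
      using c by (subst inv_pair_cancel_right[OF inv_pair_sym[OF assms(1)]]) auto
    finally show ?thesis .
  qed
  have 4: "1\<^sub>m n + - 0\<^sub>m n n = (1\<^sub>m n :: 'k mat)" by (intro eq_matI) auto
  have 5: "- (h' * C) + h' * C = 0\<^sub>m m n" using c by (intro uminus_l_inv_mat) auto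
  have 3: "C * g' + - (C * g') = 0\<^sub>m m n" using c by (intro eq_matI) auto
  have "four_block_mat g (0\<^sub>m n m) C h * four_block_mat g' (0\<^sub>m n m) (- (h' * C * g')) h' = 1\<^sub>m (n+m)"
    using c 1 3 4
    by (subst mult_four_block_mat[where ?nr1.0=n and ?nr2.0=m and ?n1.0=n and ?n2.0=m and ?nc1.0=n and ?nc2.0=m])
       auto
  moreover have "four_block_mat g' (0\<^sub>m n m) (- (h' * C * g')) h' * four_block_mat g (0\<^sub>m n m) C h = 1\<^sub>m (n+m)"
    using c 2
    by (subst mult_four_block_mat[where ?nr1.0=n and ?nr2.0=m and ?n1.0=n and ?n2.0=m and ?nc1.0=n and ?nc2.0=m])
       (auto simp del: uminus_l_inv_mat simp: 5)
  ultimately show ?thesis using c by (auto simp: inv_pair_def)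
qed

lemma inv_pair_of_injective:
  fixes g :: "'k::field mat"
  assumes g: "g \<in> carrier_mat n n"
    and inj: "\<And>x. x \<in> carrier_vec n \<Longrightarrow> g *\<^sub>v x = 0\<^sub>v n \<Longrightarrow> x = 0\<^sub>v n"
  shows "\<exists>g'. inv_pair n g g'"
proof -
  have "det g \<noteq> 0" using det_0_iff_vec_prod_zero_field[OF g] inj by auto
  from det_non_zero_imp_unit[OF g this, of "()"] show ?thesis using g
    by (auto simp: inv_pair_def Units_def ring_mat_simps)
qed

lemma mat_mult_unit_vec:
  fixes A :: "'k::semiring_1 mat"
  assumes "A \<in> carrier_mat nr nc" "s < nc"
  shows "A *\<^sub>v unit_vec nc s = col A s"
  using assms by (intro eq_vecI) auto

text \<open>A vector with nonzero entry at \<open>p\<close> can replace the unit vector at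
  \<open>p\<close> in the standard basis. It is put in the last place because subrepresentations
  occupy the last coordinates.\<close>

lemma inv_pair_to_last_unit_vec:
  fixes v :: "'k::field vec"
  assumes v: "v \<in> carrier_vec (Suc n)" and nz: "v \<noteq> 0\<^sub>v (Suc n)"
  shows "\<exists>g g'. inv_pair (Suc n) g g' \<and> col g n = v \<and> g' *\<^sub>v v = unit_vec (Suc n) n"
proof -
  obtain p where p: "p < Suc n" "v $ p \<noteq> 0" using nz v by (auto simp: vec_eq_iff)
  \<comment> \<open>The identity matrix with \<open>v\<close> in the last column and, if
    \<open>p < n\<close>, the displaced last unit vector in column \<open>p\<close>.\<close>
  define g where "g = mat (Suc n) (Suc n)
    (\<lambda>(r, s). if s = n then v $ r else if s = p then of_bool (r = n) else of_bool (r = s))"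
  have g: "g \<in> carrier_mat (Suc n) (Suc n)" by (simp add: g_def)
  have row_sum: "(g *\<^sub>v x) $ r = v $ r * x $ n +
      (\<Sum>s<n. (if s = p then of_bool (r = n) else of_bool (r = s)) * x $ s)"
    if "x \<in> carrier_vec (Suc n)" "r < Suc n" for x r
    using that by (simp add: g_def scalar_prod_def lessThan_atLeast0 add.commute)
  have "x = 0\<^sub>v (Suc n)" if x: "x \<in> carrier_vec (Suc n)" and gx: "g *\<^sub>v x = 0\<^sub>v (Suc n)" for x
  proof -
    have zero: "v $ r * x $ n + (\<Sum>s<n. (if s = p then of_bool (r = n) else of_bool (r = s)) * x $ s) = 0"
      if "r < Suc n" for r
      using row_sum[OF x that] gx that by simp
    \<comment> \<open>In row \<open>p\<close> only the last column has a nonzero entry, namely that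
      of \<open>v\<close>.\<close>
    have xn: "x $ n = 0"
    proof -
      have "(\<Sum>s<n. (if s = p then of_bool (p = n) else of_bool (p = s)) * x $ s) = 0"
        by (intro sum.neutral) auto
      with zero[OF p(1)] p(2) show ?thesis by simp
    qed
    have "x $ r = 0" if r: "r < n" for r
    proof (cases "r = p")
      case True
      have "(\<Sum>s<n. (if s = p then of_bool (n = n) else of_bool (n = s)) * x $ s) =
          (\<Sum>s<n. if s = p then x $ s else 0)" by (intro sum.cong) auto
      with zero[of n] xn True r show ?thesis by simp
    next
      case False
      have "(\<Sum>s<n. (if s = p then of_bool (r = n) else of_bool (r = s)) * x $ s) =
          (\<Sum>s<n. if s = r then x $ s else 0)" using False r by (intro sum.cong) auto
      with zero[of r] xn r show ?thesis by simp
    qed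
    with xn x show ?thesis by (intro eq_vecI) (auto simp: less_Suc_eq)
  qed
  from inv_pair_of_injective[OF g this] obtain g' where g': "inv_pair (Suc n) g g'" by blast
  have col: "col g n = v" using v by (intro eq_vecI) (auto simp: g_def)
  have "g' *\<^sub>v v = g' *\<^sub>v (g *\<^sub>v unit_vec (Suc n) n)"
    using col g by (simp add: mat_mult_unit_vec)
  also have "\<dots> = (g' * g) *\<^sub>v unit_vec (Suc n) n"
    using inv_pairD[OF g'] by (intro assoc_mult_mat_vec[symmetric]) auto
  also have "\<dots> = unit_vec (Suc n) n" using inv_pairD[OF g'] by simp
  finally show ?thesis using col g' by blast
qed

section \<open>Rank normal form\<close>

definition rank_form :: "nat \<Rightarrow> nat \<Rightarrow> nat \<Rightarrow> 'k::field mat" where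
  "rank_form n p r = four_block_mat (0\<^sub>m (n - r) (p - r)) (0\<^sub>m (n - r) r) (0\<^sub>m r (p - r)) (1\<^sub>m r)"

lemma rank_form_Suc:
  assumes "r \<le> n" "r \<le> p"
  shows "four_block_mat (rank_form n p r) (0\<^sub>m n 1) (0\<^sub>m 1 p) (1\<^sub>m 1) = rank_form (Suc n) (Suc p) (Suc r)"
  using assms by (intro eq_matI) (auto simp: rank_form_def)

text \<open>Induction on the number of rows: a nonzero column is moved to the last place and turned
  into the last unit vector, the rest of the last row is cleared, and a smaller block remains. The
  identity block sits in the lower right corner so that the image of the normal form lies in the
  last \<open>r\<close> coordinates.\<close>

lemma rank_normal_form:
  fixes M :: "'k::field mat"
  assumes "M \<in> carrier_mat n p"
  shows "\<exists>P P' Q Q' r. inv_pair n P P' \<and> inv_pair p Q Q' \<and> r \<le> n \<and> r \<le> p \<and> P * M * Q = rank_form n p r"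
  using assms
proof (induction n arbitrary: p M)
  case 0
  then have "1\<^sub>m 0 * M * 1\<^sub>m p = rank_form 0 p 0" by (intro eq_matI) (auto simp: rank_form_def)
  then show ?case using inv_pair_one by blast
next
  case (Suc n)
  show ?case
  proof (cases "M = 0\<^sub>m (Suc n) p")
    case True
    then have "1\<^sub>m (Suc n) * M * 1\<^sub>m p = rank_form (Suc n) p 0" by (intro eq_matI) (auto simp: rank_form_def)
    then show ?thesis using inv_pair_one by blast
  next
    case False
    have "\<exists>r0<Suc n. \<exists>q<p. M $$ (r0, q) \<noteq> 0"
    proof (rule ccontr)
      assume "\<not> ?thesis"
      with Suc.prems have "M = 0\<^sub>m (Suc n) p" by (intro eq_matI) auto
      with False show False ..
    qed
    then obtain r0 q where q: "r0 < Suc n" "q < p" "M $$ (r0, q) \<noteq> 0" by blast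
    then obtain p' where p': "p = Suc p'" by (cases p) auto
    have M: "M \<in> carrier_mat (Suc n) (Suc p')" using Suc.prems p' by simp
    \<comment> \<open>Multiplication by \<open>g\<close> on the right puts column \<open>q\<close>
      of \<open>M\<close> in the last place.\<close>
    obtain g g' :: "'k mat" where g: "inv_pair p g g'" "col g p' = unit_vec p q"
    proof -
      have "unit_vec p q \<noteq> (0\<^sub>v p :: 'k vec)" using q(2) by (intro unit_vec_nonzero)
      from inv_pair_to_last_unit_vec[OF unit_vec_carrier this[unfolded p'], folded p'] show ?thesis
        using that by blast
    qed
    note gc = inv_pairD[OF g(1)]
    have "col M q \<noteq> 0\<^sub>v (Suc n)" using q Suc.prems by (auto simp: vec_eq_iff)
    then obtain h h' where h: "inv_pair (Suc n) h' h" "h *\<^sub>v col M q = unit_vec (Suc n) n"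
      using inv_pair_to_last_unit_vec[OF col_carrier_vec[OF q(2) Suc.prems]] inv_pair_sym by blast
    note hc = inv_pairD[OF h(1)]
    define N where "N = h * M * g"
    have N: "N \<in> carrier_mat (Suc n) (Suc p')" using gc hc M p' by (simp add: N_def)
    have "col N p' = h * M *\<^sub>v col g p'"
      using gc hc M p' unfolding N_def by (intro col_mult2) auto
    also have "\<dots> = h *\<^sub>v (M *\<^sub>v unit_vec p q)"
      unfolding g(2) using hc M p' by (intro assoc_mult_mat_vec) auto
    also have "\<dots> = unit_vec (Suc n) n" using q(2) p' M h(2) by (simp add: mat_mult_unit_vec)
    finally have "col N p' = unit_vec (Suc n) n" .
    then have cN: "col N p' $ r = unit_vec (Suc n) n $ r" for r by simp
    have colN: "N $$ (r, p') = of_bool (r = n)" if "r < Suc n" for r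
      using cN[of r] that N by auto
    define N1 where "N1 = mat n p' (\<lambda>(r, s). N $$ (r, s))"
    define w where "w = mat 1 p' (\<lambda>(r, s). N $$ (n, s))"
    have N1: "N1 \<in> carrier_mat n p'" and w: "w \<in> carrier_mat 1 p'" by (auto simp: N1_def w_def)
    have Nb: "N = four_block_mat N1 (0\<^sub>m n 1) w (1\<^sub>m 1)"
      using N colN by (intro eq_matI) (auto simp: N1_def w_def less_Suc_eq)
    \<comment> \<open>Subtracts multiples of the last column, which is a unit vector, to clear the
      row \<open>w\<close>.\<close>
    define k where "k = four_block_mat (1\<^sub>m p') (0\<^sub>m p' 1) (- w) (1\<^sub>m 1)"
    obtain k' where k: "inv_pair p k k'"
      using inv_pair_four_block[OF inv_pair_one[of p'] inv_pair_one[of 1], of "- w"] w p'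
      by (auto simp: k_def)
    have w': "w + - w = 0\<^sub>m 1 p'" using w by (intro eq_matI) auto
    have Nk: "N * k = four_block_mat N1 (0\<^sub>m n 1) (0\<^sub>m 1 p') (1\<^sub>m 1)"
      unfolding Nb k_def using N1 w w'
      by (subst mult_four_block_mat[where ?nr1.0=n and ?nr2.0=1 and ?n1.0=p' and ?n2.0=1 and ?nc1.0=p' and ?nc2.0=1])
         auto
    from Suc.IH[OF N1] obtain P P' Q Q' r where IH: "inv_pair n P P'" "inv_pair p' Q Q'" "r \<le> n" "r \<le> p'"
      "P * N1 * Q = rank_form n p' r" by blast
    note IHc = inv_pairD[OF IH(1)] inv_pairD[OF IH(2)]
    define P2 where "P2 = four_block_mat P (0\<^sub>m n 1) (0\<^sub>m 1 n) (1\<^sub>m 1)"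
    define Q2 where "Q2 = four_block_mat Q (0\<^sub>m p' 1) (0\<^sub>m 1 p') (1\<^sub>m 1)"
    obtain P2' where P2: "inv_pair (Suc n) P2 P2'"
      using inv_pair_four_block[OF IH(1) inv_pair_one[of 1], of "0\<^sub>m 1 n"] by (auto simp: P2_def)
    obtain Q2' where Q2: "inv_pair p Q2 Q2'"
      using inv_pair_four_block[OF IH(2) inv_pair_one[of 1], of "0\<^sub>m 1 p'"] p' by (auto simp: Q2_def)
    have "P2 * (N * k) * Q2 = four_block_mat (P * N1) (0\<^sub>m n 1) (0\<^sub>m 1 p') (1\<^sub>m 1) * Q2"
      unfolding P2_def Nk using IHc N1
      by (subst mult_four_block_mat[where ?nr1.0=n and ?nr2.0=1 and ?n1.0=n and ?n2.0=1 and ?nc1.0=p' and ?nc2.0=1]) auto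
    also have "\<dots> = four_block_mat (P * N1 * Q) (0\<^sub>m n 1) (0\<^sub>m 1 p') (1\<^sub>m 1)"
      unfolding Q2_def using IHc N1
      by (subst mult_four_block_mat[where ?nr1.0=n and ?nr2.0=1 and ?n1.0=p' and ?n2.0=1 and ?nc1.0=p' and ?nc2.0=1]) auto
    also have "\<dots> = rank_form (Suc n) p (Suc r)" using IH rank_form_Suc p' by metis
    finally have "P2 * (N * k) * Q2 = rank_form (Suc n) p (Suc r)" .
    moreover have "P2 * (N * k) * Q2 = P2 * h * M * (g * k * Q2)"
    proof -
      note c = inv_pairD[OF P2] inv_pairD[OF Q2] inv_pairD[OF k] gc hc Suc.prems
      have "P2 * (N * k) * Q2 = P2 * (h * M * (g * k)) * Q2" unfolding N_def
        using c by (subst assoc_mult_mat[of "h * M" "Suc n" p g p k p]) auto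
      also have "\<dots> = P2 * (h * M * (g * k) * Q2)" using c by (intro assoc_mult_mat) auto
      also have "\<dots> = P2 * (h * M * (g * k * Q2))" using c by (subst assoc_mult_mat[of "h * M" "Suc n" p]) auto
      also have "\<dots> = P2 * (h * (M * (g * k * Q2)))" using c by (subst assoc_mult_mat[of h "Suc n" "Suc n"]) auto
      also have "\<dots> = P2 * h * (M * (g * k * Q2))" using c by (intro assoc_mult_mat[symmetric]) auto
      also have "\<dots> = P2 * h * M * (g * k * Q2)" using c by (intro assoc_mult_mat[symmetric]) auto
      finally show ?thesis .
    qed
    moreover have "inv_pair (Suc n) (P2 * h) (h' * P2')" by (intro inv_pair_mult P2 inv_pair_sym[OF h(1)])
    moreover have "inv_pair p (g * k * Q2) (Q2' * (k' * g'))" by (intro inv_pair_mult g k Q2)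
    ultimately show ?thesis using IH(3,4) p' by (metis Suc_le_mono)
  qed
qed

section \<open>Exact sequences and block matrices\<close>

lemma scalar_prod_unit_right:
  fixes r n :: nat
  assumes "r < n" shows "(\<Sum>k = 0..<n. f k * (if k = r then 1 else 0 :: 'k::semiring_1)) = f r"
proof -
  have "(\<Sum>k = 0..<n. f k * (if k = r then 1 else 0)) = (\<Sum>k = 0..<n. if k = r then f k else 0)"
    by (intro sum.cong) auto
  also have "\<dots> = f r" using assms by (subst sum.delta) auto
  finally show ?thesis .
qed

lemma scalar_prod_unit_left:
  fixes r n :: nat
  assumes "r < n" shows "(\<Sum>k = 0..<n. (if k = r then 1 else 0 :: 'k::semiring_1) * f k) = f r"
proof -
  have "(\<Sum>k = 0..<n. (if k = r then 1 else 0) * f k) = (\<Sum>k = 0..<n. if k = r then f k else 0)"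
    by (intro sum.cong) auto
  also have "\<dots> = f r" using assms by (subst sum.delta) auto
  finally show ?thesis .
qed

text \<open>Together with \<open>quot_proj\<close> this is the model exact sequence, with the
  subspace in the last \<open>b\<close> coordinates and the quotient in the first
  \<open>a\<close>.\<close>

definition sub_incl :: "nat \<Rightarrow> nat \<Rightarrow> 'k::field mat" where
  "sub_incl a b = mat (a + b) b (\<lambda>(r, s). if r = a + s then 1 else 0)"

definition quot_proj :: "nat \<Rightarrow> nat \<Rightarrow> 'k::field mat" where
  "quot_proj a b = mat a (a + b) (\<lambda>(r, s). if s = r then 1 else 0)"

lemma incl_proj_carrier [simp, intro]:
  "sub_incl a b \<in> carrier_mat (a + b) b" "quot_proj a b \<in> carrier_mat a (a + b)"
  by (auto simp: sub_incl_def quot_proj_def)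

lemma mult_sub_incl:
  assumes "M \<in> carrier_mat n (a + b)"
  shows "M * sub_incl a b = mat n b (\<lambda>(r, s). M $$ (r, a + s))"
  using assms by (intro eq_matI) (auto simp: sub_incl_def scalar_prod_def scalar_prod_unit_right)

lemma quot_proj_mult:
  assumes "M \<in> carrier_mat (a + b) n"
  shows "quot_proj a b * M = mat a n (\<lambda>(r, s). M $$ (r, s))"
  using assms by (intro eq_matI) (auto simp: quot_proj_def scalar_prod_def scalar_prod_unit_left)

lemma sub_incl_mult:
  assumes "M \<in> carrier_mat b n"
  shows "sub_incl a b * M = mat (a + b) n (\<lambda>(r, s). if r < a then 0 else M $$ (r - a, s))"
proof -
  have *: "(sub_incl a b * M) $$ (r, s) = (if r < a then 0 else M $$ (r - a, s))"
    if rs: "r < a + b" "s < n" for r s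
  proof (cases "r < a")
    case True
    then show ?thesis using rs assms by (auto simp: sub_incl_def scalar_prod_def intro!: sum.neutral)
  next
    case False
    then have "(if r = a + k then 1 else 0) = (if k = r - a then 1 else (0::'a))" for k by auto
    then show ?thesis using rs assms False
      by (simp add: sub_incl_def scalar_prod_def scalar_prod_unit_left)
  qed
  show ?thesis using assms * by (intro eq_matI) (auto simp: sub_incl_def)
qed

lemma mult_quot_proj:
  assumes "M \<in> carrier_mat n a"
  shows "M * quot_proj a b = mat n (a + b) (\<lambda>(r, s). if s < a then M $$ (r, s) else 0)"
proof -
  have *: "(M * quot_proj a b) $$ (r, s) = (if s < a then M $$ (r, s) else 0)"
    if rs: "r < n" "s < a + b" for r s
  proof (cases "s < a")
    case True
    have "(if s = k then 1 else 0) = (if k = s then 1 else (0::'a))" for k by auto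
    then show ?thesis using rs assms True
      by (simp add: quot_proj_def scalar_prod_def scalar_prod_unit_right)
  next
    case False
    then show ?thesis using rs assms by (auto simp: quot_proj_def scalar_prod_def intro!: sum.neutral)
  qed
  show ?thesis using assms * by (intro eq_matI) (auto simp: quot_proj_def)
qed

lemma sub_incl_mult_vec:
  assumes "x \<in> carrier_vec b"
  shows "sub_incl a b *\<^sub>v x = vec (a + b) (\<lambda>r. if r < a then 0 else x $ (r - a))"
proof -
  have *: "(sub_incl a b *\<^sub>v x) $ r = (if r < a then 0 else x $ (r - a))"
    if r: "r < a + b" for r
  proof (cases "r < a")
    case True
    then show ?thesis using r assms by (auto simp: sub_incl_def scalar_prod_def intro!: sum.neutral)
  next
    case False
    then have "(if r = a + k then 1 else 0) = (if k = r - a then 1 else (0::'a))" for k by auto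
    then show ?thesis using r assms False
      by (simp add: sub_incl_def scalar_prod_def scalar_prod_unit_left)
  qed
  show ?thesis using assms * by (intro eq_vecI) (auto simp: sub_incl_def)
qed

lemma quot_proj_mult_vec:
  assumes "x \<in> carrier_vec (a + b)"
  shows "quot_proj a b *\<^sub>v x = vec a (\<lambda>r. x $ r)"
  using assms by (intro eq_vecI) (auto simp: quot_proj_def scalar_prod_def scalar_prod_unit_left)

text \<open>Every short exact sequence of vector spaces is a base change of the model. The inclusion
  involves \<open>g'\<close> and the projection its inverse \<open>g\<close>, which is why
  invertible matrices are kept in pairs.\<close>

lemma short_exact_mat_iff:
  fixes f :: "'k::field mat"
  assumes f: "f \<in> carrier_mat (a + b) b" and h: "h \<in> carrier_mat a (a + b)"
  shows "short_exact_mat f h \<longleftrightarrow>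
    (\<exists>g g'. inv_pair (a + b) g g' \<and> f = g' * sub_incl a b \<and> h = quot_proj a b * g)"
proof
  assume ex: "short_exact_mat f h"
  have inj: "x = 0\<^sub>v b" if "x \<in> carrier_vec b" "f *\<^sub>v x = 0\<^sub>v (a + b)" for x
  proof (rule inj_onD[of "\<lambda>v. f *\<^sub>v v" "carrier_vec b"])
    show "inj_on (\<lambda>v. f *\<^sub>v v) (carrier_vec b)" using ex f by (simp add: short_exact_mat_def)
    show "f *\<^sub>v x = f *\<^sub>v 0\<^sub>v b" using that f by auto
  qed (use that in auto)
  have ker: "h *\<^sub>v (f *\<^sub>v x) = 0\<^sub>v a" if "x \<in> carrier_vec b" for x
  proof -
    have "f *\<^sub>v x \<in> mat_kernel h" using ex f that unfolding short_exact_mat_def by auto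
    then show ?thesis using h by (auto simp: mat_kernel_def)
  qed
  have "\<exists>v\<in>carrier_vec (a + b). h *\<^sub>v v = unit_vec a l" for l
  proof -
    have "unit_vec a l \<in> (\<lambda>v. h *\<^sub>v v) ` carrier_vec (a + b)"
      using ex h unfolding short_exact_mat_def by auto
    then show ?thesis by auto
  qed
  then obtain v where v: "\<And>l. v l \<in> carrier_vec (a + b)" "\<And>l. h *\<^sub>v v l = unit_vec a l" by metis
  \<comment> \<open>A basis adapted to the sequence: lifts of the unit vectors of the quotient,
    followed by the columns of \<open>f\<close>.\<close>
  define g' where "g' = mat (a + b) (a + b) (\<lambda>(r, s). if s < a then v s $ r else f $$ (r, s - a))"
  have g': "g' \<in> carrier_mat (a + b) (a + b)" by (simp add: g'_def)
  have fg': "f = g' * sub_incl a b"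
    using f by (subst mult_sub_incl[OF g']) (auto simp: g'_def intro!: eq_matI)
  have hg': "h * g' = quot_proj a b"
  proof (intro eq_matI)
    fix r s assume "r < dim_row (quot_proj a b :: 'k mat)" "s < dim_col (quot_proj a b :: 'k mat)"
    then have rs: "r < a" "s < a + b" by (auto simp: quot_proj_def)
    have "(h * g') $$ (r, s) = (h *\<^sub>v col g' s) $ r" using h g' rs by auto
    also have "\<dots> = quot_proj a b $$ (r, s)"
    proof (cases "s < a")
      case True
      have "col g' s = v s" using v(1)[of s] True by (intro eq_vecI) (auto simp: g'_def)
      then show ?thesis using v(2)[of s] True rs by (auto simp: quot_proj_def)
    next
      case False
      have "col g' s = f *\<^sub>v unit_vec b (s - a)" using f rs False
        by (subst mat_mult_unit_vec[OF f]) (auto simp: g'_def intro!: eq_vecI)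
      then show ?thesis using ker[of "unit_vec b (s - a)"] False rs by (auto simp: quot_proj_def)
    qed
    finally show "(h * g') $$ (r, s) = quot_proj a b $$ (r, s)" .
  qed (use h g' in \<open>auto simp: quot_proj_def\<close>)
  have "x = 0\<^sub>v (a + b)" if x: "x \<in> carrier_vec (a + b)" "g' *\<^sub>v x = 0\<^sub>v (a + b)" for x
  proof -
    have "quot_proj a b *\<^sub>v x = h *\<^sub>v (g' *\<^sub>v x)"
      unfolding hg'[symmetric] using h g' x by (intro assoc_mult_mat_vec) auto
    also have "\<dots> = 0\<^sub>v a" using x h by auto
    finally have "vec a (\<lambda>r. x $ r) = 0\<^sub>v a" using quot_proj_mult_vec x by metis
    then have 1: "x $ r = 0" if "r < a" for r using that by (auto simp: vec_eq_iff)
    define y where "y = vec b (\<lambda>r. x $ (a + r))"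
    have y: "y \<in> carrier_vec b" by (simp add: y_def)
    have xy: "x = sub_incl a b *\<^sub>v y"
      using x(1) 1 by (subst sub_incl_mult_vec[OF y]) (auto simp: y_def intro!: eq_vecI)
    have "f *\<^sub>v y = g' *\<^sub>v (sub_incl a b *\<^sub>v y)"
      unfolding fg' using g' y by (intro assoc_mult_mat_vec) auto
    also have "\<dots> = 0\<^sub>v (a + b)" using x(2) xy by simp
    finally have "y = 0\<^sub>v b" using inj y by blast
    then show ?thesis using xy sub_incl_mult_vec[OF y] by (auto intro!: eq_vecI)
  qed
  from inv_pair_of_injective[OF g' this] obtain g where g: "inv_pair (a + b) g g'"
    using inv_pair_sym by blast
  have "h = quot_proj a b * g"
    using inv_pair_cancel_right[OF inv_pair_sym[OF g] h] hg' by simp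
  with g fg' show "\<exists>g g'. inv_pair (a + b) g g' \<and> f = g' * sub_incl a b \<and> h = quot_proj a b * g"
    by blast
next
  assume "\<exists>g g'. inv_pair (a + b) g g' \<and> f = g' * sub_incl a b \<and> h = quot_proj a b * g"
  then obtain g g' where g: "inv_pair (a + b) g g'" and fg: "f = g' * sub_incl a b"
    and hg: "h = quot_proj a b * g" by blast
  note gc = inv_pairD[OF g]
  have gf: "g *\<^sub>v (f *\<^sub>v x) = sub_incl a b *\<^sub>v x" if "x \<in> carrier_vec b" for x
  proof -
    have "g *\<^sub>v (f *\<^sub>v x) = (g * f) *\<^sub>v x" using gc f that by (intro assoc_mult_mat_vec[symmetric]) auto
    also have "g * f = sub_incl a b" unfolding fg by (intro inv_pair_cancel_left[OF g]) auto
    finally show ?thesis .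
  qed
  have hg': "h *\<^sub>v (g' *\<^sub>v x) = quot_proj a b *\<^sub>v x" if "x \<in> carrier_vec (a + b)" for x
  proof -
    have "h *\<^sub>v (g' *\<^sub>v x) = (h * g') *\<^sub>v x" using gc h that by (intro assoc_mult_mat_vec[symmetric]) auto
    also have "h * g' = quot_proj a b" unfolding hg by (intro inv_pair_cancel_right[OF g]) auto
    finally show ?thesis .
  qed
  have g'g: "g' *\<^sub>v (g *\<^sub>v x) = x" if "x \<in> carrier_vec (a + b)" for x
    using gc that by (subst assoc_mult_mat_vec[symmetric]) auto
  have "inj_on (\<lambda>v. f *\<^sub>v v) (carrier_vec b)"
  proof (rule inj_onI)
    fix x y :: "'k vec" assume xy: "x \<in> carrier_vec b" "y \<in> carrier_vec b" "f *\<^sub>v x = f *\<^sub>v y"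
    then have "sub_incl a b *\<^sub>v x = sub_incl a b *\<^sub>v y" using gf by metis
    then have eq: "(sub_incl a b *\<^sub>v x) $ (a + r) = (sub_incl a b *\<^sub>v y) $ (a + r)" for r by simp
    have "x $ r = y $ r" if "r < b" for r
      using eq[of r] xy that by (simp add: sub_incl_mult_vec)
    then show "x = y" using xy by (intro eq_vecI) auto
  qed
  moreover have "(\<lambda>v. f *\<^sub>v v) ` carrier_vec b = mat_kernel h"
  proof (intro equalityI subsetI)
    fix y assume "y \<in> (\<lambda>v. f *\<^sub>v v) ` carrier_vec b"
    then obtain x where x: "x \<in> carrier_vec b" "y = f *\<^sub>v x" by auto
    have y: "y = g' *\<^sub>v (sub_incl a b *\<^sub>v x)"
      unfolding x(2) fg using gc x(1) by (intro assoc_mult_mat_vec) auto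
    have "h *\<^sub>v y = quot_proj a b *\<^sub>v (sub_incl a b *\<^sub>v x)" unfolding y
      by (intro hg' mult_mat_vec_carrier[of _ _ b]) (use x in auto)
    also have "\<dots> = 0\<^sub>v a" using x(1)
      by (subst quot_proj_mult_vec) (auto simp: sub_incl_mult_vec intro!: eq_vecI)
    finally show "y \<in> mat_kernel h" using h f x by (auto simp: mat_kernel_def)
  next
    fix y assume "y \<in> mat_kernel h"
    then have y: "y \<in> carrier_vec (a + b)" "h *\<^sub>v y = 0\<^sub>v a" using h by (auto simp: mat_kernel_def)
    define z where "z = g *\<^sub>v y"
    have z: "z \<in> carrier_vec (a + b)" using gc y by (auto simp: z_def)
    have "vec a (\<lambda>r. z $ r) = 0\<^sub>v a"
      using hg'[OF z] y g'g[OF y(1)] quot_proj_mult_vec[OF z] by (simp add: z_def)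
    then have 1: "z $ r = 0" if "r < a" for r using that by (auto simp: vec_eq_iff)
    define x where "x = vec b (\<lambda>r. z $ (a + r))"
    have x: "x \<in> carrier_vec b" by (simp add: x_def)
    have "z = sub_incl a b *\<^sub>v x"
      using z 1 by (subst sub_incl_mult_vec[OF x]) (auto simp: x_def intro!: eq_vecI)
    then have "y = g' *\<^sub>v (sub_incl a b *\<^sub>v x)" using g'g[OF y(1)] by (simp add: z_def)
    also have "\<dots> = f *\<^sub>v x" unfolding fg using gc x by (intro assoc_mult_mat_vec[symmetric]) auto
    finally show "y \<in> (\<lambda>v. f *\<^sub>v v) ` carrier_vec b" using x by blast
  qed
  moreover have "(\<lambda>v. h *\<^sub>v v) ` carrier_vec (a + b) = carrier_vec a"
  proof (intro equalityI subsetI)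
    fix y :: "'k vec" assume y: "y \<in> carrier_vec a"
    define x where "x = vec (a + b) (\<lambda>r. if r < a then y $ r else 0)"
    have x: "x \<in> carrier_vec (a + b)" by (simp add: x_def)
    have "h *\<^sub>v (g' *\<^sub>v x) = y" using hg'[OF x] quot_proj_mult_vec[OF x] y
      by (auto simp: x_def intro!: eq_vecI)
    moreover have "g' *\<^sub>v x \<in> carrier_vec (a + b)" using gc x by auto
    ultimately show "y \<in> (\<lambda>v. h *\<^sub>v v) ` carrier_vec (a + b)" by blast
  qed (use h in auto)
  ultimately show "short_exact_mat f h" using f h by (simp add: short_exact_mat_def)
qed

text \<open>The first equation prescribes the last \<open>b\<close> columns of \<open>X\<close>, the
  second its first \<open>a'\<close> rows; only the lower left block stays free.\<close>

lemma block_triangular_iff: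
  fixes X :: "'k::field mat"
  assumes X: "X \<in> carrier_mat (a' + b') (a + b)" and A: "A \<in> carrier_mat a' a" and B: "B \<in> carrier_mat b' b"
  shows "X * sub_incl a b = sub_incl a' b' * B \<and> quot_proj a' b' * X = A * quot_proj a b \<longleftrightarrow>
    (\<exists>C\<in>carrier_mat b' a. X = four_block_mat A (0\<^sub>m a' b) C B)"
proof
  assume *: "X * sub_incl a b = sub_incl a' b' * B \<and> quot_proj a' b' * X = A * quot_proj a b"
  have 1: "X $$ (r, a + s) = (if r < a' then 0 else B $$ (r - a', s))" if "r < a' + b'" "s < b" for r s
    using arg_cong[OF conjunct1[OF *], of "\<lambda>M. M $$ (r, s)"] that
    by (simp add: mult_sub_incl[OF X] sub_incl_mult[OF B])
  have 2: "X $$ (r, s) = (if s < a then A $$ (r, s) else 0)" if "r < a'" "s < a + b" for r s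
    using arg_cong[OF conjunct2[OF *], of "\<lambda>M. M $$ (r, s)"] that
    by (simp add: mult_quot_proj[OF A] quot_proj_mult[OF X])
  have "X = four_block_mat A (0\<^sub>m a' b) (mat b' a (\<lambda>(r, s). X $$ (a' + r, s))) B"
  proof (intro eq_matI)
    fix r s assume "r < dim_row (four_block_mat A (0\<^sub>m a' b) (mat b' a (\<lambda>(r, s). X $$ (a' + r, s))) B)"
      "s < dim_col (four_block_mat A (0\<^sub>m a' b) (mat b' a (\<lambda>(r, s). X $$ (a' + r, s))) B)"
    then have "r < a' + b'" "s < a + b" using A B by auto
    then show "X $$ (r, s) = four_block_mat A (0\<^sub>m a' b) (mat b' a (\<lambda>(r, s). X $$ (a' + r, s))) B $$ (r, s)"
      using A B 1[of r "s - a"] 2[of r s] by auto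
  qed (use X A B in auto)
  then show "\<exists>C\<in>carrier_mat b' a. X = four_block_mat A (0\<^sub>m a' b) C B" by (metis mat_carrier)
next
  assume "\<exists>C\<in>carrier_mat b' a. X = four_block_mat A (0\<^sub>m a' b) C B"
  then obtain C where C: "C \<in> carrier_mat b' a" "X = four_block_mat A (0\<^sub>m a' b) C B" by blast
  show "X * sub_incl a b = sub_incl a' b' * B \<and> quot_proj a' b' * X = A * quot_proj a b"
    using A B C(1) unfolding mult_sub_incl[OF X] sub_incl_mult[OF B] mult_quot_proj[OF A] quot_proj_mult[OF X]
    by (auto simp: C(2) intro!: eq_matI)
qed

lemma intertwining_iff:
  fixes X :: "'k::field mat"
  assumes X: "X \<in> carrier_mat (a' + b') (a + b)" and A: "A \<in> carrier_mat a' a" and B: "B \<in> carrier_mat b' b"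
    and g: "inv_pair (a + b) g g'" and h: "inv_pair (a' + b') h h'"
  shows "h' * sub_incl a' b' * B = X * (g' * sub_incl a b) \<and>
      quot_proj a' b' * h * X = A * (quot_proj a b * g) \<longleftrightarrow>
    (\<exists>C\<in>carrier_mat b' a. X = h' * four_block_mat A (0\<^sub>m a' b) C B * g)"
proof -
  note c = inv_pairD[OF g] inv_pairD[OF h] X A B
  \<comment> \<open>In the coordinates given by \<open>g\<close> and \<open>h\<close> both sequences
    are the model ones, which reduces the claim to \<open>block_triangular_iff\<close>.\<close>
  define T where "T = h * X * g'"
  have T: "T \<in> carrier_mat (a' + b') (a + b)" using c by (auto simp: T_def)
  have XT: "X = h' * T * g"
  proof -
    have "h' * T = h' * (h * (X * g'))" unfolding T_def using c by (subst assoc_mult_mat[of h]) auto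
    also have "\<dots> = X * g'" using c by (intro inv_pair_cancel_left[OF inv_pair_sym[OF h]]) auto
    finally show ?thesis using inv_pair_cancel_right[OF inv_pair_sym[OF g] X] by simp
  qed
  have "h' * sub_incl a' b' * B = X * (g' * sub_incl a b) \<longleftrightarrow> T * sub_incl a b = sub_incl a' b' * B"
  proof -
    have 1: "T * sub_incl a b = h * (X * (g' * sub_incl a b))"
    proof -
      have "T * sub_incl a b = h * (X * g') * sub_incl a b"
        unfolding T_def using c by (subst assoc_mult_mat[of h]) auto
      also have "\<dots> = h * (X * g' * sub_incl a b)" using c by (intro assoc_mult_mat) auto
      also have "X * g' * sub_incl a b = X * (g' * sub_incl a b)" using c by (intro assoc_mult_mat) auto
      finally show ?thesis .
    qed
    have 2: "h' * sub_incl a' b' * B = h' * (sub_incl a' b' * B)" using c by (intro assoc_mult_mat) auto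
    have 3: "h' * (h * (X * (g' * sub_incl a b))) = X * (g' * sub_incl a b)"
      using c by (intro inv_pair_cancel_left[OF inv_pair_sym[OF h]] mult_carrier_mat) auto
    have 4: "h * (h' * (sub_incl a' b' * B)) = sub_incl a' b' * B"
      using c by (intro inv_pair_cancel_left[OF h] mult_carrier_mat) auto
    show ?thesis using 1 2 3 4 by metis
  qed
  moreover have "quot_proj a' b' * h * X = A * (quot_proj a b * g) \<longleftrightarrow> quot_proj a' b' * T = A * quot_proj a b"
  proof -
    have 1: "quot_proj a' b' * T = quot_proj a' b' * h * X * g'"
    proof -
      have "quot_proj a' b' * T = quot_proj a' b' * (h * X) * g'"
        unfolding T_def using c by (intro assoc_mult_mat[symmetric]) auto
      also have "quot_proj a' b' * (h * X) = quot_proj a' b' * h * X"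
        using c by (intro assoc_mult_mat[symmetric]) auto
      finally show ?thesis .
    qed
    have 2: "A * (quot_proj a b * g) = A * quot_proj a b * g" using c by (intro assoc_mult_mat[symmetric]) auto
    have 3: "quot_proj a' b' * h * X * g' * g = quot_proj a' b' * h * X"
      using c by (intro inv_pair_cancel_right[OF inv_pair_sym[OF g]] mult_carrier_mat) auto
    have 4: "A * quot_proj a b * g * g' = A * quot_proj a b"
      using c by (intro inv_pair_cancel_right[OF g] mult_carrier_mat) auto
    show ?thesis using 1 2 3 4 by metis
  qed
  moreover have "X = h' * M * g \<longleftrightarrow> T = M" if "M \<in> carrier_mat (a' + b') (a + b)" for M
  proof
    assume "X = h' * M * g"
    then have "T = h * (h' * M * g) * g'" by (simp add: T_def)
    also have "h * (h' * M * g) = h * (h' * (M * g))" using c that by (subst assoc_mult_mat) auto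
    also have "\<dots> = M * g" using c that by (intro inv_pair_cancel_left[OF h]) auto
    also have "M * g * g' = M" by (rule inv_pair_cancel_right[OF g that])
    finally show "T = M" .
  qed (use XT in simp)
  ultimately show ?thesis using block_triangular_iff[OF T A B] A B four_block_carrier_mat[OF A B]
    by simp
qed

section \<open>Associativity, units and duality of the extension product\<close>

definition act :: "'k::field mat \<Rightarrow> 'k krep \<Rightarrow> 'k mat \<Rightarrow> 'k krep" where
  "act h X g = (h * fst X * g, h * snd X * g)"

text \<open>The right factor \<open>g\<close> itself, rather than its inverse, ranges over the
  invertible matrices; the orbits are the same.\<close>

definition rep_iso :: "dimvec \<Rightarrow> 'k::field krep \<Rightarrow> 'k krep \<Rightarrow> bool" where
  "rep_iso \<alpha> X Y \<longleftrightarrow> Y \<in> Rep \<alpha> \<and>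
     (\<exists>h h' g g'. inv_pair (snd \<alpha>) h h' \<and> inv_pair (fst \<alpha>) g g' \<and> X = act h Y g)"

text \<open>The subrepresentation \<open>B\<close> occupies the last coordinates.\<close>

definition rep_block :: "'k::field krep \<Rightarrow> 'k krep \<Rightarrow> 'k krep \<Rightarrow> 'k krep" where
  "rep_block A C B =
     (four_block_mat (fst A) (0\<^sub>m (dim_row (fst A)) (dim_col (fst B))) (fst C) (fst B),
      four_block_mat (snd A) (0\<^sub>m (dim_row (snd A)) (dim_col (snd B))) (snd C) (snd B))"

lemma Rep_iff: "X \<in> Rep \<alpha> \<longleftrightarrow>
    fst X \<in> carrier_mat (snd \<alpha>) (fst \<alpha>) \<and> snd X \<in> carrier_mat (snd \<alpha>) (fst \<alpha>)"
  by (cases X) (simp add: Rep_def)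

lemma Rep_dim_unique:
  assumes "X \<in> Rep \<alpha>" "X \<in> Rep \<beta>" shows "\<alpha> = \<beta>"
  using assms by (auto simp: Rep_iff prod_eq_iff)

lemma Rep_nonempty: "Rep \<alpha> \<noteq> ({} :: 'k::zero krep set)"
proof -
  have "(0\<^sub>m (snd \<alpha>) (fst \<alpha>), 0\<^sub>m (snd \<alpha>) (fst \<alpha>)) \<in> (Rep \<alpha> :: 'k krep set)" by (simp add: Rep_iff)
  then show ?thesis by blast
qed

lemma dim_add_simps [simp]:
  "fst (dim_add \<alpha> \<beta>) = fst \<alpha> + fst \<beta>" "snd (dim_add \<alpha> \<beta>) = snd \<alpha> + snd \<beta>"
  by (simp_all add: dim_add_def)

lemma dim_add_assoc: "dim_add (dim_add \<alpha> \<beta>) \<gamma> = dim_add \<alpha> (dim_add \<beta> \<gamma>)"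
  by (simp add: dim_add_def)

lemma act_in_Rep:
  assumes "h \<in> carrier_mat (snd \<alpha>) (snd \<alpha>)" "X \<in> Rep \<alpha>" "g \<in> carrier_mat (fst \<alpha>) (fst \<alpha>)"
  shows "act h X g \<in> Rep \<alpha>"
  using assms by (auto simp: act_def Rep_iff)

lemma act_act:
  assumes "X \<in> Rep \<alpha>"
    and "h \<in> carrier_mat (snd \<alpha>) (snd \<alpha>)" "k \<in> carrier_mat (snd \<alpha>) (snd \<alpha>)"
    and "g \<in> carrier_mat (fst \<alpha>) (fst \<alpha>)" "l \<in> carrier_mat (fst \<alpha>) (fst \<alpha>)"
  shows "act h (act k X g) l = act (h * k) X (g * l)"
proof -
  have "h * (k * M * g) * l = h * k * M * (g * l)" if M: "M \<in> carrier_mat (snd \<alpha>) (fst \<alpha>)" for M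
  proof -
    have "h * (k * M * g) * l = h * (k * M * g * l)" using assms M by (intro assoc_mult_mat) auto
    also have "k * M * g * l = k * M * (g * l)" using assms M by (intro assoc_mult_mat) auto
    also have "\<dots> = k * (M * (g * l))" using assms M by (intro assoc_mult_mat) auto
    also have "h * \<dots> = h * k * (M * (g * l))" using assms M by (intro assoc_mult_mat[symmetric]) auto
    also have "\<dots> = h * k * M * (g * l)" using assms M by (intro assoc_mult_mat[symmetric]) auto
    finally show ?thesis .
  qed
  from this[of "fst X"] this[of "snd X"] show ?thesis using assms(1) by (simp add: act_def Rep_iff)
qed

lemma act_one: "X \<in> Rep \<alpha> \<Longrightarrow> act (1\<^sub>m (snd \<alpha>)) X (1\<^sub>m (fst \<alpha>)) = X"
  by (auto simp: act_def Rep_iff prod_eq_iff)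

lemma rep_iso_refl: "X \<in> Rep \<alpha> \<Longrightarrow> rep_iso \<alpha> X X"
  unfolding rep_iso_def using act_one[of X \<alpha>] inv_pair_one by metis

lemma rep_iso_Rep:
  assumes "rep_iso \<alpha> X Y" shows "X \<in> Rep \<alpha>" "Y \<in> Rep \<alpha>"
  using assms act_in_Rep inv_pairD(1) unfolding rep_iso_def by blast+

lemma rep_iso_sym:
  assumes "rep_iso \<alpha> X Y" shows "rep_iso \<alpha> Y X"
proof -
  from assms obtain h h' g g' where *: "Y \<in> Rep \<alpha>" "inv_pair (snd \<alpha>) h h'" "inv_pair (fst \<alpha>) g g'"
    "X = act h Y g" unfolding rep_iso_def by blast
  have "act h' X g' = act (h' * h) Y (g * g')" unfolding *(4)
    using inv_pairD[OF *(2)] inv_pairD[OF *(3)] by (intro act_act[OF *(1)]) auto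
  also have "\<dots> = Y" using inv_pairD[OF *(2)] inv_pairD[OF *(3)] act_one[OF *(1)] by simp
  finally have "Y = act h' X g'" by simp
  then show ?thesis
    using rep_iso_Rep[OF assms] inv_pair_sym[OF *(2)] inv_pair_sym[OF *(3)] unfolding rep_iso_def by blast
qed

lemma rep_iso_trans:
  assumes "rep_iso \<alpha> X Y" "rep_iso \<alpha> Y Z" shows "rep_iso \<alpha> X Z"
proof -
  from assms(1) obtain h h' g g' where 1: "inv_pair (snd \<alpha>) h h'" "inv_pair (fst \<alpha>) g g'"
    "X = act h Y g" unfolding rep_iso_def by blast
  from assms(2) obtain k k' l l' where 2: "Z \<in> Rep \<alpha>" "inv_pair (snd \<alpha>) k k'" "inv_pair (fst \<alpha>) l l'"
    "Y = act k Z l" unfolding rep_iso_def by blast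
  have "X = act (h * k) Z (l * g)" unfolding 1(3) 2(4)
    using inv_pairD[OF 1(1)] inv_pairD[OF 1(2)] inv_pairD[OF 2(2)] inv_pairD[OF 2(3)]
    by (intro act_act[OF 2(1)]) auto
  then show ?thesis using inv_pair_mult[OF 1(1) 2(2)] inv_pair_mult[OF 2(3) 1(2)] 2(1)
    unfolding rep_iso_def by blast
qed

lemma rep_block_in_Rep:
  assumes "A \<in> Rep \<alpha>" "B \<in> Rep \<beta>"
  shows "rep_block A C B \<in> Rep (dim_add \<alpha> \<beta>)"
  using assms by (auto simp: rep_block_def Rep_iff)

text \<open>Adapted bases at both vertices turn an exact sequence into a pair of block triangular
  matrices. Associativity, the unit laws and duality are read off this form.\<close>

lemma is_extension_iff:
  assumes A: "A \<in> Rep \<alpha>" and B: "B \<in> Rep \<beta>" and X: "X \<in> Rep (dim_add \<alpha> \<beta>)"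
  shows "is_extension \<alpha> \<beta> A B X \<longleftrightarrow>
    (\<exists>C\<in>Rep (fst \<alpha>, snd \<beta>). rep_iso (dim_add \<alpha> \<beta>) X (rep_block A C B))"
proof -
  obtain ai aj bi bj where \<alpha>: "\<alpha> = (ai, aj)" and \<beta>: "\<beta> = (bi, bj)" by fastforce
  obtain A1 A2 B1 B2 X1 X2 where pairs: "A = (A1, A2)" "B = (B1, B2)" "X = (X1, X2)" by fastforce
  have c: "A1 \<in> carrier_mat aj ai" "A2 \<in> carrier_mat aj ai" "B1 \<in> carrier_mat bj bi" "B2 \<in> carrier_mat bj bi"
    "X1 \<in> carrier_mat (aj + bj) (ai + bi)" "X2 \<in> carrier_mat (aj + bj) (ai + bi)"
    using A B X by (auto simp: \<alpha> \<beta> pairs Rep_iff)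
  have "is_extension \<alpha> \<beta> A B X \<longleftrightarrow>
    (\<exists>g g' h h'. inv_pair (ai + bi) g g' \<and> inv_pair (aj + bj) h h' \<and>
      (h' * sub_incl aj bj * B1 = X1 * (g' * sub_incl ai bi) \<and>
       quot_proj aj bj * h * X1 = A1 * (quot_proj ai bi * g)) \<and>
      (h' * sub_incl aj bj * B2 = X2 * (g' * sub_incl ai bi) \<and>
       quot_proj aj bj * h * X2 = A2 * (quot_proj ai bi * g)))" (is "_ \<longleftrightarrow> ?R")
  proof
    assume "is_extension \<alpha> \<beta> A B X"
    then obtain f1 f2 p1 p2 where *: "(f1, f2) \<in> krep_hom \<beta> (dim_add \<alpha> \<beta>) B X"
      "(p1, p2) \<in> krep_hom (dim_add \<alpha> \<beta>) \<alpha> X A" "short_exact_mat f1 p1" "short_exact_mat f2 p2"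
      unfolding is_extension_def by fastforce
    then have d: "f1 \<in> carrier_mat (ai + bi) bi" "f2 \<in> carrier_mat (aj + bj) bj"
      "p1 \<in> carrier_mat ai (ai + bi)" "p2 \<in> carrier_mat aj (aj + bj)"
      "f2 * B1 = X1 * f1" "f2 * B2 = X2 * f1" "p2 * X1 = A1 * p1" "p2 * X2 = A2 * p1"
      by (auto simp: krep_hom_def \<alpha> \<beta> pairs)
    from *(3)[unfolded short_exact_mat_iff[OF d(1,3)]] *(4)[unfolded short_exact_mat_iff[OF d(2,4)]]
    obtain g g' h h' where "inv_pair (ai + bi) g g'" "inv_pair (aj + bj) h h'"
      "f1 = g' * sub_incl ai bi" "p1 = quot_proj ai bi * g" "f2 = h' * sub_incl aj bj" "p2 = quot_proj aj bj * h"
      by blast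
    with d show ?R by blast
  next
    assume ?R
    then obtain g g' h h' where *: "inv_pair (ai + bi) g g'" "inv_pair (aj + bj) h h'"
      "h' * sub_incl aj bj * B1 = X1 * (g' * sub_incl ai bi)"
      "quot_proj aj bj * h * X1 = A1 * (quot_proj ai bi * g)"
      "h' * sub_incl aj bj * B2 = X2 * (g' * sub_incl ai bi)"
      "quot_proj aj bj * h * X2 = A2 * (quot_proj ai bi * g)" by blast
    note gc = inv_pairD[OF *(1)] inv_pairD[OF *(2)]
    have d: "g' * sub_incl ai bi \<in> carrier_mat (ai + bi) bi" "h' * sub_incl aj bj \<in> carrier_mat (aj + bj) bj"
      "quot_proj ai bi * g \<in> carrier_mat ai (ai + bi)" "quot_proj aj bj * h \<in> carrier_mat aj (aj + bj)"
      using mult_carrier_mat[OF gc(2) incl_proj_carrier(1)] mult_carrier_mat[OF gc(6) incl_proj_carrier(1)]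
        mult_carrier_mat[OF incl_proj_carrier(2) gc(1)] mult_carrier_mat[OF incl_proj_carrier(2) gc(5)] by simp_all
    have "short_exact_mat (g' * sub_incl ai bi) (quot_proj ai bi * g)"
      "short_exact_mat (h' * sub_incl aj bj) (quot_proj aj bj * h)"
      using * short_exact_mat_iff[OF d(1,3)] short_exact_mat_iff[OF d(2,4)] by blast+
    moreover have "(g' * sub_incl ai bi, h' * sub_incl aj bj) \<in> krep_hom \<beta> (dim_add \<alpha> \<beta>) B X"
      "(quot_proj ai bi * g, quot_proj aj bj * h) \<in> krep_hom (dim_add \<alpha> \<beta>) \<alpha> X A"
      using * d by (auto simp: krep_hom_def \<alpha> \<beta> pairs)
    ultimately show "is_extension \<alpha> \<beta> A B X" unfolding is_extension_def
      by (metis fst_conv snd_conv)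
  qed
  also have "\<dots> \<longleftrightarrow> (\<exists>g g' h h'. inv_pair (ai + bi) g g' \<and> inv_pair (aj + bj) h h' \<and>
      (\<exists>C\<in>carrier_mat bj ai. X1 = h' * four_block_mat A1 (0\<^sub>m aj bi) C B1 * g) \<and>
      (\<exists>C\<in>carrier_mat bj ai. X2 = h' * four_block_mat A2 (0\<^sub>m aj bi) C B2 * g))"
    using intertwining_iff[OF c(5,1,3)] intertwining_iff[OF c(6,2,4)]
    by (intro ex_cong1 conj_cong refl) blast+
  also have "\<dots> \<longleftrightarrow> (\<exists>C\<in>Rep (fst \<alpha>, snd \<beta>). rep_iso (dim_add \<alpha> \<beta>) X (rep_block A C B))" (is "?L \<longleftrightarrow> ?R")
  proof
    assume ?L
    then obtain g g' h h' C1 C2 where *: "inv_pair (ai + bi) g g'" "inv_pair (aj + bj) h h'"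
      "C1 \<in> carrier_mat bj ai" "X1 = h' * four_block_mat A1 (0\<^sub>m aj bi) C1 B1 * g"
      "C2 \<in> carrier_mat bj ai" "X2 = h' * four_block_mat A2 (0\<^sub>m aj bi) C2 B2 * g" by blast
    have "X = act h' (rep_block A (C1, C2) B) g" using * c by (simp add: act_def rep_block_def pairs)
    then have "rep_iso (dim_add \<alpha> \<beta>) X (rep_block A (C1, C2) B)"
      using * rep_block_in_Rep[OF A B] inv_pair_sym[OF *(2)]
      unfolding rep_iso_def \<alpha> \<beta> dim_add_simps fst_conv snd_conv by blast
    then show ?R using * by (intro bexI[of _ "(C1, C2)"]) (auto simp: \<alpha> \<beta> Rep_iff)
  next
    assume ?R
    then obtain C where C: "C \<in> Rep (fst \<alpha>, snd \<beta>)" "rep_iso (dim_add \<alpha> \<beta>) X (rep_block A C B)" by blast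
    obtain C1 C2 where CC: "C = (C1, C2)" by fastforce
    from C(2) obtain h h' g g' where *: "inv_pair (aj + bj) h h'" "inv_pair (ai + bi) g g'"
       "X = act h (rep_block A C B) g" unfolding rep_iso_def \<alpha> \<beta> dim_add_simps fst_conv snd_conv by blast
    have "X1 = h * four_block_mat A1 (0\<^sub>m aj bi) C1 B1 * g" "X2 = h * four_block_mat A2 (0\<^sub>m aj bi) C2 B2 * g"
      using *(3) c by (simp_all add: act_def rep_block_def pairs CC)
    moreover have "C1 \<in> carrier_mat bj ai" "C2 \<in> carrier_mat bj ai" using C(1) by (auto simp: CC Rep_iff \<alpha> \<beta>)
    ultimately show ?L using *(2) inv_pair_sym[OF *(1)] by blast
  qed
  finally show ?thesis .
qed

lemma ext_prod_iff:
  "X \<in> ext_prod S T \<longleftrightarrow> (\<exists>\<alpha> \<beta> A B C. A \<in> S \<inter> Rep \<alpha> \<and> B \<in> T \<inter> Rep \<beta> \<and> C \<in> Rep (fst \<alpha>, snd \<beta>) \<and>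
     rep_iso (dim_add \<alpha> \<beta>) X (rep_block A C B))" (is "_ \<longleftrightarrow> ?R")
proof
  assume "X \<in> ext_prod S T"
  then show ?R unfolding ext_prod_def using is_extension_iff by fast
next
  assume ?R
  then obtain \<alpha> \<beta> A B C where *: "A \<in> S \<inter> Rep \<alpha>" "B \<in> T \<inter> Rep \<beta>" "C \<in> Rep (fst \<alpha>, snd \<beta>)"
     "rep_iso (dim_add \<alpha> \<beta>) X (rep_block A C B)" by blast
  moreover have "X \<in> Rep (dim_add \<alpha> \<beta>)" by (rule rep_iso_Rep[OF *(4)])
  ultimately show "X \<in> ext_prod S T" unfolding ext_prod_def using is_extension_iff[of A \<alpha> B \<beta> X] by blast
qed

lemma ext_prod_mono: "S \<subseteq> S' \<Longrightarrow> T \<subseteq> T' \<Longrightarrow> ext_prod S T \<subseteq> ext_prod S' T'"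
  unfolding ext_prod_def by blast

lemma block_diag_conj:
  fixes A :: "'k::field mat"
  assumes "h \<in> carrier_mat a' a'" "k \<in> carrier_mat b' b'" "g \<in> carrier_mat a a" "l \<in> carrier_mat b b"
    "A \<in> carrier_mat a' a" "C \<in> carrier_mat b' a" "B \<in> carrier_mat b' b"
  shows "four_block_mat h (0\<^sub>m a' b') (0\<^sub>m b' a') k * four_block_mat A (0\<^sub>m a' b) C B *
      four_block_mat g (0\<^sub>m a b) (0\<^sub>m b a) l =
    four_block_mat (h * A * g) (0\<^sub>m a' b) (k * C * g) (k * B * l)"
proof -
  have "four_block_mat h (0\<^sub>m a' b') (0\<^sub>m b' a') k * four_block_mat A (0\<^sub>m a' b) C B =
    four_block_mat (h * A) (0\<^sub>m a' b) (k * C) (k * B)"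
    using assms by (subst mult_four_block_mat[where ?nr1.0=a' and ?nr2.0=b' and ?n1.0=a' and ?n2.0=b'
      and ?nc1.0=a and ?nc2.0=b]) auto
  also have "\<dots> * four_block_mat g (0\<^sub>m a b) (0\<^sub>m b a) l =
    four_block_mat (h * A * g) (0\<^sub>m a' b) (k * C * g) (k * B * l)"
    using assms by (subst mult_four_block_mat[where ?nr1.0=a' and ?nr2.0=b' and ?n1.0=a and ?n2.0=b
      and ?nc1.0=a and ?nc2.0=b]) auto
  finally show ?thesis .
qed

lemma rep_iso_block:
  assumes A: "rep_iso \<alpha> A A'" and B: "rep_iso \<beta> B B'" and C: "C \<in> Rep (fst \<alpha>, snd \<beta>)"
  shows "\<exists>C'\<in>Rep (fst \<alpha>, snd \<beta>). rep_iso (dim_add \<alpha> \<beta>) (rep_block A C B) (rep_block A' C' B')"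
proof -
  obtain h h' g g' where a: "A' \<in> Rep \<alpha>" "inv_pair (snd \<alpha>) h h'" "inv_pair (fst \<alpha>) g g'"
    "A = act h A' g" using A unfolding rep_iso_def by blast
  obtain k k' l l' where b: "B' \<in> Rep \<beta>" "inv_pair (snd \<beta>) k k'" "inv_pair (fst \<beta>) l l'"
    "B = act k B' l" using B unfolding rep_iso_def by blast
  define H where "H = four_block_mat h (0\<^sub>m (snd \<alpha>) (snd \<beta>)) (0\<^sub>m (snd \<beta>) (snd \<alpha>)) k"
  define G where "G = four_block_mat g (0\<^sub>m (fst \<alpha>) (fst \<beta>)) (0\<^sub>m (fst \<beta>) (fst \<alpha>)) l"
  have "\<exists>H'. inv_pair (snd \<alpha> + snd \<beta>) H H'" "\<exists>G'. inv_pair (fst \<alpha> + fst \<beta>) G G'"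
    unfolding H_def G_def using inv_pair_four_block[OF a(2) b(2)] inv_pair_four_block[OF a(3) b(3)]
    by (meson zero_carrier_mat)+
  \<comment> \<open>The corner for which \<open>act k C' g\<close> is \<open>C\<close>.\<close>
  moreover define C' where "C' = act k' C g'"
  note c = inv_pairD[OF a(2)] inv_pairD[OF b(2)] inv_pairD[OF a(3)] inv_pairD[OF b(3)]
  have C': "C' \<in> Rep (fst \<alpha>, snd \<beta>)" unfolding C'_def using C c by (intro act_in_Rep) auto
  have "act k C' g = act (k * k') C (g' * g)" unfolding C'_def using C c by (intro act_act[OF C]) auto
  then have CC: "C = act k C' g" using act_one[OF C] c by simp
  have "rep_block A C B = act H (rep_block A' C' B') G"
  proof -
    have "fst A' \<in> carrier_mat (snd \<alpha>) (fst \<alpha>)" "snd A' \<in> carrier_mat (snd \<alpha>) (fst \<alpha>)"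
      "fst B' \<in> carrier_mat (snd \<beta>) (fst \<beta>)" "snd B' \<in> carrier_mat (snd \<beta>) (fst \<beta>)"
      "fst C' \<in> carrier_mat (snd \<beta>) (fst \<alpha>)" "snd C' \<in> carrier_mat (snd \<beta>) (fst \<alpha>)"
      using a(1) b(1) C' by (auto simp: Rep_iff)
    note d = this and d' = this[THEN carrier_matD(1)] this[THEN carrier_matD(2)]
    note conj = block_diag_conj[OF c(1) c(5) c(9) c(13)]
    show ?thesis using c d'
      unfolding CC a(4) b(4) rep_block_def act_def H_def G_def fst_conv snd_conv
      by (simp add: conj[OF d(1,5,3), symmetric] conj[OF d(2,6,4), symmetric])
  qed
  ultimately show ?thesis using C' rep_block_in_Rep[OF a(1) b(1)] unfolding rep_iso_def by fastforce
qed

text \<open>Both bracketings are one three by three block triangular matrix, cut in two ways: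
  \<open>F\<close> stacks \<open>C\<close> on the left part of \<open>E\<close>, and
  \<open>G\<close> is the right part of \<open>E\<close>.\<close>

lemma rep_block_assoc1:
  assumes "A \<in> Rep \<alpha>" "B \<in> Rep \<beta>" "D \<in> Rep \<gamma>"
    "C \<in> Rep (fst \<alpha>, snd \<beta>)" "E \<in> Rep (fst \<alpha> + fst \<beta>, snd \<gamma>)"
  shows "\<exists>F\<in>Rep (fst \<alpha>, snd \<beta> + snd \<gamma>). \<exists>G\<in>Rep (fst \<beta>, snd \<gamma>).
    rep_block (rep_block A C B) E D = rep_block A F (rep_block B G D)"
proof -
  let ?F = "\<lambda>C E :: 'a mat. mat (snd \<beta> + snd \<gamma>) (fst \<alpha>)
    (\<lambda>(r, s). if r < snd \<beta> then C $$ (r, s) else E $$ (r - snd \<beta>, s))"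
  let ?G = "\<lambda>E :: 'a mat. mat (snd \<gamma>) (fst \<beta>) (\<lambda>(r, s). E $$ (r, fst \<alpha> + s))"
  have "rep_block (rep_block A C B) E D =
    rep_block A (?F (fst C) (fst E), ?F (snd C) (snd E)) (rep_block B (?G (fst E), ?G (snd E)) D)"
    using assms by (auto simp: rep_block_def Rep_iff intro!: eq_matI)
  then show ?thesis by (intro bexI) (auto simp: Rep_iff)
qed

lemma rep_block_assoc2:
  assumes "A \<in> Rep \<alpha>" "B \<in> Rep \<beta>" "D \<in> Rep \<gamma>"
    "F \<in> Rep (fst \<alpha>, snd \<beta> + snd \<gamma>)" "G \<in> Rep (fst \<beta>, snd \<gamma>)"
  shows "\<exists>C\<in>Rep (fst \<alpha>, snd \<beta>). \<exists>E\<in>Rep (fst \<alpha> + fst \<beta>, snd \<gamma>).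
    rep_block A F (rep_block B G D) = rep_block (rep_block A C B) E D"
proof -
  let ?C = "\<lambda>F :: 'a mat. mat (snd \<beta>) (fst \<alpha>) (\<lambda>(r, s). F $$ (r, s))"
  let ?E = "\<lambda>F G :: 'a mat. mat (snd \<gamma>) (fst \<alpha> + fst \<beta>)
    (\<lambda>(r, s). if s < fst \<alpha> then F $$ (snd \<beta> + r, s) else G $$ (r, s - fst \<alpha>))"
  have "rep_block A F (rep_block B G D) =
    rep_block (rep_block A (?C (fst F), ?C (snd F)) B) (?E (fst F) (fst G), ?E (snd F) (snd G)) D"
    using assms by (auto simp: rep_block_def Rep_iff intro!: eq_matI)
  then show ?thesis by (intro bexI) (auto simp: Rep_iff)
qed

text \<open>The inner extension \<open>Y\<close> is only isomorphic to a block matrix, so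
  \<open>rep_iso_block\<close> replaces it before the blocks are regrouped.\<close>

lemma ext_prod_assoc: "ext_prod (ext_prod S T) U = ext_prod S (ext_prod T U)"
proof (intro equalityI subsetI)
  fix X assume "X \<in> ext_prod (ext_prod S T) U"
  then obtain \<delta> \<gamma> Y D E where 1: "Y \<in> ext_prod S T" "Y \<in> Rep \<delta>" "D \<in> U" "D \<in> Rep \<gamma>"
    "E \<in> Rep (fst \<delta>, snd \<gamma>)" "rep_iso (dim_add \<delta> \<gamma>) X (rep_block Y E D)"
    unfolding ext_prod_iff[of X] by blast
  from 1(1) obtain \<alpha> \<beta> A B C where 2: "A \<in> S" "A \<in> Rep \<alpha>" "B \<in> T" "B \<in> Rep \<beta>" "C \<in> Rep (fst \<alpha>, snd \<beta>)"
     "rep_iso (dim_add \<alpha> \<beta>) Y (rep_block A C B)" unfolding ext_prod_iff by blast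
  have \<delta>: "\<delta> = dim_add \<alpha> \<beta>" using Rep_dim_unique[OF 1(2) rep_iso_Rep(1)[OF 2(6)]] .
  obtain E' where E': "E' \<in> Rep (fst \<delta>, snd \<gamma>)"
    "rep_iso (dim_add \<delta> \<gamma>) (rep_block Y E D) (rep_block (rep_block A C B) E' D)"
    using rep_iso_block[OF 2(6)[folded \<delta>] rep_iso_refl[OF 1(4)] 1(5)] by blast
  obtain F G where FG: "F \<in> Rep (fst \<alpha>, snd \<beta> + snd \<gamma>)" "G \<in> Rep (fst \<beta>, snd \<gamma>)"
    "rep_block (rep_block A C B) E' D = rep_block A F (rep_block B G D)"
    using rep_block_assoc1[OF 2(2,4) 1(4) 2(5) E'(1)[unfolded \<delta> dim_add_simps]] by blast
  have "rep_block B G D \<in> ext_prod T U"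
    unfolding ext_prod_iff using rep_iso_refl[OF rep_block_in_Rep[OF 2(4) 1(4)]] 1(3,4) 2(3,4) FG(2) by blast
  moreover have "rep_iso (dim_add \<alpha> (dim_add \<beta> \<gamma>)) X (rep_block A F (rep_block B G D))"
    using rep_iso_trans[OF 1(6) E'(2)] unfolding FG(3) \<delta> dim_add_assoc .
  moreover have "rep_block B G D \<in> Rep (dim_add \<beta> \<gamma>)" by (rule rep_block_in_Rep[OF 2(4) 1(4)])
  ultimately show "X \<in> ext_prod S (ext_prod T U)"
    unfolding ext_prod_iff[of X] using 2(1,2) FG(1) by fastforce
next
  fix X assume "X \<in> ext_prod S (ext_prod T U)"
  then obtain \<alpha> \<delta> A Y F where 1: "A \<in> S" "A \<in> Rep \<alpha>" "Y \<in> ext_prod T U" "Y \<in> Rep \<delta>"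
    "F \<in> Rep (fst \<alpha>, snd \<delta>)" "rep_iso (dim_add \<alpha> \<delta>) X (rep_block A F Y)"
    unfolding ext_prod_iff[of X] by blast
  from 1(3) obtain \<beta> \<gamma> B D G where 2: "B \<in> T" "B \<in> Rep \<beta>" "D \<in> U" "D \<in> Rep \<gamma>" "G \<in> Rep (fst \<beta>, snd \<gamma>)"
     "rep_iso (dim_add \<beta> \<gamma>) Y (rep_block B G D)" unfolding ext_prod_iff by blast
  have \<delta>: "\<delta> = dim_add \<beta> \<gamma>" using Rep_dim_unique[OF 1(4) rep_iso_Rep(1)[OF 2(6)]] .
  obtain F' where F': "F' \<in> Rep (fst \<alpha>, snd \<delta>)"
    "rep_iso (dim_add \<alpha> \<delta>) (rep_block A F Y) (rep_block A F' (rep_block B G D))"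
    using rep_iso_block[OF rep_iso_refl[OF 1(2)] 2(6)[folded \<delta>] 1(5)] by blast
  obtain C E where CE: "C \<in> Rep (fst \<alpha>, snd \<beta>)" "E \<in> Rep (fst \<alpha> + fst \<beta>, snd \<gamma>)"
    "rep_block A F' (rep_block B G D) = rep_block (rep_block A C B) E D"
    using rep_block_assoc2[OF 1(2) 2(2,4) F'(1)[unfolded \<delta> dim_add_simps] 2(5)] by blast
  have "rep_block A C B \<in> ext_prod S T"
    unfolding ext_prod_iff using rep_iso_refl[OF rep_block_in_Rep[OF 1(2) 2(2)]] 1(1,2) 2(1,2) CE(1) by blast
  moreover have "rep_iso (dim_add (dim_add \<alpha> \<beta>) \<gamma>) X (rep_block (rep_block A C B) E D)"
    using rep_iso_trans[OF 1(6) F'(2)] unfolding CE(3) \<delta> dim_add_assoc .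
  moreover have "rep_block A C B \<in> Rep (dim_add \<alpha> \<beta>)" by (rule rep_block_in_Rep[OF 1(2) 2(2)])
  ultimately show "X \<in> ext_prod (ext_prod S T) U"
    unfolding ext_prod_iff[of X] using 2(3,4) CE(2) by fastforce
qed

text \<open>Every value of \<open>ext_prod\<close> has this property, so the unit laws can hold only
  for such sets.\<close>

definition iso_closed :: "'k::field krep set \<Rightarrow> bool" where
  "iso_closed S \<longleftrightarrow> S \<subseteq> (\<Union>\<alpha>. Rep \<alpha>) \<and> (\<forall>\<alpha> X Y. rep_iso \<alpha> X Y \<longrightarrow> Y \<in> S \<longrightarrow> X \<in> S)"

lemma iso_closedD: "iso_closed S \<Longrightarrow> rep_iso \<alpha> X Y \<Longrightarrow> Y \<in> S \<Longrightarrow> X \<in> S"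
  unfolding iso_closed_def by blast

lemma iso_closed_Rep: "iso_closed (Rep \<alpha>)"
  unfolding iso_closed_def using Rep_dim_unique rep_iso_Rep by blast

lemma iso_closed_ext_prod: "iso_closed (ext_prod S T)"
proof -
  have "X \<in> ext_prod S T" if "rep_iso \<delta> X Y" "Y \<in> ext_prod S T" for \<delta> X Y
  proof -
    from that(2) obtain \<alpha> \<beta> A B C where *: "A \<in> S \<inter> Rep \<alpha>" "B \<in> T \<inter> Rep \<beta>" "C \<in> Rep (fst \<alpha>, snd \<beta>)"
      "rep_iso (dim_add \<alpha> \<beta>) Y (rep_block A C B)" unfolding ext_prod_iff by blast
    have "\<delta> = dim_add \<alpha> \<beta>"
      using Rep_dim_unique rep_iso_Rep(2)[OF that(1)] rep_iso_Rep(1)[OF *(4)] by blast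
    then show ?thesis unfolding ext_prod_iff using * rep_iso_trans that(1) by blast
  qed
  moreover have "ext_prod S T \<subseteq> (\<Union>\<alpha>. Rep \<alpha>)" unfolding ext_prod_def by blast
  ultimately show ?thesis unfolding iso_closed_def by blast
qed

lemma ext_prod_unit_left:
  assumes S: "iso_closed S" shows "ext_prod (Rep (0, 0)) S = S"
proof -
  have bl: "rep_block A C B = B" if "A \<in> Rep (0, 0)" "B \<in> Rep \<beta>" "C \<in> Rep (0, snd \<beta>)"
    for A B C :: "'a krep" and \<beta>
    using that by (auto simp: rep_block_def Rep_iff prod_eq_iff intro!: eq_matI)
  show ?thesis
  proof (intro equalityI subsetI)
    fix X assume "X \<in> ext_prod (Rep (0, 0)) S"
    then obtain \<alpha> \<beta> A B C where *: "A \<in> Rep (0, 0)" "A \<in> Rep \<alpha>" "B \<in> S" "B \<in> Rep \<beta>" "C \<in> Rep (fst \<alpha>, snd \<beta>)"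
      "rep_iso (dim_add \<alpha> \<beta>) X (rep_block A C B)" unfolding ext_prod_iff by blast
    have "\<alpha> = (0, 0)" using Rep_dim_unique *(1,2) by blast
    then show "X \<in> S" using * bl[of A B \<beta> C] iso_closedD[OF S *(6)] by simp
  next
    fix X assume X: "X \<in> S"
    then obtain \<beta> where \<beta>: "X \<in> Rep \<beta>" using S unfolding iso_closed_def by blast
    let ?A = "(0\<^sub>m 0 0, 0\<^sub>m 0 0) :: 'a krep" and ?C = "(0\<^sub>m (snd \<beta>) 0, 0\<^sub>m (snd \<beta>) 0) :: 'a krep"
    have AC: "?A \<in> Rep (0, 0)" "?C \<in> Rep (0, snd \<beta>)" by (auto simp: Rep_iff)
    have "rep_iso (dim_add (0, 0) \<beta>) X (rep_block ?A ?C X)"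
      using bl[OF AC(1) \<beta> AC(2)] rep_iso_refl[OF \<beta>] by (simp add: dim_add_def)
    then show "X \<in> ext_prod (Rep (0, 0)) S" unfolding ext_prod_iff using X \<beta> AC by fastforce
  qed
qed

lemma ext_prod_unit_right:
  assumes S: "iso_closed S" shows "ext_prod S (Rep (0, 0)) = S"
proof -
  have bl: "rep_block B C A = B" if "A \<in> Rep (0, 0)" "B \<in> Rep \<beta>" "C \<in> Rep (fst \<beta>, 0)"
    for A B C :: "'a krep" and \<beta>
    using that by (auto simp: rep_block_def Rep_iff prod_eq_iff intro!: eq_matI)
  show ?thesis
  proof (intro equalityI subsetI)
    fix X assume "X \<in> ext_prod S (Rep (0, 0))"
    then obtain \<alpha> \<beta> A B C where *: "A \<in> S" "A \<in> Rep \<alpha>" "B \<in> Rep (0, 0)" "B \<in> Rep \<beta>" "C \<in> Rep (fst \<alpha>, snd \<beta>)"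
      "rep_iso (dim_add \<alpha> \<beta>) X (rep_block A C B)" unfolding ext_prod_iff by blast
    have "\<beta> = (0, 0)" using Rep_dim_unique *(3,4) by blast
    then show "X \<in> S" using * bl[of B A \<alpha> C] iso_closedD[OF S *(6)] by simp
  next
    fix X assume X: "X \<in> S"
    then obtain \<beta> where \<beta>: "X \<in> Rep \<beta>" using S unfolding iso_closed_def by blast
    let ?A = "(0\<^sub>m 0 0, 0\<^sub>m 0 0) :: 'a krep" and ?C = "(0\<^sub>m 0 (fst \<beta>), 0\<^sub>m 0 (fst \<beta>)) :: 'a krep"
    have AC: "?A \<in> Rep (0, 0)" "?C \<in> Rep (fst \<beta>, 0)" by (auto simp: Rep_iff)
    have "rep_iso (dim_add \<beta> (0, 0)) X (rep_block X ?C ?A)"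
      using bl[OF AC(1) \<beta> AC(2)] rep_iso_refl[OF \<beta>] by (simp add: dim_add_def)
    then show "X \<in> ext_prod S (Rep (0, 0))" unfolding ext_prod_iff using X \<beta> AC by fastforce
  qed
qed

lemma ext_prod_Rep_subset: "ext_prod (Rep \<alpha>) (Rep \<beta>) \<subseteq> Rep (dim_add \<alpha> \<beta>)"
  unfolding ext_prod_def using Rep_dim_unique by blast

text \<open>In a product of two full spaces the diagonal and lower left blocks are unrestricted, so
  a base change that makes the upper right blocks vanish is all that is required.\<close>

lemma ext_prod_RepI:
  fixes X :: "'k::field krep"
  assumes X: "X \<in> Rep (dim_add \<alpha> \<beta>)"
    and h: "inv_pair (snd \<alpha> + snd \<beta>) h h'" and g: "inv_pair (fst \<alpha> + fst \<beta>) g g'"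
    and z1: "\<And>r s. r < snd \<alpha> \<Longrightarrow> s < fst \<beta> \<Longrightarrow> (h * fst X * g) $$ (r, fst \<alpha> + s) = 0"
    and z2: "\<And>r s. r < snd \<alpha> \<Longrightarrow> s < fst \<beta> \<Longrightarrow> (h * snd X * g) $$ (r, fst \<alpha> + s) = 0"
  shows "X \<in> ext_prod (Rep \<alpha>) (Rep \<beta>)"
proof -
  define Y where "Y = act h X g"
  have Y: "Y \<in> Rep (dim_add \<alpha> \<beta>)" unfolding Y_def
    using X inv_pairD[OF h] inv_pairD[OF g] by (intro act_in_Rep) auto
  have "rep_iso (dim_add \<alpha> \<beta>) Y X" using X h g unfolding rep_iso_def Y_def by auto
  then have XY: "rep_iso (dim_add \<alpha> \<beta>) X Y" by (rule rep_iso_sym)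
  let ?A = "\<lambda>M :: 'k mat. mat (snd \<alpha>) (fst \<alpha>) (\<lambda>(r, s). M $$ (r, s))"
  let ?B = "\<lambda>M :: 'k mat. mat (snd \<beta>) (fst \<beta>) (\<lambda>(r, s). M $$ (snd \<alpha> + r, fst \<alpha> + s))"
  let ?C = "\<lambda>M :: 'k mat. mat (snd \<beta>) (fst \<alpha>) (\<lambda>(r, s). M $$ (snd \<alpha> + r, s))"
  have block: "M = four_block_mat (?A M) (0\<^sub>m (snd \<alpha>) (fst \<beta>)) (?C M) (?B M)"
    if M: "M \<in> carrier_mat (snd \<alpha> + snd \<beta>) (fst \<alpha> + fst \<beta>)"
      and z: "\<And>r s. r < snd \<alpha> \<Longrightarrow> s < fst \<beta> \<Longrightarrow> M $$ (r, fst \<alpha> + s) = 0" for M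
  proof (intro eq_matI)
    fix r s assume "r < dim_row (four_block_mat (?A M) (0\<^sub>m (snd \<alpha>) (fst \<beta>)) (?C M) (?B M))"
      "s < dim_col (four_block_mat (?A M) (0\<^sub>m (snd \<alpha>) (fst \<beta>)) (?C M) (?B M))"
    then show "M $$ (r, s) = four_block_mat (?A M) (0\<^sub>m (snd \<alpha>) (fst \<beta>)) (?C M) (?B M) $$ (r, s)"
      using z[of r "s - fst \<alpha>"] by auto
  qed (use M in auto)
  have "fst Y = four_block_mat (?A (fst Y)) (0\<^sub>m (snd \<alpha>) (fst \<beta>)) (?C (fst Y)) (?B (fst Y))"
    by (rule block) (use Y z1 in \<open>auto simp: Y_def act_def Rep_iff\<close>)
  moreover have "snd Y = four_block_mat (?A (snd Y)) (0\<^sub>m (snd \<alpha>) (fst \<beta>)) (?C (snd Y)) (?B (snd Y))"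
    by (rule block) (use Y z2 in \<open>auto simp: Y_def act_def Rep_iff\<close>)
  ultimately have "Y = rep_block (?A (fst Y), ?A (snd Y)) (?C (fst Y), ?C (snd Y)) (?B (fst Y), ?B (snd Y))"
    by (simp add: rep_block_def prod_eq_iff)
  moreover have "(?A (fst Y), ?A (snd Y)) \<in> Rep \<alpha>" "(?C (fst Y), ?C (snd Y)) \<in> Rep (fst \<alpha>, snd \<beta>)"
    "(?B (fst Y), ?B (snd Y)) \<in> Rep \<beta>" by (auto simp: Rep_iff)
  ultimately show ?thesis unfolding ext_prod_iff using XY by (metis (no_types, lifting) IntI)
qed

section \<open>Duality by transposition\<close>

definition transpose_rep :: "'k krep \<Rightarrow> 'k krep" where
  "transpose_rep X = (transpose_mat (fst X), transpose_mat (snd X))"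

lemma transpose_rep_transpose_rep [simp]: "transpose_rep (transpose_rep X) = X"
  by (simp add: transpose_rep_def)

lemma transpose_rep_Rep_iff: "transpose_rep X \<in> Rep \<alpha> \<longleftrightarrow> X \<in> Rep (prod.swap \<alpha>)"
  by (auto simp: transpose_rep_def Rep_iff)

lemma transpose_rep_image_Rep: "transpose_rep ` Rep \<alpha> = Rep (prod.swap \<alpha>)"
proof (intro equalityI subsetI)
  fix X :: "'a krep" assume "X \<in> Rep (prod.swap \<alpha>)"
  then have "transpose_rep X \<in> Rep \<alpha>" by (simp add: transpose_rep_Rep_iff)
  then show "X \<in> transpose_rep ` Rep \<alpha>" by (metis image_eqI transpose_rep_transpose_rep)
qed (auto simp: transpose_rep_Rep_iff)

text \<open>Transposing a block triangular matrix moves its zero block to the lower left. Permuting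
  the two groups of coordinates restores the shape, with sub and quotient exchanged.\<close>

definition block_swap :: "nat \<Rightarrow> nat \<Rightarrow> 'k::field mat" where
  "block_swap a b = four_block_mat (0\<^sub>m a b) (1\<^sub>m a) (1\<^sub>m b) (0\<^sub>m b a)"

lemma block_swap_carrier: "block_swap a b \<in> carrier_mat (a + b) (a + b)"
  unfolding block_swap_def by (metis four_block_carrier_mat zero_carrier_mat add.commute)

lemma inv_pair_block_swap: "inv_pair (a + b) (block_swap a b) (block_swap b a)"
proof -
  have "block_swap c d * block_swap d c = 1\<^sub>m (c + d)" for c d
    unfolding block_swap_def
    by (subst mult_four_block_mat[where ?nr1.0=c and ?nr2.0=d and ?n1.0=d and ?n2.0=c and ?nc1.0=c and ?nc2.0=d]) auto
  then show ?thesis using block_swap_carrier[of a b] block_swap_carrier[of b a]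
    by (auto simp: inv_pair_def add.commute)
qed

lemma transpose_block:
  fixes A :: "'k::field mat"
  assumes "A \<in> carrier_mat a' a" "B \<in> carrier_mat b' b" "C \<in> carrier_mat b' a"
  shows "transpose_mat (four_block_mat A (0\<^sub>m a' b) C B) =
    block_swap a b * four_block_mat (transpose_mat B) (0\<^sub>m b a') (transpose_mat C) (transpose_mat A) * block_swap b' a'"
proof -
  have "block_swap a b * four_block_mat (transpose_mat B) (0\<^sub>m b a') (transpose_mat C) (transpose_mat A) =
    four_block_mat (transpose_mat C) (transpose_mat A) (transpose_mat B) (0\<^sub>m b a')"
    unfolding block_swap_def using assms
    by (subst mult_four_block_mat[where ?nr1.0=a and ?nr2.0=b and ?n1.0=b and ?n2.0=a and ?nc1.0=b' and ?nc2.0=a']) auto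
  also have "\<dots> * block_swap b' a' =
    four_block_mat (transpose_mat A) (transpose_mat C) (0\<^sub>m b a') (transpose_mat B)"
    unfolding block_swap_def using assms
    by (subst mult_four_block_mat[where ?nr1.0=a and ?nr2.0=b and ?n1.0=b' and ?n2.0=a' and ?nc1.0=a' and ?nc2.0=b']) auto
  finally show ?thesis using assms by (subst transpose_four_block_mat) auto
qed

lemma rep_iso_transpose_rep:
  assumes "rep_iso \<alpha> X Y"
  shows "rep_iso (prod.swap \<alpha>) (transpose_rep X) (transpose_rep Y)"
proof -
  from assms obtain h h' g g' where *: "Y \<in> Rep \<alpha>" "inv_pair (snd \<alpha>) h h'" "inv_pair (fst \<alpha>) g g'"
    "X = act h Y g" unfolding rep_iso_def by blast
  have "transpose_mat (h * M * g) = transpose_mat g * transpose_mat M * transpose_mat h"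
    if M: "M \<in> carrier_mat (snd \<alpha>) (fst \<alpha>)" for M
  proof -
    note c = inv_pairD[OF *(2)] inv_pairD[OF *(3)]
    have "transpose_mat (h * M * g) = transpose_mat g * transpose_mat (h * M)"
      using c M by (intro transpose_mult) auto
    also have "transpose_mat (h * M) = transpose_mat M * transpose_mat h"
      using c M by (intro transpose_mult) auto
    also have "transpose_mat g * \<dots> = transpose_mat g * transpose_mat M * transpose_mat h"
      using c M by (intro assoc_mult_mat[symmetric]) auto
    finally show ?thesis .
  qed
  then have "transpose_rep X = act (transpose_mat g) (transpose_rep Y) (transpose_mat h)"
    using *(1) by (simp add: *(4) transpose_rep_def act_def Rep_iff)
  moreover have "transpose_rep Y \<in> Rep (prod.swap \<alpha>)" using *(1) by (simp add: transpose_rep_Rep_iff)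
  ultimately show ?thesis unfolding rep_iso_def
    using inv_pair_transpose[OF *(2)] inv_pair_transpose[OF *(3)] by auto
qed

lemma transpose_rep_ext_prod_subset:
  "transpose_rep ` ext_prod S T \<subseteq> ext_prod (transpose_rep ` T) (transpose_rep ` S)"
proof (intro subsetI, elim imageE)
  fix X Z assume "X \<in> ext_prod S T" and Z: "Z = transpose_rep X"
  then obtain \<alpha> \<beta> A B C where *: "A \<in> S" "A \<in> Rep \<alpha>" "B \<in> T" "B \<in> Rep \<beta>" "C \<in> Rep (fst \<alpha>, snd \<beta>)"
     "rep_iso (dim_add \<alpha> \<beta>) X (rep_block A C B)" unfolding ext_prod_iff by blast
  let ?T = "rep_block (transpose_rep B) (transpose_rep C) (transpose_rep A)"
  have t: "transpose_rep A \<in> Rep (prod.swap \<alpha>)" "transpose_rep B \<in> Rep (prod.swap \<beta>)"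
    "transpose_rep C \<in> Rep (fst (prod.swap \<beta>), snd (prod.swap \<alpha>))"
    using *(2,4,5) by (simp_all add: transpose_rep_Rep_iff)
  have "transpose_rep (rep_block A C B) =
    act (block_swap (fst \<alpha>) (fst \<beta>)) ?T (block_swap (snd \<beta>) (snd \<alpha>))"
  proof -
    have "fst A \<in> carrier_mat (snd \<alpha>) (fst \<alpha>)" "snd A \<in> carrier_mat (snd \<alpha>) (fst \<alpha>)"
      "fst B \<in> carrier_mat (snd \<beta>) (fst \<beta>)" "snd B \<in> carrier_mat (snd \<beta>) (fst \<beta>)"
      "fst C \<in> carrier_mat (snd \<beta>) (fst \<alpha>)" "snd C \<in> carrier_mat (snd \<beta>) (fst \<alpha>)"
      using *(2,4,5) by (auto simp: Rep_iff)
    note d = this and d' = this[THEN carrier_matD(1)] this[THEN carrier_matD(2)]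
    show ?thesis unfolding transpose_rep_def rep_block_def act_def fst_conv snd_conv
      using d' by (simp add: transpose_block[OF d(1,3,5)] transpose_block[OF d(2,4,6)])
  qed
  then have "rep_iso (dim_add (prod.swap \<beta>) (prod.swap \<alpha>)) (transpose_rep (rep_block A C B)) ?T"
    unfolding rep_iso_def using rep_block_in_Rep[OF t(2,1)]
      inv_pair_block_swap[of "fst \<alpha>" "fst \<beta>"] inv_pair_block_swap[of "snd \<beta>" "snd \<alpha>"]
    by (auto simp: add.commute)
  moreover have "prod.swap (dim_add \<alpha> \<beta>) = dim_add (prod.swap \<beta>) (prod.swap \<alpha>)"
    by (simp add: dim_add_def)
  ultimately have "rep_iso (dim_add (prod.swap \<beta>) (prod.swap \<alpha>)) Z ?T"
    using rep_iso_transpose_rep[OF *(6)] rep_iso_trans Z by metis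
  then show "Z \<in> ext_prod (transpose_rep ` T) (transpose_rep ` S)"
    unfolding ext_prod_iff[of Z] using t *(1,3) by (metis (no_types, lifting) IntI imageI)
qed

text \<open>Transposition is an involution, so the inclusion for the transposed sets yields the
  reverse inclusion.\<close>

lemma transpose_rep_ext_prod:
  "transpose_rep ` ext_prod S T = ext_prod (transpose_rep ` T) (transpose_rep ` S)"
proof
  have inv: "transpose_rep ` transpose_rep ` S = S" for S :: "'a krep set"
    by (simp add: image_image)
  have "transpose_rep ` ext_prod (transpose_rep ` T) (transpose_rep ` S) \<subseteq> ext_prod S T"
    using transpose_rep_ext_prod_subset[of "transpose_rep ` T" "transpose_rep ` S"] unfolding inv .
  then show "ext_prod (transpose_rep ` T) (transpose_rep ` S) \<subseteq> transpose_rep ` ext_prod S T"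
    using inv by (metis image_mono)
qed (rule transpose_rep_ext_prod_subset)

section \<open>Normal forms of words\<close>

definition kron_rels :: "(kvertex list \<times> kvertex list) set" where
  "kron_rels =
    {(wpow wi m @ wpow wj (m + 1) @ wpow wi (m + 1) @ wpow wj (m + 2),
       wpow wi (2 * m + 1) @ wpow wj (2 * m + 3)) | m. m \<ge> 0} \<union>
     {(wpow wi (n + 2) @ wpow wj (n + 1) @ wpow wi (n + 1) @ wpow wj n,
       wpow wi (2 * n + 3) @ wpow wj (2 * n + 1)) | n. n \<ge> 0} \<union>
     {(wpow (wi @ wj) m, wpow wi m @ wpow wj m) | m. m \<ge> 1}"

abbreviation kron_cong :: "kvertex list \<Rightarrow> kvertex list \<Rightarrow> bool" (infix \<open>\<approx>\<close> 50) where
  "u \<approx> v \<equiv> word_cong kron_rels u v"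

lemmas kron_cong_trans [trans] = word_cong.trans[where R = kron_rels]

lemma cong_append_left: "u \<approx> v \<Longrightarrow> w @ u \<approx> w @ v"
  by (intro word_cong.append word_cong.refl)

lemma cong_append_right: "u \<approx> v \<Longrightarrow> u @ w \<approx> v @ w"
  by (intro word_cong.append word_cong.refl)

text \<open>Such a word evaluates to the full space \<open>Rep (m, n)\<close>, and each defining
  relation has one as its right-hand side.\<close>

definition ijw :: "nat \<Rightarrow> nat \<Rightarrow> kvertex list" where
  "ijw m n = replicate m Vi @ replicate n Vj"

text \<open>
  The words \<open>ppw a\<close>, \<open>rrw m\<close> and \<open>qqw b\<close> stand for the closures of the families of
  preprojective, regular and preinjective representations.
\<close>

abbreviation "ppw a \<equiv> ijw a (Suc a)"
abbreviation "qqw b \<equiv> ijw (Suc b) b"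
abbreviation "rrw m \<equiv> wpow [Vi, Vj] m"

lemma wpow_singleton [simp]: "wpow [x] n = replicate n x"
  by (induction n) auto

lemma ijw_append_j: "ijw m n @ replicate k Vj = ijw m (n + k)"
  by (simp add: ijw_def replicate_add)

lemma ijw_append_i: "replicate k Vi @ ijw m n = ijw (k + m) n"
  by (simp add: ijw_def replicate_add)

lemma rrw_add: "rrw (m + n) = rrw m @ rrw n"
  by (simp add: replicate_add)

lemma cong_ppw_ppw_Suc: "ppw m @ ppw (Suc m) \<approx> ijw (2 * m + 1) (2 * m + 3)"
  by (rule word_cong.rel) (auto simp: kron_rels_def ijw_def intro!: exI[of _ m])

lemma cong_qqw_Suc_qqw: "qqw (Suc n) @ qqw n \<approx> ijw (2 * n + 3) (2 * n + 1)"
  by (rule word_cong.rel) (auto simp: kron_rels_def ijw_def intro!: exI[of _ n])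

lemma cong_rrw: "rrw m \<approx> ijw m m"
proof (cases "m = 0")
  case False
  then show ?thesis by (intro word_cong.rel) (auto simp: kron_rels_def ijw_def intro!: exI[of _ m])
qed (auto simp: ijw_def intro: word_cong.refl)

fun swap_vertex :: "kvertex \<Rightarrow> kvertex" where
  "swap_vertex Vi = Vj"
| "swap_vertex Vj = Vi"

text \<open>The counterpart of \<open>transpose_rep\<close> on words: sub and quotient change
  places, hence the reversal. It interchanges the first two families of relations and fixes the
  third.\<close>

definition dual_word :: "kvertex list \<Rightarrow> kvertex list" where
  "dual_word w = rev (map swap_vertex w)"

lemma dual_word_simps [simp]:
  "dual_word [] = []" "dual_word (u @ v) = dual_word v @ dual_word u" "dual_word (ijw m n) = ijw n m"
  by (simp_all add: dual_word_def ijw_def)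

lemma dual_word_rrw [simp]: "dual_word (rrw m) = rrw m"
proof (induction m)
  case (Suc m)
  have "rrw (Suc m) = rrw m @ [Vi, Vj]" using rrw_add[of m 1] by simp
  then show ?case using Suc by (simp add: dual_word_def)
qed simp

lemma cong_dual_word: "u \<approx> v \<Longrightarrow> dual_word u \<approx> dual_word v"
proof (induction rule: word_cong.induct)
  case (rel u v)
  then consider m where "u = ppw m @ ppw (Suc m)" "v = ijw (2 * m + 1) (2 * m + 3)"
    | n where "u = qqw (Suc n) @ qqw n" "v = ijw (2 * n + 3) (2 * n + 1)"
    | m where "u = rrw m" "v = ijw m m"
    unfolding kron_rels_def ijw_def by auto
  then show ?case
  proof cases
    case 1 then show ?thesis using cong_qqw_Suc_qqw[of m] by simp
  next
    case 2 then show ?thesis using cong_ppw_ppw_Suc[of n] by simp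
  next
    case 3 then show ?thesis using cong_rrw[of m] by simp
  qed
qed (auto intro: word_cong.intros)

text \<open>The third family trades \<open>ppw a\<close> for a power of ij followed by a single j;
  in this form further factors ij on the left are absorbed.\<close>

lemma cong_ppw: "ppw a \<approx> rrw a @ [Vj]"
proof -
  have "ppw a = ijw a a @ [Vj]" using ijw_append_j[of a a 1] by simp
  then show ?thesis using word_cong.sym[OF cong_append_right[OF cong_rrw]] by simp
qed

lemma cong_rrw_ppw: "rrw m @ ppw a \<approx> ppw (m + a)"
proof -
  have "rrw m @ ppw a \<approx> rrw m @ rrw a @ [Vj]" by (rule cong_append_left[OF cong_ppw])
  also have "rrw m @ rrw a @ [Vj] = rrw (m + a) @ [Vj]" by (simp add: rrw_add)
  also have "\<dots> \<approx> ppw (m + a)" by (rule word_cong.sym[OF cong_ppw])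
  finally show ?thesis .
qed

lemma cong_qqw_rrw: "qqw b @ rrw m \<approx> qqw (b + m)"
  using cong_dual_word[OF cong_rrw_ppw[of m b]] by (simp add: add.commute)

lemma cong_i_ppw: "Vi # ppw a \<approx> rrw (Suc a)"
  using word_cong.sym[OF cong_rrw[of "Suc a"]] ijw_append_i[of 1 a "Suc a"] by simp

text \<open>The value depends only on \<open>a + b\<close>. For \<open>b = Suc c\<close>, a power of
  ij is split off from \<open>ppw a\<close> so that \<open>ppw c\<close> remains, which is possible
  since \<open>c \<le> a\<close>; the first family applies to \<open>ppw c @ ppw (Suc c)\<close>,
  and the power is absorbed again.\<close>

lemma cong_ppw_ppw:
  assumes "b \<le> Suc a" shows "ppw a @ ppw b \<approx> ijw (a + b) (a + b + 2)"
proof (cases b)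
  case 0
  then show ?thesis using ijw_append_j[of a "Suc a" 1] word_cong.refl by (simp add: ijw_def)
next
  case (Suc c)
  define k where "k = a - c"
  have a: "a = k + c" using assms Suc by (simp add: k_def)
  have "ppw a @ ppw b \<approx> (rrw k @ ppw c) @ ppw b"
    unfolding a by (rule cong_append_right[OF word_cong.sym[OF cong_rrw_ppw]])
  also have "(rrw k @ ppw c) @ ppw b = rrw k @ (ppw c @ ppw (Suc c))" by (simp add: Suc)
  also have "\<dots> \<approx> rrw k @ ijw (2 * c + 1) (2 * c + 3)"
    by (rule cong_append_left[OF cong_ppw_ppw_Suc])
  \<comment> \<open>One j is detached so that the rest is a \<open>ppw\<close>, which can absorb the
    power of ij.\<close>
  also have "\<dots> = rrw k @ ppw (2 * c + 1) @ [Vj]"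
    using ijw_append_j[of "2 * c + 1" "2 * c + 2" 1] by (simp add: eval_nat_numeral)
  also have "\<dots> = (rrw k @ ppw (2 * c + 1)) @ [Vj]" by simp
  also have "\<dots> \<approx> ppw (k + (2 * c + 1)) @ [Vj]" by (rule cong_append_right[OF cong_rrw_ppw])
  also have "k + (2 * c + 1) = a + b" by (simp add: a Suc)
  also have "ppw (a + b) @ [Vj] = ijw (a + b) (a + b + 2)"
    using ijw_append_j[of "a + b" "Suc (a + b)" 1] by simp
  finally show ?thesis .
qed

lemma not_sorted_descent:
  fixes xs :: "'a::linorder list"
  assumes "\<not> sorted xs"
  obtains us a b vs where "xs = us @ a # b # vs" "b < a"
proof -
  obtain n where n: "Suc n < length xs" "xs ! Suc n < xs ! n"
    using assms unfolding sorted_iff_nth_Suc by auto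
  then have "xs = take n xs @ xs ! n # xs ! Suc n # drop (Suc (Suc n)) xs"
    by (metis Cons_nth_drop_Suc Suc_lessD append_take_drop_id)
  with n(2) show ?thesis using that by blast
qed

text \<open>
  Replacing a descent by the balanced pair with the same sum lowers the list lexicographically.
\<close>

lemma cong_sort_ppw: "\<exists>ys. sorted ys \<and> concat (map ppw xs) \<approx> concat (map ppw ys)"
proof (induction xs rule: wf_induct_rule[OF wf_lex[OF wf_less_than]])
  case (1 xs)
  show ?case
  proof (cases "sorted xs")
    case True
    then show ?thesis using word_cong.refl by blast
  next
    case False
    then obtain us a b vs where xs: "xs = us @ a # b # vs" "b < a" by (rule not_sorted_descent)
    \<comment> \<open>The larger half comes second. Since \<open>d \<le> Suc c\<close>,
      \<open>cong_ppw_ppw\<close> applies to the new pair as well and gives the same value.\<close>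
    define c where "c = (a + b) div 2"
    define d where "d = a + b - c"
    have cd: "c < a" "d \<le> Suc c" "c + d = a + b" using xs(2) by (auto simp: c_def d_def)
    have "(us @ c # d # vs, xs) \<in> lex less_than"
      using cd xs by (auto simp: lex_conv)
    from "1"[OF this] obtain ys where ys: "sorted ys"
      "concat (map ppw (us @ c # d # vs)) \<approx> concat (map ppw ys)" by blast
    have "ppw a @ ppw b \<approx> ijw (a + b) (a + b + 2)" using xs(2) by (intro cong_ppw_ppw) simp
    also have "\<dots> \<approx> ppw c @ ppw d"
      using word_cong.sym[OF cong_ppw_ppw[OF cd(2)]] by (simp add: cd(3))
    finally have "concat (map ppw us) @ (ppw a @ ppw b) @ concat (map ppw vs) \<approx>
      concat (map ppw us) @ (ppw c @ ppw d) @ concat (map ppw vs)"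
      by (intro cong_append_left cong_append_right)
    then have "concat (map ppw xs) \<approx> concat (map ppw (us @ c # d # vs))" by (simp add: xs(1))
    with ys show ?thesis using kron_cong_trans by blast
  qed
qed

text \<open>Reversing the second list makes \<open>dual_word\<close> exchange \<open>as\<close> and
  \<open>bs\<close>, so that both can be required to be sorted in the same sense.\<close>

definition normal_word :: "nat list \<Rightarrow> nat \<Rightarrow> nat list \<Rightarrow> kvertex list" where
  "normal_word as m bs = concat (map ppw as) @ rrw m @ concat (map qqw (rev bs))"

lemma dual_word_concat_ppw: "dual_word (concat (map ppw as)) = concat (map qqw (rev as))"
  by (induction as) auto

lemma dual_word_concat_qqw: "dual_word (concat (map qqw (rev as))) = concat (map ppw as)"
  by (induction as) auto

lemma dual_word_normal_word: "dual_word (normal_word as m bs) = normal_word bs m as"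
  by (simp add: normal_word_def dual_word_concat_ppw dual_word_concat_qqw)

text \<open>Prepending a letter preserves the shape. The letter j is \<open>ppw 0\<close>. The
  letter i turns the first \<open>ppw a\<close> into a power of ij, which the next
  \<open>ppw\<close> absorbs if there is one; with no \<open>ppw\<close> at all, i is
  \<open>qqw 0\<close> and itself absorbs \<open>rrw m\<close>.\<close>

lemma cong_normal_word: "\<exists>as m bs. w \<approx> normal_word as m bs"
proof (induction w)
  case Nil
  have "normal_word [] 0 [] = []" by (simp add: normal_word_def)
  then show ?case using word_cong.refl by metis
next
  case (Cons x w)
  then obtain as m bs where w: "w \<approx> normal_word as m bs" by blast
  have xw: "x # w \<approx> x # normal_word as m bs" using cong_append_left[OF w, of "[x]"] by simp
  have "\<exists>as' m' bs'. x # normal_word as m bs \<approx> normal_word as' m' bs'"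
  proof (cases x)
    case Vj
    have "Vj # normal_word as m bs = normal_word (0 # as) m bs" by (simp add: normal_word_def ijw_def)
    then show ?thesis using Vj word_cong.refl by metis
  next
    case Vi
    let ?q = "concat (map qqw (rev bs))"
    consider "as = []" | a where "as = [a]" | a a' as' where "as = a # a' # as'"
      by (metis list.exhaust)
    then show ?thesis
    proof cases
      case 1
      have "(qqw 0 @ rrw m) @ ?q \<approx> qqw (0 + m) @ ?q" by (rule cong_append_right[OF cong_qqw_rrw])
      \<comment> \<open>The new leftmost factor \<open>qqw m\<close> goes to the end of
        \<open>bs\<close>, since the list is written in reverse.\<close>
      then have "x # normal_word as m bs \<approx> normal_word [] 0 (bs @ [m])"
        using 1 Vi by (simp add: normal_word_def ijw_def)
      then show ?thesis by blast
    next
      case 2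
      have "(Vi # ppw a) @ rrw m @ ?q \<approx> rrw (Suc a) @ rrw m @ ?q" by (rule cong_append_right[OF cong_i_ppw])
      also have "rrw (Suc a) @ rrw m @ ?q = rrw (Suc a + m) @ ?q" by (simp only: rrw_add append_assoc)
      finally have "x # normal_word as m bs \<approx> normal_word [] (Suc a + m) bs"
        using 2 Vi by (simp add: normal_word_def)
      then show ?thesis by blast
    next
      case 3
      let ?w = "concat (map ppw as') @ rrw m @ ?q"
      have "(Vi # ppw a) @ ppw a' @ ?w \<approx> rrw (Suc a) @ ppw a' @ ?w"
        by (rule cong_append_right[OF cong_i_ppw])
      also have "rrw (Suc a) @ ppw a' @ ?w = (rrw (Suc a) @ ppw a') @ ?w" by simp
      also have "\<dots> \<approx> ppw (Suc a + a') @ ?w" by (rule cong_append_right[OF cong_rrw_ppw])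
      finally have "x # normal_word as m bs \<approx> normal_word ((Suc a + a') # as') m bs"
        using 3 Vi by (simp add: normal_word_def)
      then show ?thesis by blast
    qed
  qed
  with xw show ?case using kron_cong_trans by blast
qed

lemma cong_sorted_normal_word: "\<exists>as m bs. sorted as \<and> sorted bs \<and> w \<approx> normal_word as m bs"
proof -
  obtain as m bs where w: "w \<approx> normal_word as m bs" using cong_normal_word by blast
  obtain as' where as': "sorted as'" "concat (map ppw as) \<approx> concat (map ppw as')"
    using cong_sort_ppw by blast
  obtain bs' where bs': "sorted bs'" "concat (map ppw bs) \<approx> concat (map ppw bs')"
    using cong_sort_ppw by blast
  have "concat (map qqw (rev bs)) \<approx> concat (map qqw (rev bs'))"
    using cong_dual_word[OF bs'(2)] by (simp add: dual_word_concat_ppw)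
  then have "normal_word as m bs \<approx> normal_word as' m bs'"
    unfolding normal_word_def by (intro word_cong.append as' word_cong.refl)
  with w as'(1) bs'(1) show ?thesis using kron_cong_trans by blast
qed

section \<open>Composition series and the relations\<close>

definition filt :: "kvertex list \<Rightarrow> 'k::field krep set" where
  "filt w = word_eval composition_monoid simple_class w"

lemma composition_monoid_simps [simp]:
  "mult composition_monoid = ext_prod" "one composition_monoid = Rep (0, 0)"
  "carrier (composition_monoid :: 'k::field krep set monoid) =
    generated_set extension_monoid {Rep (1, 0), Rep (0, 1)}"
  by (simp_all add: composition_monoid_def generated_submonoid_def extension_monoid_def)

lemma filt_simps [simp]:
  "filt [] = Rep (0, 0)" "filt (x # w) = ext_prod (simple_class x) (filt w)"
  by (simp_all add: filt_def word_eval_def)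

lemma iso_closed_filt: "iso_closed (filt w)"
  by (cases w) (auto intro: iso_closed_Rep iso_closed_ext_prod)

lemma filt_append: "filt (u @ v) = ext_prod (filt u) (filt v)"
  by (induction u) (simp_all add: ext_prod_unit_left iso_closed_filt ext_prod_assoc)

text \<open>The block that has to vanish has \<open>snd \<alpha>\<close> rows and
  \<open>fst \<beta>\<close> columns, so it is empty.\<close>

lemma ext_prod_Rep_split:
  assumes "snd \<alpha> = 0 \<or> fst \<beta> = 0"
  shows "ext_prod (Rep \<alpha>) (Rep \<beta>) = (Rep (dim_add \<alpha> \<beta>) :: 'k::field krep set)"
proof
  show "Rep (dim_add \<alpha> \<beta>) \<subseteq> ext_prod (Rep \<alpha>) (Rep \<beta> :: 'k krep set)"
    by (intro subsetI ext_prod_RepI[OF _ inv_pair_one inv_pair_one]) (use assms in auto)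
qed (rule ext_prod_Rep_subset)

lemma filt_ijw: "filt (ijw m n) = Rep (m, n)"
proof -
  have 1: "filt (replicate m Vi) = Rep (m, 0)"
    by (induction m) (simp_all add: ext_prod_Rep_split dim_add_def)
  have 2: "filt (replicate n Vj) = Rep (0, n)"
    by (induction n) (simp_all add: ext_prod_Rep_split dim_add_def)
  show ?thesis by (simp add: ijw_def filt_append 1 2 ext_prod_Rep_split dim_add_def)
qed

text \<open>Only the last columns of \<open>g\<close>, a basis of the subspace at i, enter the
  conditions: both maps must send it into the subspace at j on which the first rows of
  \<open>h\<close> vanish.\<close>

lemma ext_prod_RepI_columns:
  fixes X :: "'k::field krep"
  assumes X: "X \<in> Rep (dim_add \<alpha> \<beta>)"
    and h: "inv_pair (snd \<alpha> + snd \<beta>) h h'" and g: "inv_pair (fst \<alpha> + fst \<beta>) g g'"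
    and z1: "\<And>r s. r < snd \<alpha> \<Longrightarrow> s < fst \<beta> \<Longrightarrow>
      (h * (fst X * (g * sub_incl (fst \<alpha>) (fst \<beta>)))) $$ (r, s) = 0"
    and z2: "\<And>r s. r < snd \<alpha> \<Longrightarrow> s < fst \<beta> \<Longrightarrow>
      (h * (snd X * (g * sub_incl (fst \<alpha>) (fst \<beta>)))) $$ (r, s) = 0"
  shows "X \<in> ext_prod (Rep \<alpha>) (Rep \<beta>)"
proof (rule ext_prod_RepI[OF X h g])
  note c = inv_pairD[OF h] inv_pairD[OF g]
  have *: "(h * M * g) $$ (r, fst \<alpha> + s) = (h * (M * (g * sub_incl (fst \<alpha>) (fst \<beta>)))) $$ (r, s)"
    if M: "M \<in> carrier_mat (snd \<alpha> + snd \<beta>) (fst \<alpha> + fst \<beta>)" and rs: "r < snd \<alpha>" "s < fst \<beta>" for M r s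
  proof -
    have hMg: "h * M * g \<in> carrier_mat (snd \<alpha> + snd \<beta>) (fst \<alpha> + fst \<beta>)" using c M by auto
    have "h * (M * (g * sub_incl (fst \<alpha>) (fst \<beta>))) = h * M * (g * sub_incl (fst \<alpha>) (fst \<beta>))"
      using c M by (intro assoc_mult_mat[symmetric]) auto
    also have "\<dots> = h * M * g * sub_incl (fst \<alpha>) (fst \<beta>)"
      using c M by (intro assoc_mult_mat[symmetric, of _ "snd \<alpha> + snd \<beta>" "fst \<alpha> + fst \<beta>" _ "fst \<alpha> + fst \<beta>"]) auto
    finally show ?thesis using rs by (simp add: mult_sub_incl[OF hMg])
  qed
  fix r s assume rs: "r < snd \<alpha>" "s < fst \<beta>"
  show "(h * fst X * g) $$ (r, fst \<alpha> + s) = 0" using *[of "fst X", OF _ rs] z1[OF rs] X by (simp add: Rep_iff)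
  show "(h * snd X * g) $$ (r, fst \<alpha> + s) = 0" using *[of "snd X", OF _ rs] z2[OF rs] X by (simp add: Rep_iff)
qed

text \<open>The lines through \<open>u\<close> and \<open>v\<close> form a subrepresentation of
  dimension (1, 1). If \<open>A\<close> is singular, its kernel supplies \<open>u\<close>; otherwise
  an eigenvector of \<open>A' * B\<close> does, where \<open>A'\<close> is the inverse of
  \<open>A\<close>. The eigenvalue is where algebraic closedness enters.\<close>

lemma pencil_common_line:
  fixes A B :: "'k::alg_closed_field mat"
  assumes A: "A \<in> carrier_mat (Suc n) (Suc n)" and B: "B \<in> carrier_mat (Suc n) (Suc n)"
  shows "\<exists>u\<in>carrier_vec (Suc n). \<exists>v\<in>carrier_vec (Suc n). \<exists>c d.
    u \<noteq> 0\<^sub>v (Suc n) \<and> v \<noteq> 0\<^sub>v (Suc n) \<and> A *\<^sub>v u = c \<cdot>\<^sub>v v \<and> B *\<^sub>v u = d \<cdot>\<^sub>v v"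
proof (cases "\<exists>u\<in>carrier_vec (Suc n). u \<noteq> 0\<^sub>v (Suc n) \<and> A *\<^sub>v u = 0\<^sub>v (Suc n)")
  case True
  then obtain u where u: "u \<in> carrier_vec (Suc n)" "u \<noteq> 0\<^sub>v (Suc n)" "A *\<^sub>v u = 0\<^sub>v (Suc n)" by blast
  show ?thesis
  proof (cases "B *\<^sub>v u = 0\<^sub>v (Suc n)")
    case True
    \<comment> \<open>Both images vanish, so any nonzero vector may serve as \<open>v\<close>; here
      it is \<open>u\<close>.\<close>
    then have "A *\<^sub>v u = 0 \<cdot>\<^sub>v u" "B *\<^sub>v u = 0 \<cdot>\<^sub>v u" using u by (auto intro!: eq_vecI)
    with u show ?thesis by blast
  next
    case False
    have "B *\<^sub>v u \<in> carrier_vec (Suc n)" using B u by auto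
    moreover from this have "A *\<^sub>v u = 0 \<cdot>\<^sub>v (B *\<^sub>v u)" "B *\<^sub>v u = 1 \<cdot>\<^sub>v (B *\<^sub>v u)"
      using u B by (auto intro!: eq_vecI)
    ultimately show ?thesis using u False by blast
  qed
next
  case False
  then obtain A' where A': "inv_pair (Suc n) A A'" using inv_pair_of_injective[OF A] by blast
  define C where "C = A' * B"
  have C: "C \<in> carrier_mat (Suc n) (Suc n)" using inv_pairD[OF A'] B by (auto simp: C_def)
  have "degree (char_poly C) > 0" using degree_monic_char_poly[OF C] by simp
  then obtain c where "poly (char_poly C) c = 0" using alg_closed_imp_poly_has_root by blast
  then have "eigenvalue C c" using eigenvalue_root_char_poly[OF C] by simp
  then obtain u where u: "u \<in> carrier_vec (Suc n)" "u \<noteq> 0\<^sub>v (Suc n)" "C *\<^sub>v u = c \<cdot>\<^sub>v u"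
    using C by (auto simp: eigenvalue_def eigenvector_def)
  have "B = A * C" unfolding C_def by (rule inv_pair_cancel_left[OF A' B, symmetric])
  then have "B *\<^sub>v u = A *\<^sub>v (C *\<^sub>v u)" using assoc_mult_mat_vec[OF A C u(1)] by simp
  also have "\<dots> = c \<cdot>\<^sub>v (A *\<^sub>v u)" unfolding u(3) using A u(1) by (rule mult_mat_vec)
  finally have "B *\<^sub>v u = c \<cdot>\<^sub>v (A *\<^sub>v u)" .
  moreover have "A *\<^sub>v u = 1 \<cdot>\<^sub>v (A *\<^sub>v u)" by (auto intro!: eq_vecI)
  moreover have "A *\<^sub>v u \<in> carrier_vec (Suc n)" "A *\<^sub>v u \<noteq> 0\<^sub>v (Suc n)" using A u False by auto
  ultimately show ?thesis using u by blast
qed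

lemma Rep_square_step:
  "ext_prod (Rep (n, n)) (Rep (1, 1)) = (Rep (Suc n, Suc n) :: 'k::alg_closed_field krep set)"
proof
  show "ext_prod (Rep (n, n)) (Rep (1, 1)) \<subseteq> (Rep (Suc n, Suc n) :: 'k krep set)"
    using ext_prod_Rep_subset[of "(n, n)" "(1, 1)"] by (simp add: dim_add_def)
  show "Rep (Suc n, Suc n) \<subseteq> ext_prod (Rep (n, n)) (Rep (1, 1) :: 'k krep set)"
  proof
    fix X :: "'k krep" assume X: "X \<in> Rep (Suc n, Suc n)"
    then have AB: "fst X \<in> carrier_mat (Suc n) (Suc n)" "snd X \<in> carrier_mat (Suc n) (Suc n)"
      by (simp_all add: Rep_iff)
    from pencil_common_line[OF this] obtain u v c d where
      u: "u \<in> carrier_vec (Suc n)" "u \<noteq> 0\<^sub>v (Suc n)" and v: "v \<in> carrier_vec (Suc n)" "v \<noteq> 0\<^sub>v (Suc n)"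
      and uv: "fst X *\<^sub>v u = c \<cdot>\<^sub>v v" "snd X *\<^sub>v u = d \<cdot>\<^sub>v v" by blast
    obtain g g' where g: "inv_pair (Suc n) g g'" "col g n = u"
      using inv_pair_to_last_unit_vec[OF u] by blast
    obtain h h' where h: "inv_pair (Suc n) h h'" "h *\<^sub>v v = unit_vec (Suc n) n"
      using inv_pair_to_last_unit_vec[OF v] inv_pair_sym by blast
    note gc = inv_pairD[OF g(1)] inv_pairD[OF h(1)]
    define G where "G = g * sub_incl n 1"
    have G: "G \<in> carrier_mat (Suc n) 1" 
      using mult_carrier_mat[OF gc(1), of "sub_incl n 1" 1] incl_proj_carrier(1)[of n 1] by (simp add: G_def)
    have colG: "col G 0 = u"
      unfolding G_def using gc(1) by (subst mult_sub_incl[of g "Suc n"]) (auto simp: g(2)[symmetric] intro!: eq_vecI)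
    have zero: "(h * (M * G)) $$ (r, 0) = 0"
      if M: "M \<in> carrier_mat (Suc n) (Suc n)" and Mu: "M *\<^sub>v u = e \<cdot>\<^sub>v v" and r: "r < n" for M e r
    proof -
      have "col (h * (M * G)) 0 = h *\<^sub>v col (M * G) 0" using gc M G by (intro col_mult2) auto
      also have "col (M * G) 0 = M *\<^sub>v u" using M G colG by (subst col_mult2[of _ "Suc n" "Suc n" _ 1]) auto
      also have "h *\<^sub>v \<dots> = e \<cdot>\<^sub>v unit_vec (Suc n) n" unfolding Mu h(2)[symmetric] using gc v by (intro mult_mat_vec) auto
      finally have "col (h * (M * G)) 0 $ r = (e \<cdot>\<^sub>v unit_vec (Suc n) n) $ r" by simp
      then show ?thesis using r gc M G by simp
    qed
    show "X \<in> ext_prod (Rep (n, n)) (Rep (1, 1))"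
    proof (rule ext_prod_RepI_columns[where h = h and h' = h' and g = g and g' = g'])
      show "X \<in> Rep (dim_add (n, n) (1, 1))" using X by (simp add: dim_add_def)
    qed (use h g zero[OF AB(1) uv(1)] zero[OF AB(2) uv(2)] in \<open>auto simp: G_def\<close>)
  qed
qed

lemma filt_rrw: "filt (rrw m) = (Rep (m, m) :: 'k::alg_closed_field krep set)"
proof (induction m)
  case (Suc m)
  have "filt [Vi, Vj] = (Rep (1, 1) :: 'k krep set)" using filt_ijw[of 1 1] by (simp add: ijw_def)
  moreover have "rrw (Suc m) = rrw m @ [Vi, Vj]" using rrw_add[of m 1] by simp
  ultimately show ?case using Suc Rep_square_step by (simp add: filt_append)
qed simp

text \<open>
  \<open>u 0, \<dots>, u k\<close> are the images of the basis vectors at \<open>i\<close> under a homomorphism \<open>I\<^sub>k \<rightarrow> X\<close>.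
\<close>

definition pencil_sol :: "nat \<Rightarrow> dimvec \<Rightarrow> 'k::field krep \<Rightarrow> (nat \<Rightarrow> 'k vec) \<Rightarrow> bool" where
  "pencil_sol k \<alpha> X u \<longleftrightarrow> (\<forall>t. u t \<in> carrier_vec (fst \<alpha>)) \<and> (\<forall>t>k. u t = 0\<^sub>v (fst \<alpha>)) \<and>
     fst X *\<^sub>v u 0 = 0\<^sub>v (snd \<alpha>) \<and> (\<forall>t. fst X *\<^sub>v u (Suc t) = snd X *\<^sub>v u t)"

text \<open>The product of \<open>fst X\<close> - s \<open>snd X\<close> with the polynomial has
  coefficients in degrees 0 to k + 1, which gives k + 2 vector equations for k + 1 unknown vectors.
  The extra conditions \<open>E\<close> serve to force chosen linear forms of the solution to
  vanish.\<close>

lemma pencil_sol_exists: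
  fixes X :: "'k::field krep" and c :: "'e \<Rightarrow> nat \<Rightarrow> nat \<Rightarrow> 'k"
  assumes X: "X \<in> Rep \<alpha>" and E: "finite E"
    and card: "(k + 2) * snd \<alpha> + card E < (k + 1) * fst \<alpha>"
  shows "\<exists>u. pencil_sol k \<alpha> X u \<and> (\<exists>t. u t \<noteq> 0\<^sub>v (fst \<alpha>)) \<and>
    (\<forall>e\<in>E. (\<Sum>t\<le>k. \<Sum>s<fst \<alpha>. c e t s * u t $ s) = 0)"
proof -
  obtain a b where \<alpha>: "\<alpha> = (a, b)" by fastforce
  have AB: "fst X \<in> carrier_mat b a" "snd X \<in> carrier_mat b a" using X by (auto simp: Rep_iff \<alpha>)
  define V where "V = {..k} \<times> {..<a}"
  define F where "F = ({..Suc k} \<times> {..<b}) <+> E"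
  \<comment> \<open>\<open>Inl (t', r)\<close> is row \<open>r\<close> of the coefficient in degree
    \<open>t'\<close>, and \<open>Inr e\<close> is an extra condition.\<close>
  define q where "q = (\<lambda>f (t, s). case f of
      Inl (t', r) \<Rightarrow> (if t = t' then fst X $$ (r, s) else 0) - (if Suc t = t' then snd X $$ (r, s) else 0)
    | Inr e \<Rightarrow> c e t s)"
  have "card F < card V"
    using card E unfolding F_def V_def by (subst card_Plus) (auto simp: \<alpha>)
  moreover have "finite F" "finite V" using E by (auto simp: F_def V_def)
  ultimately obtain x where x: "\<exists>v\<in>V. x v \<noteq> 0" "\<And>f. f \<in> F \<Longrightarrow> (\<Sum>v\<in>V. q f v * x v) = 0"
    using homogeneous_system_nontrivial[of F V q] by blast
  have sumV: "(\<Sum>v\<in>V. q f v * x v) = (\<Sum>t\<le>k. \<Sum>s<a. q f (t, s) * x (t, s))" for f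
    unfolding V_def by (simp add: sum.cartesian_product)
  define u where "u t = (if t \<le> k then vec a (\<lambda>s. x (t, s)) else 0\<^sub>v a)" for t
  have u: "u t \<in> carrier_vec a" for t by (simp add: u_def)
  have Mu: "(M *\<^sub>v u t) $ r = (if t \<le> k then \<Sum>s<a. M $$ (r, s) * x (t, s) else 0)"
    if "M \<in> carrier_mat b a" "r < b" for M t r
    using that by (auto simp: u_def scalar_prod_def lessThan_atLeast0)
  have eq: "(fst X *\<^sub>v u t') $ r = (if t' = 0 then 0 else (snd X *\<^sub>v u (t' - 1)) $ r)"
    if "t' \<le> Suc k" "r < b" for t' r
  proof -
    have "(\<Sum>t\<le>k. \<Sum>s<a. q (Inl (t', r)) (t, s) * x (t, s)) =
      (\<Sum>t\<le>k. if t = t' then \<Sum>s<a. fst X $$ (r, s) * x (t, s) else 0) -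
      (\<Sum>t\<le>k. if Suc t = t' then \<Sum>s<a. snd X $$ (r, s) * x (t, s) else 0)"
      unfolding sum_subtractf[symmetric]
      by (intro sum.cong refl) (auto simp: q_def left_diff_distrib sum_subtractf sum_negf)
    also have "(\<Sum>t\<le>k. if t = t' then \<Sum>s<a. fst X $$ (r, s) * x (t, s) else 0) = (fst X *\<^sub>v u t') $ r"
      unfolding Mu[OF AB(1) that(2)] by (subst sum.delta) auto
    also have "(\<Sum>t\<le>k. if Suc t = t' then \<Sum>s<a. snd X $$ (r, s) * x (t, s) else 0) =
      (if t' = 0 then 0 else (snd X *\<^sub>v u (t' - 1)) $ r)"
    proof (cases t')
      case (Suc t'')
      then show ?thesis unfolding Mu[OF AB(2) that(2)] by simp
    qed auto
    finally show ?thesis using x(2)[of "Inl (t', r)"] that unfolding sumV by (auto simp: F_def Plus_def)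
  qed
  have "pencil_sol k \<alpha> X u"
    unfolding pencil_sol_def \<alpha> fst_conv snd_conv
  proof (intro conjI allI impI)
    show "fst X *\<^sub>v u 0 = 0\<^sub>v b" using eq[of 0] AB by (intro eq_vecI) auto
    fix t show "fst X *\<^sub>v u (Suc t) = snd X *\<^sub>v u t"
    proof (cases "t \<le> k")
      case True
      then show ?thesis using eq[of "Suc t"] AB by (intro eq_vecI) auto
    next
      case False
      then show ?thesis using Mu[OF AB(1)] Mu[OF AB(2)] AB by (intro eq_vecI) auto
    qed
  qed (auto simp: u_def)
  moreover have "\<exists>t. u t \<noteq> 0\<^sub>v a"
  proof -
    from x(1) obtain t s where ts: "t \<le> k" "s < a" "x (t, s) \<noteq> 0" by (auto simp: V_def)
    then have "u t $ s \<noteq> 0\<^sub>v a $ s" by (simp add: u_def)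
    then show ?thesis by metis
  qed
  moreover have "(\<Sum>t\<le>k. \<Sum>s<a. c e t s * u t $ s) = 0" if "e \<in> E" for e
  proof -
    have "(\<Sum>t\<le>k. \<Sum>s<a. q (Inr e) (t, s) * x (t, s)) = 0"
      using x(2)[of "Inr e"] that unfolding sumV by (auto simp: F_def Plus_def)
    then show ?thesis by (simp add: q_def u_def)
  qed
  ultimately show ?thesis by (auto simp: \<alpha>)
qed

text \<open>Dividing the polynomial by the highest possible power of its variable makes the constant
  coefficient nonzero and does not raise the degree.\<close>

lemma pencil_sol_shift:
  assumes X: "X \<in> Rep \<alpha>" and u: "pencil_sol k \<alpha> X u" and nz: "u t \<noteq> 0\<^sub>v (fst \<alpha>)"
  shows "\<exists>u'. pencil_sol k \<alpha> X u' \<and> u' 0 \<noteq> 0\<^sub>v (fst \<alpha>)"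
proof -
  define t0 where "t0 = (LEAST t. u t \<noteq> 0\<^sub>v (fst \<alpha>))"
  have t0: "u t0 \<noteq> 0\<^sub>v (fst \<alpha>)" unfolding t0_def by (rule LeastI[where P = "\<lambda>t. u t \<noteq> 0\<^sub>v (fst \<alpha>)", OF nz])
  have below: "u t = 0\<^sub>v (fst \<alpha>)" if "t < t0" for t using not_less_Least that unfolding t0_def by blast
  have "fst X *\<^sub>v u t0 = 0\<^sub>v (snd \<alpha>)"
  proof (cases t0)
    case (Suc t)
    then have "fst X *\<^sub>v u t0 = snd X *\<^sub>v 0\<^sub>v (fst \<alpha>)"
      using u below[of t] by (simp add: pencil_sol_def)
    also have "\<dots> = 0\<^sub>v (snd \<alpha>)" using X by (auto simp: Rep_iff)
    finally show ?thesis .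
  qed (use u in \<open>simp add: pencil_sol_def\<close>)
  with u t0 show ?thesis
    by (intro exI[of _ "\<lambda>t. u (t0 + t)"]) (auto simp: pencil_sol_def)
qed

section \<open>From a pencil solution to a subrepresentation\<close>

lemma rank_form_eq_sub_incl:
  assumes "r \<le> n" "r \<le> p"
  shows "(rank_form n p r :: 'k::field mat) =
    sub_incl (n - r) r * mat r p (\<lambda>(i, j). if j = p - r + i then 1 else 0)"
  using assms by (subst sub_incl_mult) (auto simp: rank_form_def intro!: eq_matI)

lemma sub_incl_mult_zero:
  assumes "M \<in> carrier_mat b n" "r < a" "s < n"
  shows "(sub_incl a b * M) $$ (r, s) = 0"
  using assms by (simp add: sub_incl_mult)

text \<open>
  A nonzero solution spans a subspace of dimension \<open>r \<le> k + 1\<close> at \<open>i\<close> on which the first map is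
  not injective; the second map sends it into the image of the first, of dimension \<open>< r\<close>.
\<close>

lemma pencil_sol_subrep:
  fixes X :: "'k::field krep"
  assumes X: "X \<in> Rep (a, b)" and u: "pencil_sol k (a, b) X u" and u0: "u 0 \<noteq> 0\<^sub>v a" and kb: "k \<le> b"
  shows "\<exists>e\<le>k. Suc e \<le> a \<and> X \<in> ext_prod (Rep (a - Suc e, b - e)) (Rep (Suc e, e))"
proof -
  have AB: "fst X \<in> carrier_mat b a" "snd X \<in> carrier_mat b a" using X by (auto simp: Rep_iff)
  have uc: "u t \<in> carrier_vec a" and uk: "k < t \<Longrightarrow> u t = 0\<^sub>v a"
    and Au0: "fst X *\<^sub>v u 0 = 0\<^sub>v b" and Au: "fst X *\<^sub>v u (Suc t) = snd X *\<^sub>v u t" for t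
    using u by (auto simp: pencil_sol_def)
  define M where "M = mat a (Suc k) (\<lambda>(r, t). u t $ r)"
  have M: "M \<in> carrier_mat a (Suc k)" by (simp add: M_def)
  have colM: "col M t = u t" if "t \<le> k" for t using that uc[of t] by (intro eq_vecI) (auto simp: M_def)
  \<comment> \<open>The shift of coefficients: column \<open>t\<close> of \<open>M * N\<close> is
    \<open>u (Suc t)\<close>, which is zero for \<open>t = k\<close>. The pencil equations become
    \<open>snd X * M = fst X * (M * N)\<close>.\<close>
  define N where "N = mat (Suc k) (Suc k) (\<lambda>(r, t). if r = Suc t then 1 else 0 :: 'k)"
  have N: "N \<in> carrier_mat (Suc k) (Suc k)" by (simp add: N_def)
  have MN: "M * N = mat a (Suc k) (\<lambda>(r, t). u (Suc t) $ r)"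
  proof (intro eq_matI)
    fix r t assume "r < dim_row (mat a (Suc k) (\<lambda>(r, t). u (Suc t) $ r))"
      "t < dim_col (mat a (Suc k) (\<lambda>(r, t). u (Suc t) $ r))"
    then have rt: "r < a" "t < Suc k" by auto
    have "(M * N) $$ (r, t) = (\<Sum>l = 0..<Suc k. u l $ r * (if l = Suc t then 1 else 0))"
      using rt by (simp add: M_def N_def scalar_prod_def del: sum.op_ivl_Suc)
    also have "\<dots> = (\<Sum>l = 0..<Suc k. if l = Suc t then u l $ r else 0)" by (intro sum.cong) auto
    also have "\<dots> = u (Suc t) $ r" using rt uk[of "Suc t"] by (subst sum.delta) auto
    finally show "(M * N) $$ (r, t) = mat a (Suc k) (\<lambda>(r, t). u (Suc t) $ r) $$ (r, t)" using rt by simp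
  qed (use M N in auto)
  have BM: "snd X * M = fst X * (M * N)"
  proof (intro eq_matI)
    fix r t assume "r < dim_row (fst X * (M * N))" "t < dim_col (fst X * (M * N))"
    then have rt: "r < b" "t \<le> k" using AB N by auto
    have "col (M * N) t = u (Suc t)" unfolding MN using rt uc[of "Suc t"] by (intro eq_vecI) auto
    then show "(snd X * M) $$ (r, t) = (fst X * (M * N)) $$ (r, t)"
      using rt AB M N colM[of t] arg_cong[OF Au[of t], of "\<lambda>v. v $ r"] by auto
  qed (use AB M N in auto)
  obtain P P' Q Q' r where rf: "inv_pair a P P'" "inv_pair (Suc k) Q Q'" "r \<le> a" "r \<le> Suc k"
    "P * M * Q = rank_form a (Suc k) r"
    using rank_normal_form[OF M] by blast
  note c = inv_pairD[OF rf(1)] inv_pairD[OF rf(2)]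
  define K where "K = mat r (Suc k) (\<lambda>(i, j). if j = Suc k - r + i then 1 else 0 :: 'k)"
  define L :: "'k mat" where "L = sub_incl (Suc k - r) r"
  \<comment> \<open>The columns of \<open>G\<close> form a basis of the column space of
    \<open>M\<close>; \<open>MGY\<close> and \<open>GMQ\<close> express each of the two matrices
    through the other.\<close>
  define G where "G = P' * sub_incl (a - r) r"
  have K: "K \<in> carrier_mat r (Suc k)" by (simp add: K_def)
  have L: "L \<in> carrier_mat (Suc k) r"
    using incl_proj_carrier(1)[of "Suc k - r" r] rf(4) by (simp add: L_def)
  have si: "sub_incl (a - r) r \<in> carrier_mat a r"
    using incl_proj_carrier(1)[of "a - r" r] rf(3) by simp
  have G: "G \<in> carrier_mat a r" unfolding G_def using c(2) si by (rule mult_carrier_mat)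
  have KL: "K * L = 1\<^sub>m r"
    unfolding L_def using rf(4) K by (subst mult_sub_incl[of K r]) (auto simp: K_def intro!: eq_matI)
  have PMQ: "P * M * Q = sub_incl (a - r) r * K"
    unfolding rf(5) K_def using rf by (intro rank_form_eq_sub_incl) auto
  have MQ: "M * Q = G * K"
  proof -
    have "M * Q = P' * (P * (M * Q))"
      using c M by (intro inv_pair_cancel_left[OF inv_pair_sym[OF rf(1)], symmetric]) auto
    also have "P * (M * Q) = P * M * Q" using c M by (intro assoc_mult_mat[symmetric]) auto
    also have "P' * \<dots> = G * K" unfolding PMQ G_def using c si K by (intro assoc_mult_mat[symmetric]) auto
    finally show ?thesis .
  qed
  have MGY: "M = G * (K * Q')"
  proof -
    have "M = M * Q * Q'" by (rule inv_pair_cancel_right[OF rf(2) M, symmetric])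
    also have "\<dots> = G * (K * Q')" unfolding MQ using G K c by (intro assoc_mult_mat) auto
    finally show ?thesis .
  qed
  have GMQ: "G = M * (Q * L)"
  proof -
    have "M * (Q * L) = M * Q * L" using M c L by (intro assoc_mult_mat[symmetric]) auto
    also have "\<dots> = G * (K * L)" unfolding MQ using G K L by (intro assoc_mult_mat) auto
    also have "\<dots> = G" using G by (simp add: KL)
    finally show ?thesis by simp
  qed
  define W where "W = fst X * G"
  have W: "W \<in> carrier_mat b r" using AB G by (simp add: W_def)
  \<comment> \<open>The shift in the coordinates of \<open>G\<close>: pass from \<open>G\<close> to
    \<open>M\<close>, shift, and pass back.\<close>
  define Z where "Z = K * Q' * (N * (Q * L))"
  have QL: "Q * L \<in> carrier_mat (Suc k) r" using c L by auto
  have KQ: "K * Q' \<in> carrier_mat r (Suc k)" using c K by auto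
  have NQL: "N * (Q * L) \<in> carrier_mat (Suc k) r" using N QL by (rule mult_carrier_mat)
  have Z: "Z \<in> carrier_mat r r" unfolding Z_def using KQ NQL by (rule mult_carrier_mat)
  have BG: "snd X * G = W * Z"
  proof -
    have "snd X * G = snd X * M * (Q * L)"
      by (subst GMQ) (rule assoc_mult_mat[OF AB(2) M QL, symmetric])
    also have "\<dots> = fst X * (M * N * (Q * L))"
      unfolding BM by (rule assoc_mult_mat[OF AB(1) mult_carrier_mat[OF M N] QL])
    also have "M * N * (Q * L) = M * (N * (Q * L))" by (rule assoc_mult_mat[OF M N QL])
    also have "\<dots> = G * Z" unfolding Z_def by (subst MGY) (rule assoc_mult_mat[OF G KQ NQL])
    also have "fst X * (G * Z) = W * Z" unfolding W_def by (rule assoc_mult_mat[OF AB(1) G Z, symmetric])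
    finally show ?thesis .
  qed
  \<comment> \<open>The coordinates of \<open>u 0\<close> with respect to \<open>G\<close>. The
    first map kills \<open>u 0\<close>, so \<open>W\<close> has a nonzero kernel and its rank is
    below \<open>r\<close>.\<close>
  define y where "y = col (K * Q') 0"
  have y: "y \<in> carrier_vec r" unfolding y_def using KQ by (intro col_carrier_vec) auto
  have Gy: "G *\<^sub>v y = u 0"
  proof -
    have "G *\<^sub>v y = col (G * (K * Q')) 0" unfolding y_def using G KQ by (intro col_mult2[symmetric]) auto
    then show ?thesis using MGY colM[of 0] by simp
  qed
  have "G *\<^sub>v 0\<^sub>v r = 0\<^sub>v a" using G by (intro eq_vecI) auto
  then have y0: "y \<noteq> 0\<^sub>v r" using Gy u0 by auto
  have Wy: "W *\<^sub>v y = 0\<^sub>v b" unfolding W_def using assoc_mult_mat_vec[OF AB(1) G y] Gy Au0 by simp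
  \<comment> \<open>Here \<open>R\<close> moves the image of \<open>W\<close> into the last
    \<open>s\<close> coordinates at j.\<close>
  obtain R R' S S' s where rg: "inv_pair b R R'" "inv_pair r S S'" "s \<le> b" "s \<le> r"
    "R * W * S = rank_form b r s"
    using rank_normal_form[OF W] by blast
  note d = inv_pairD[OF rg(1)] inv_pairD[OF rg(2)]
  define T where "T = mat s r (\<lambda>(i, j). if j = r - s + i then 1 else 0 :: 'k)"
  have T: "T \<in> carrier_mat s r" by (simp add: T_def)
  have si': "sub_incl (b - s) s \<in> carrier_mat b s"
    using incl_proj_carrier(1)[of "b - s" s] rg(3) by simp
  have RW: "R * W = sub_incl (b - s) s * (T * S')"
  proof -
    have "R * W = R * W * S * S'" using d W by (intro inv_pair_cancel_right[OF rg(2), symmetric]) auto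
    also have "R * W * S = sub_incl (b - s) s * T"
      unfolding rg(5) T_def using rg by (intro rank_form_eq_sub_incl) auto
    also have "\<dots> * S' = sub_incl (b - s) s * (T * S')" using si' T d by (intro assoc_mult_mat) auto
    finally show ?thesis .
  qed
  have TS: "T * S' \<in> carrier_mat s r" using T d by auto
  have "s \<noteq> r"
  proof
    assume sr: "s = r"
    have T1: "T = 1\<^sub>m r" using sr by (intro eq_matI) (auto simp: T_def)
    have S'y: "S' *\<^sub>v y \<in> carrier_vec r" using d y by auto
    have "sub_incl (b - s) s *\<^sub>v (S' *\<^sub>v y) = sub_incl (b - s) s * S' *\<^sub>v y"
      using si' d y sr by (intro assoc_mult_mat_vec[symmetric]) auto
    also have "sub_incl (b - s) s * S' = R * W" using RW T1 d by simp
    also have "R * W *\<^sub>v y = R *\<^sub>v (W *\<^sub>v y)" using d W y by (intro assoc_mult_mat_vec) auto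
    also have "\<dots> = 0\<^sub>v b" using Wy d by auto
    finally have z: "sub_incl (b - s) s *\<^sub>v (S' *\<^sub>v y) = 0\<^sub>v b" .
    have "(S' *\<^sub>v y) $ i = 0" if "i < r" for i
    proof -
      obtain l where l: "b = l + r" using rg(3) sr by (metis le_Suc_ex add.commute)
      show ?thesis
        using arg_cong[OF z, of "\<lambda>v. v $ (l + i)"] that S'y
        by (simp add: sub_incl_mult_vec sr l)
    qed
    then have "S' *\<^sub>v y = 0\<^sub>v r" using S'y carrier_vecD[OF S'y] by (intro eq_vecI) (simp_all del: dim_mult_mat_vec index_mult_mat_vec)
    then have "S *\<^sub>v (S' *\<^sub>v y) = 0\<^sub>v r" using d by auto
    moreover have "S *\<^sub>v (S' *\<^sub>v y) = y" using d y by (subst assoc_mult_mat_vec[symmetric]) auto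
    ultimately show False using y0 by simp
  qed
  \<comment> \<open>The image of \<open>W\<close> has dimension \<open>s \<le> e\<close>; it is
    enlarged to the last \<open>e\<close> coordinates so that the subrepresentation has dimension
    exactly \<open>(Suc e, e)\<close>.\<close>
  then obtain e where e: "r = Suc e" "s \<le> e" using rg(4) by (cases r) auto
  have RWz: "(R * W) $$ (i, j) = 0" if "i < b - e" "j < r" for i j
    unfolding RW using that e by (intro sub_incl_mult_zero[OF TS]) auto
  have RWZz: "(R * (W * Z)) $$ (i, j) = 0" if "i < b - e" "j < r" for i j
  proof -
    have "R * (W * Z) = R * W * Z" using d W Z by (intro assoc_mult_mat[symmetric]) auto
    also have "\<dots> = sub_incl (b - s) s * (T * S' * Z)"
      unfolding RW by (rule assoc_mult_mat[OF si' TS Z])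
    finally show ?thesis
      using that e sub_incl_mult_zero[of "T * S' * Z" s r i "b - s" j] TS Z by auto
  qed
  have "X \<in> ext_prod (Rep (a - Suc e, b - e)) (Rep (Suc e, e))"
  proof (rule ext_prod_RepI_columns[where h = R and h' = R' and g = P' and g' = P])
    show "X \<in> Rep (dim_add (a - Suc e, b - e) (Suc e, e))"
      using X rf e kb by (simp add: dim_add_def)
  qed (use rf(3,4) rg(1) inv_pair_sym[OF rf(1)] RWz RWZz e kb in
      \<open>simp_all add: G_def[symmetric, unfolded e(1)] W_def[symmetric] BG\<close>)
  then show ?thesis using e rf by auto
qed

text \<open>The full space of dimension (m+1, m) is the value of i followed by \<open>rrw m\<close>,
  and multiplying by \<open>rrw l\<close> on the right only lengthens the power.\<close>

lemma Rep_ext_prod_square: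
  "ext_prod (Rep (Suc m, m)) (Rep (l, l)) = (Rep (Suc (m + l), m + l) :: 'k::alg_closed_field krep set)"
proof -
  have "Rep (Suc n, n) = (filt ([Vi] @ rrw n) :: 'k krep set)" for n
    unfolding filt_append filt_rrw by (simp add: ext_prod_unit_right iso_closed_Rep ext_prod_Rep_split dim_add_def)
  then have "ext_prod (Rep (Suc m, m)) (Rep (l, l)) = (filt (([Vi] @ rrw m) @ rrw l) :: 'k krep set)"
    by (simp only: filt_append filt_rrw)
  also have "\<dots> = filt ([Vi] @ rrw (m + l))" by (simp only: rrw_add append_assoc)
  also have "\<dots> = Rep (Suc (m + l), m + l)"
    unfolding filt_append filt_rrw by (simp add: ext_prod_unit_right iso_closed_Rep ext_prod_Rep_split dim_add_def)
  finally show ?thesis .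
qed

text \<open>Counting only yields a subrepresentation of dimension \<open>(Suc e, e)\<close> with
  some \<open>e \<le> n\<close>. The missing \<open>(l, l)\<close> is split off from the quotient as
  a square factor and merged with the subrepresentation.\<close>

lemma Rep_preinjective_product:
  "ext_prod (Rep (n + 2, n + 1)) (Rep (n + 1, n)) = (Rep (2 * n + 3, 2 * n + 1) :: 'k::alg_closed_field krep set)"
proof
  show "ext_prod (Rep (n + 2, n + 1)) (Rep (n + 1, n)) \<subseteq> (Rep (2 * n + 3, 2 * n + 1) :: 'k krep set)"
    using ext_prod_Rep_subset[of "(n + 2, n + 1)" "(n + 1, n)"]
    by (simp add: dim_add_def mult_2 eval_nat_numeral)
  show "Rep (2 * n + 3, 2 * n + 1) \<subseteq> ext_prod (Rep (n + 2, n + 1)) (Rep (n + 1, n) :: 'k krep set)"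
  proof
    fix X :: "'k krep" assume X: "X \<in> Rep (2 * n + 3, 2 * n + 1)"
    \<comment> \<open>For solutions of degree at most \<open>n\<close> the unknowns outnumber the
      equations by exactly one.\<close>
    have "(n + 2) * (2 * n + 1) < (n + 1) * (2 * n + 3)" by (simp add: algebra_simps)
    then obtain u t where "pencil_sol n (2 * n + 3, 2 * n + 1) X u" "u t \<noteq> 0\<^sub>v (2 * n + 3)"
      using pencil_sol_exists[OF X, of "{}" n] by auto
    then obtain u where u: "pencil_sol n (2 * n + 3, 2 * n + 1) X u" "u 0 \<noteq> 0\<^sub>v (2 * n + 3)"
      using pencil_sol_shift[OF X] by fastforce
    obtain e where e: "e \<le> n"
      "X \<in> ext_prod (Rep (2 * n + 3 - Suc e, 2 * n + 1 - e)) (Rep (Suc e, e))"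
      using pencil_sol_subrep[OF X u] by auto
    define l where "l = n - e"
    have n: "n = l + e" using e(1) by (simp add: l_def)
    have 1: "Rep (2 * n + 3 - Suc e, 2 * n + 1 - e) = ext_prod (Rep (n + 2, n + 1)) (Rep (l, l) :: 'k krep set)"
      using Rep_ext_prod_square[of "n + 1" l, where 'k = 'k] by (simp add: n eval_nat_numeral ac_simps mult_2)
    have 2: "ext_prod (Rep (l, l)) (Rep (Suc e, e)) \<subseteq> (Rep (n + 1, n) :: 'k krep set)"
      using ext_prod_Rep_subset[of "(l, l)" "(Suc e, e)"] by (simp add: n dim_add_def)
    have "X \<in> ext_prod (Rep (n + 2, n + 1)) (ext_prod (Rep (l, l)) (Rep (Suc e, e)))"
      using e(2) unfolding 1 ext_prod_assoc .
    then show "X \<in> ext_prod (Rep (n + 2, n + 1)) (Rep (n + 1, n))"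
      using ext_prod_mono[OF subset_refl 2] by blast
  qed
qed

lemma transpose_rep_filt: "transpose_rep ` filt w = (filt (dual_word w) :: 'k::field krep set)"
proof (induction w)
  case (Cons x w)
  have *: "transpose_rep ` simple_class x = (filt [swap_vertex x] :: 'k krep set)"
    by (cases x) (simp_all add: transpose_rep_image_Rep ext_prod_unit_right iso_closed_Rep)
  have "transpose_rep ` (filt (x # w) :: 'k krep set) = ext_prod (transpose_rep ` filt w) (transpose_rep ` simple_class x)"
    by (simp add: transpose_rep_ext_prod)
  also have "\<dots> = filt (dual_word w @ [swap_vertex x])" by (simp only: Cons * filt_append)
  finally show ?case by (simp add: dual_word_def)
qed (simp add: transpose_rep_image_Rep)

lemma filt_cong:
  assumes "u \<approx> v" shows "filt u = (filt v :: 'k::alg_closed_field krep set)"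
  using assms
proof (induction rule: word_cong.induct)
  case (rel u v)
  have q: "filt (qqw (Suc n) @ qqw n) = (filt (ijw (2 * n + 3) (2 * n + 1)) :: 'k krep set)" for n
    using Rep_preinjective_product[of n, where 'k = 'k] by (simp add: filt_append filt_ijw)
  have p: "filt (ppw n @ ppw (Suc n)) = (filt (ijw (2 * n + 1) (2 * n + 3)) :: 'k krep set)" for n
    using arg_cong[OF q[of n], of "image transpose_rep"] by (simp add: transpose_rep_filt)
  from rel consider m where "u = ppw m @ ppw (Suc m)" "v = ijw (2 * m + 1) (2 * m + 3)"
    | n where "u = qqw (Suc n) @ qqw n" "v = ijw (2 * n + 3) (2 * n + 1)"
    | m where "u = rrw m" "v = ijw m m"
    unfolding kron_rels_def ijw_def by auto
  then show ?case using p q by cases (simp_all only: filt_ijw filt_rrw)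
qed (simp_all add: filt_append)

section \<open>Separating the normal forms\<close>

text \<open>
  A bound \<open>n\<close> for \<open>dim Hom(I\<^sub>k, X)\<close>, witnessed by \<open>n\<close> coordinates that determine a homomorphism.
\<close>

definition sol_bound :: "nat \<Rightarrow> dimvec \<Rightarrow> 'k::field krep \<Rightarrow> nat \<Rightarrow> bool" where
  "sol_bound k \<alpha> X n \<longleftrightarrow> (\<exists>\<Phi> \<subseteq> {..k} \<times> {..<fst \<alpha>}. card \<Phi> \<le> n \<and>
     (\<forall>u. pencil_sol k \<alpha> X u \<longrightarrow> (\<forall>(t, s)\<in>\<Phi>. u t $ s = 0) \<longrightarrow> (\<forall>t. u t = 0\<^sub>v (fst \<alpha>))))"

text \<open>Hom(I_k, B) embeds in Hom(I_k, X). In coordinates: if the inequality failed,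
  \<open>B\<close> would have a nonzero solution whose image in \<open>X\<close> vanishes at the
  chosen coordinates, hence altogether, against the injectivity of the inclusion.\<close>

lemma sol_bound_subrep:
  fixes X :: "'k::field krep"
  assumes bound: "sol_bound k \<gamma> X n" and X: "X \<in> Rep \<gamma>" "X \<in> ext_prod (Rep \<alpha>) (Rep \<beta>)"
  shows "(k + 1) * fst \<beta> \<le> (k + 2) * snd \<beta> + n"
proof (rule ccontr)
  assume "\<not> ?thesis"
  then have gt: "(k + 2) * snd \<beta> + n < (k + 1) * fst \<beta>" by simp
  from X(2) obtain A B where A: "A \<in> Rep \<alpha>" and B: "B \<in> Rep \<beta>" and ex: "is_extension \<alpha> \<beta> A B X"
    and X': "X \<in> Rep (dim_add \<alpha> \<beta>)"
    unfolding ext_prod_def using Rep_dim_unique by blast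
  have \<gamma>: "\<gamma> = dim_add \<alpha> \<beta>" using Rep_dim_unique X(1) X' by blast
  from ex obtain f f' where hom: "(f, f') \<in> krep_hom \<beta> \<gamma> B X"
    and inj: "inj_on (\<lambda>v. f *\<^sub>v v) (carrier_vec (dim_col f))"
    unfolding is_extension_def short_exact_mat_def \<gamma> by fastforce
  then have f: "f \<in> carrier_mat (fst \<gamma>) (fst \<beta>)" "f' \<in> carrier_mat (snd \<gamma>) (snd \<beta>)"
    "f' * fst B = fst X * f" "f' * snd B = snd X * f" by (auto simp: krep_hom_def)
  have XB: "fst X \<in> carrier_mat (snd \<gamma>) (fst \<gamma>)" "snd X \<in> carrier_mat (snd \<gamma>) (fst \<gamma>)"
    "fst B \<in> carrier_mat (snd \<beta>) (fst \<beta>)" "snd B \<in> carrier_mat (snd \<beta>) (fst \<beta>)"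
    using X(1) B by (auto simp: Rep_iff)
  from bound obtain \<Phi> where \<Phi>: "\<Phi> \<subseteq> {..k} \<times> {..<fst \<gamma>}" "card \<Phi> \<le> n"
    and zero: "\<And>u t. pencil_sol k \<gamma> X u \<Longrightarrow> \<forall>(t, s)\<in>\<Phi>. u t $ s = 0 \<Longrightarrow> u t = 0\<^sub>v (fst \<gamma>)"
    unfolding sol_bound_def by blast
  have fin: "finite \<Phi>" using \<Phi>(1) by (rule finite_subset) auto
  \<comment> \<open>The condition \<open>u t $ s = 0\<close> on \<open>X\<close>, pulled back to
    \<open>B\<close> along the inclusion \<open>f\<close>.\<close>
  define c where "c = (\<lambda>(t :: nat, s) t' j. if t' = t then f $$ (s, j) else 0)"
  obtain y where y: "pencil_sol k \<beta> B y" "\<exists>t. y t \<noteq> 0\<^sub>v (fst \<beta>)"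
    and cy: "\<And>e. e \<in> \<Phi> \<Longrightarrow> (\<Sum>t\<le>k. \<Sum>s<fst \<beta>. c e t s * y t $ s) = 0"
    using pencil_sol_exists[OF B fin, of k c] gt \<Phi>(2) by force
  have yc: "y t \<in> carrier_vec (fst \<beta>)" for t using y(1) by (simp add: pencil_sol_def)
  define u where "u t = f *\<^sub>v y t" for t
  have Mu: "M *\<^sub>v u t = f' *\<^sub>v (N *\<^sub>v y t)"
    if "M \<in> carrier_mat (snd \<gamma>) (fst \<gamma>)" "N \<in> carrier_mat (snd \<beta>) (fst \<beta>)" "f' * N = M * f" for M N t
  proof -
    have "M *\<^sub>v u t = M * f *\<^sub>v y t" unfolding u_def by (rule assoc_mult_mat_vec[OF that(1) f(1) yc, symmetric])
    also have "\<dots> = f' *\<^sub>v (N *\<^sub>v y t)" unfolding that(3)[symmetric] by (rule assoc_mult_mat_vec[OF f(2) that(2) yc])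
    finally show ?thesis .
  qed
  have "pencil_sol k \<gamma> X u"
    unfolding pencil_sol_def Mu[OF XB(1,3) f(3)] Mu[OF XB(2,4) f(4)]
    using y(1) f unfolding pencil_sol_def by (auto simp: u_def)
  moreover have "\<forall>(t, s)\<in>\<Phi>. u t $ s = 0"
  proof clarify
    fix t s assume ts: "(t, s) \<in> \<Phi>"
    then have t: "t \<le> k" "s < fst \<gamma>" using \<Phi>(1) by auto
    have "(\<Sum>t'\<le>k. if t' = t then \<Sum>j<fst \<beta>. f $$ (s, j) * y t' $ j else 0) = 0"
      using cy[OF ts] by (subst sum.cong[OF HOL.refl, where h = "\<lambda>t'. \<Sum>j<fst \<beta>. c (t, s) t' j * y t' $ j"])
        (auto simp: c_def)
    then show "u t $ s = 0"
      using t f(1) yc[of t] by (simp add: u_def scalar_prod_def lessThan_atLeast0)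
  qed
  ultimately have u0: "u t = 0\<^sub>v (fst \<gamma>)" for t by (rule zero)
  have "y t = 0\<^sub>v (fst \<beta>)" for t
  proof (rule inj_onD[OF inj])
    show "f *\<^sub>v y t = f *\<^sub>v 0\<^sub>v (fst \<beta>)" using u0[of t] f(1) by (auto simp: u_def)
  qed (use f(1) yc in auto)
  then show False using y(2) by blast
qed

text \<open>Left exactness of Hom(I_k, -): a solution whose component in the quotient
  \<open>A\<close> vanishes is a solution in \<open>B\<close>. So the coordinates chosen for
  \<open>A\<close> and \<open>B\<close> together determine a solution in the extension.\<close>

lemma sol_bound_block:
  fixes A :: "'k::field krep"
  assumes A: "A \<in> Rep \<alpha>" and B: "B \<in> Rep \<beta>" and C: "C \<in> Rep (fst \<alpha>, snd \<beta>)"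
    and bA: "sol_bound k \<alpha> A m" and bB: "sol_bound k \<beta> B n"
  shows "sol_bound k (dim_add \<alpha> \<beta>) (rep_block A C B) (m + n)"
proof -
  from bA obtain \<Phi> where \<Phi>: "\<Phi> \<subseteq> {..k} \<times> {..<fst \<alpha>}" "card \<Phi> \<le> m"
    and zA: "\<And>u t. pencil_sol k \<alpha> A u \<Longrightarrow> \<forall>(t, s)\<in>\<Phi>. u t $ s = 0 \<Longrightarrow> u t = 0\<^sub>v (fst \<alpha>)"
    unfolding sol_bound_def by blast
  from bB obtain \<Psi> where \<Psi>: "\<Psi> \<subseteq> {..k} \<times> {..<fst \<beta>}" "card \<Psi> \<le> n"
    and zB: "\<And>u t. pencil_sol k \<beta> B u \<Longrightarrow> \<forall>(t, s)\<in>\<Psi>. u t $ s = 0 \<Longrightarrow> u t = 0\<^sub>v (fst \<beta>)"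
    unfolding sol_bound_def by blast
  \<comment> \<open>The coordinates of \<open>B\<close> come after the first
    \<open>fst \<alpha>\<close>.\<close>
  define \<Psi>' where "\<Psi>' = (\<lambda>(t, s). (t, fst \<alpha> + s)) ` \<Psi>"
  have fin: "finite \<Psi>" using \<Psi>(1) by (rule finite_subset) auto
  have "card (\<Phi> \<union> \<Psi>') \<le> card \<Phi> + card \<Psi>'" by (rule card_Un_le)
  also have "\<dots> \<le> m + n" using \<Phi>(2) \<Psi>(2) card_image_le[OF fin, of "\<lambda>(t, s). (t, fst \<alpha> + s)"]
    by (simp add: \<Psi>'_def)
  finally have card: "card (\<Phi> \<union> \<Psi>') \<le> m + n" .
  have sub: "\<Phi> \<union> \<Psi>' \<subseteq> {..k} \<times> {..<fst (dim_add \<alpha> \<beta>)}" using \<Phi>(1) \<Psi>(1) by (auto simp: \<Psi>'_def)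
  have "u t = 0\<^sub>v (fst (dim_add \<alpha> \<beta>))"
    if u: "pencil_sol k (dim_add \<alpha> \<beta>) (rep_block A C B) u" and z: "\<forall>(t, s)\<in>\<Phi> \<union> \<Psi>'. u t $ s = 0" for u t
  proof -
    define v where "v t = vec_first (u t) (fst \<alpha>)" for t
    define w where "w t = vec_last (u t) (fst \<beta>)" for t
    have c: "fst A \<in> carrier_mat (snd \<alpha>) (fst \<alpha>)" "snd A \<in> carrier_mat (snd \<alpha>) (fst \<alpha>)"
      "fst B \<in> carrier_mat (snd \<beta>) (fst \<beta>)" "snd B \<in> carrier_mat (snd \<beta>) (fst \<beta>)"
      "fst C \<in> carrier_mat (snd \<beta>) (fst \<alpha>)" "snd C \<in> carrier_mat (snd \<beta>) (fst \<alpha>)"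
      using A B C by (auto simp: Rep_iff)
    have uc: "u t \<in> carrier_vec (fst \<alpha> + fst \<beta>)" and uk: "k < t \<Longrightarrow> u t = 0\<^sub>v (fst \<alpha> + fst \<beta>)" for t
      using u by (auto simp: pencil_sol_def)
    have vw: "v t \<in> carrier_vec (fst \<alpha>)" "w t \<in> carrier_vec (fst \<beta>)" "u t = v t @\<^sub>v w t" for t
      using uc[of t] by (simp_all add: v_def w_def vec_first_last_append)
    have mult: "fst (rep_block A C B) *\<^sub>v u t = (fst A *\<^sub>v v t) @\<^sub>v (fst C *\<^sub>v v t + fst B *\<^sub>v w t)"
      "snd (rep_block A C B) *\<^sub>v u t = (snd A *\<^sub>v v t) @\<^sub>v (snd C *\<^sub>v v t + snd B *\<^sub>v w t)" for t
    proof -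
      have "four_block_mat A1 (0\<^sub>m (dim_row A1) (dim_col B1)) C1 B1 *\<^sub>v u t =
          (A1 *\<^sub>v v t) @\<^sub>v (C1 *\<^sub>v v t + B1 *\<^sub>v w t)"
        if "A1 \<in> carrier_mat (snd \<alpha>) (fst \<alpha>)" "B1 \<in> carrier_mat (snd \<beta>) (fst \<beta>)"
          "C1 \<in> carrier_mat (snd \<beta>) (fst \<alpha>)" for A1 B1 C1
        unfolding vw(3) using that vw(1,2)[of t]
        by (subst four_block_mat_mult_vec[of _ "snd \<alpha>" "fst \<alpha>" _ "fst \<beta>" _ "snd \<beta>"])
           (auto intro!: eq_vecI)
      then show "fst (rep_block A C B) *\<^sub>v u t = (fst A *\<^sub>v v t) @\<^sub>v (fst C *\<^sub>v v t + fst B *\<^sub>v w t)"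
        "snd (rep_block A C B) *\<^sub>v u t = (snd A *\<^sub>v v t) @\<^sub>v (snd C *\<^sub>v v t + snd B *\<^sub>v w t)"
        using c by (simp_all add: rep_block_def)
    qed
    have zero_split: "0\<^sub>v (a + b) = (0\<^sub>v a @\<^sub>v 0\<^sub>v b :: 'k vec)" for a b by (intro eq_vecI) auto
    have e0: "(fst A *\<^sub>v v 0) @\<^sub>v (fst C *\<^sub>v v 0 + fst B *\<^sub>v w 0) = 0\<^sub>v (snd \<alpha>) @\<^sub>v 0\<^sub>v (snd \<beta>)"
      using u unfolding pencil_sol_def mult zero_split[symmetric] by simp
    have eS: "(fst A *\<^sub>v v (Suc t)) @\<^sub>v (fst C *\<^sub>v v (Suc t) + fst B *\<^sub>v w (Suc t)) =
      (snd A *\<^sub>v v t) @\<^sub>v (snd C *\<^sub>v v t + snd B *\<^sub>v w t)" for t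
      using u unfolding pencil_sol_def mult by blast
    have e0': "fst A *\<^sub>v v 0 = 0\<^sub>v (snd \<alpha>)" "fst C *\<^sub>v v 0 + fst B *\<^sub>v w 0 = 0\<^sub>v (snd \<beta>)"
      using e0 append_vec_eq[of "fst A *\<^sub>v v 0" "snd \<alpha>" "0\<^sub>v (snd \<alpha>)"] c vw by auto
    have eS': "fst A *\<^sub>v v (Suc t) = snd A *\<^sub>v v t"
      "fst C *\<^sub>v v (Suc t) + fst B *\<^sub>v w (Suc t) = snd C *\<^sub>v v t + snd B *\<^sub>v w t" for t
      using eS[of t] append_vec_eq[of "fst A *\<^sub>v v (Suc t)" "snd \<alpha>" "snd A *\<^sub>v v t"] c vw by auto
    have vk: "v t = 0\<^sub>v (fst \<alpha>)" and wk: "w t = 0\<^sub>v (fst \<beta>)" if "k < t" for t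
      using uk[OF that] by (auto simp: v_def w_def vec_first_def vec_last_def intro!: eq_vecI)
    have "pencil_sol k \<alpha> A v" using vw vk e0' eS' by (simp add: pencil_sol_def)
    moreover have "\<forall>(t, s)\<in>\<Phi>. v t $ s = 0" using z \<Phi>(1) by (fastforce simp: v_def vec_first_def)
    ultimately have v0: "v t = 0\<^sub>v (fst \<alpha>)" for t by (rule zA)
    have C0: "fst C *\<^sub>v v t = 0\<^sub>v (snd \<beta>)" "snd C *\<^sub>v v t = 0\<^sub>v (snd \<beta>)" for t
      using c by (auto simp: v0)
    have Bw: "fst B *\<^sub>v w t \<in> carrier_vec (snd \<beta>)" "snd B *\<^sub>v w t \<in> carrier_vec (snd \<beta>)" for t
      using c vw(2)[of t] by auto
    \<comment> \<open>Only now, with \<open>v\<close> known to vanish, does the corner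
      \<open>C\<close> drop out of the equations for \<open>w\<close>.\<close>
    have "pencil_sol k \<beta> B w"
      using vw(2) wk e0'(2) eS'(2) Bw unfolding pencil_sol_def C0 by simp
    moreover have "\<forall>(t, s)\<in>\<Psi>. w t $ s = 0"
    proof clarify
      fix t s assume ts: "(t, s) \<in> \<Psi>"
      then have "u t $ (fst \<alpha> + s) = 0" using z by (force simp: \<Psi>'_def)
      moreover have "s < fst \<beta>" using ts \<Psi>(1) by auto
      ultimately show "w t $ s = 0" using vw[of t] by simp
    qed
    ultimately have "w t = 0\<^sub>v (fst \<beta>)" by (rule zB)
    then show ?thesis unfolding vw(3)[of t] v0 by (simp add: zero_split)
  qed
  then show ?thesis unfolding sol_bound_def using sub card by blast
qed

text \<open>A single member bounds the minimum of dim Hom(I_k, X) over the set. The first argument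
  fixes the field, which occurs in no other argument.\<close>

definition filt_bound :: "'k::field itself \<Rightarrow> nat \<Rightarrow> kvertex list \<Rightarrow> nat \<Rightarrow> bool" where
  "filt_bound _ k w n \<longleftrightarrow> (\<exists>\<alpha>. \<exists>X \<in> filt w \<inter> (Rep \<alpha> :: 'k krep set). sol_bound k \<alpha> X n)"

lemma filt_bound_append:
  assumes "filt_bound TYPE('k::field) k u m" "filt_bound TYPE('k) k v n"
  shows "filt_bound TYPE('k) k (u @ v) (m + n)"
proof -
  from assms obtain \<alpha> \<beta> and A B :: "'k krep" where *: "A \<in> filt u" "A \<in> Rep \<alpha>" "B \<in> filt v" "B \<in> Rep \<beta>"
    "sol_bound k \<alpha> A m" "sol_bound k \<beta> B n" unfolding filt_bound_def by blast
  obtain C :: "'k krep" where C: "C \<in> Rep (fst \<alpha>, snd \<beta>)" using Rep_nonempty by blast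
  have "rep_block A C B \<in> filt (u @ v)"
    unfolding filt_append ext_prod_iff using * C rep_iso_refl[OF rep_block_in_Rep[OF *(2,4)]] by blast
  moreover have "rep_block A C B \<in> Rep (dim_add \<alpha> \<beta>)" by (rule rep_block_in_Rep[OF *(2,4)])
  ultimately show ?thesis unfolding filt_bound_def using sol_bound_block[OF *(2,4) C *(5,6)] by blast
qed

text \<open>For an injective first map and a zero second map, the equations say that the first map
  kills every coefficient. This covers the factors \<open>ppw a\<close> and
  \<open>rrw m\<close>.\<close>

lemma filt_bound_injective:
  assumes "a \<le> b" "filt w = (Rep (a, b) :: 'k::field krep set)"
  shows "filt_bound TYPE('k) k w 0"
proof -
  define X :: "'k krep" where "X = (mat b a (\<lambda>(r, s). if s = r then 1 else 0), 0\<^sub>m b a)"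
  have X: "X \<in> Rep (a, b)" by (simp add: X_def Rep_iff)
  have "u t = 0\<^sub>v a" if u: "pencil_sol k (a, b) X u" for u t
  proof -
    have uc: "u t \<in> carrier_vec a" for t using u by (simp add: pencil_sol_def)
    have "fst X *\<^sub>v u t = 0\<^sub>v b"
      using u uc[of "t - 1"] by (cases t) (auto simp: pencil_sol_def X_def)
    moreover have "(fst X *\<^sub>v u t) $ s = u t $ s" if "s < a" for s
      using that uc[of t] assms(1) by (simp add: X_def scalar_prod_def scalar_prod_unit_left)
    ultimately show ?thesis using uc[of t] assms(1) by (intro eq_vecI) auto
  qed
  then have "sol_bound k (a, b) X 0" unfolding sol_bound_def by (intro exI[of _ "{}"]) auto
  then show ?thesis unfolding filt_bound_def using X assms(2) by blast
qed

text \<open>For I_b, given by two shifted identity matrices, the equations make a solution constant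
  along diagonals and zero at the nonzero positions of \<open>u 0\<close>. It is thus determined by
  the entries \<open>u t $ 0\<close>, and such an entry reappears as \<open>u (t + b) $ b\<close>,
  which is zero once \<open>t + b > k\<close>.\<close>

lemma filt_bound_qqw: "filt_bound TYPE('k::field) k (qqw b) (Suc k - b)"
proof -
  define X :: "'k krep" where "X = (mat b (Suc b) (\<lambda>(r, s). if s = Suc r then 1 else 0),
    mat b (Suc b) (\<lambda>(r, s). if s = r then 1 else 0))"
  have X: "X \<in> Rep (Suc b, b)" by (simp add: X_def Rep_iff)
  define \<Phi> where "\<Phi> = {..<Suc k - b} \<times> {0::nat}"
  have "u t = 0\<^sub>v (Suc b)" if u: "pencil_sol k (Suc b, b) X u" and z: "\<forall>(t, s)\<in>\<Phi>. u t $ s = 0" for u t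
  proof -
    have uc: "u t \<in> carrier_vec (Suc b)" and uk: "k < t \<Longrightarrow> u t = 0\<^sub>v (Suc b)" for t
      using u by (auto simp: pencil_sol_def)
    have A: "(fst X *\<^sub>v u t) $ r = u t $ Suc r" and B: "(snd X *\<^sub>v u t) $ r = u t $ r" if "r < b" for r t
      using that uc[of t] by (simp_all add: X_def scalar_prod_def scalar_prod_unit_left del: sum.op_ivl_Suc)
    have top: "u 0 $ Suc r = 0" if "r < b" for r
      using A[OF that, of 0] u that by (simp add: pencil_sol_def)
    have step: "u (Suc t) $ Suc r = u t $ r" if "r < b" for r t
      using A[OF that, of "Suc t"] B[OF that, of t] u by (simp add: pencil_sol_def)
    have diag: "u (t + j) $ j = u t $ 0" if "j \<le> b" for t j
      using that by (induction j) (auto simp: step)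
    have first: "u t $ 0 = 0" for t
    proof (cases "t < Suc k - b")
      case True
      then show ?thesis using z by (auto simp: \<Phi>_def)
    next
      case False
      then show ?thesis using diag[of b t] uk[of "t + b"] by simp
    qed
    have "u t $ s = 0" if "s \<le> b" for s
      using that
    proof (induction s arbitrary: t)
      case (Suc s)
      then show ?case using top[of s] step[of s] by (cases t) auto
    qed (rule first)
    then show ?thesis using uc[of t] by (intro eq_vecI) auto
  qed
  moreover have "\<Phi> \<subseteq> {..k} \<times> {..<Suc b}" "card \<Phi> \<le> Suc k - b" by (auto simp: \<Phi>_def)
  ultimately have "sol_bound k (Suc b, b) X (Suc k - b)" unfolding sol_bound_def fst_conv by blast
  then show ?thesis unfolding filt_bound_def filt_ijw using X by blast
qed

lemma filt_bound_concat:
  assumes "\<And>x. x \<in> set xs \<Longrightarrow> filt_bound TYPE('k::field) k (f x) (n x)"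
  shows "filt_bound TYPE('k) k (concat (map f xs)) (\<Sum>x\<leftarrow>xs. n x)"
  using assms
proof (induction xs)
  case Nil
  show ?case using filt_bound_injective[of 0 0 "[]"] by simp
next
  case (Cons x xs)
  have "filt_bound TYPE('k) k (f x @ concat (map f xs)) (n x + (\<Sum>x\<leftarrow>xs. n x))"
    by (intro filt_bound_append Cons.prems Cons.IH) auto
  then show ?case by simp
qed

text \<open>For \<open>n = Suc k\<close> the truncated difference is dim Hom(I_k, I_b).\<close>

definition excess :: "nat \<Rightarrow> nat list \<Rightarrow> nat" where
  "excess n bs = (\<Sum>b\<leftarrow>bs. n - b)"

lemma filt_bound_normal_word:
  "filt_bound TYPE('k::alg_closed_field) k (normal_word as m bs) (excess (Suc k) bs)"
proof -
  have "filt_bound TYPE('k) k (concat (map ppw as)) (\<Sum>a\<leftarrow>as. 0)"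
    by (intro filt_bound_concat filt_bound_injective[OF _ filt_ijw]) auto
  moreover have "filt_bound TYPE('k) k (rrw m) 0"
    by (intro filt_bound_injective[OF _ filt_rrw]) auto
  moreover have "filt_bound TYPE('k) k (concat (map qqw (rev bs))) (\<Sum>b\<leftarrow>rev bs. Suc k - b)"
    by (intro filt_bound_concat filt_bound_qqw)
  moreover have "(\<Sum>b\<leftarrow>rev bs. Suc k - b) = excess (Suc k) bs"
    by (simp only: excess_def rev_map[symmetric] sum_list_rev)
  ultimately show ?thesis unfolding normal_word_def
    by (metis add_0 filt_bound_append sum_list_0)
qed

section \<open>Lower bounds and recovery of the normal form\<close>

definition word_dim :: "kvertex list \<Rightarrow> dimvec" where
  "word_dim w = (count_list w Vi, count_list w Vj)"

lemma word_dim_simps [simp]: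
  "word_dim [] = (0, 0)" "word_dim (u @ v) = dim_add (word_dim u) (word_dim v)"
  "word_dim (ijw m n) = (m, n)"
proof -
  have "count_list (replicate n x) y = (if x = y then n else 0)" for n and x y :: kvertex
    by (induction n) auto
  then show "word_dim (ijw m n) = (m, n)" by (simp add: word_dim_def ijw_def)
qed (simp_all add: word_dim_def dim_add_def)

lemma word_dim_rrw [simp]: "word_dim (rrw m) = (m, m)"
  by (induction m) (auto simp: word_dim_def)

lemma filt_subset_Rep: "filt w \<subseteq> (Rep (word_dim w) :: 'k::field krep set)"
proof (induction w)
  case (Cons x w)
  have "filt (x # w) \<subseteq> ext_prod (simple_class x) (Rep (word_dim w) :: 'k krep set)"
    unfolding filt_simps by (intro ext_prod_mono subset_refl Cons)
  also have "\<dots> \<subseteq> Rep (word_dim (x # w))"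
    by (cases x) (use ext_prod_Rep_subset[of _ "word_dim w"] in \<open>fastforce simp: word_dim_def dim_add_def\<close>)+
  finally show ?case .
qed simp

text \<open>The witness \<open>X\<close> has few homomorphisms from I_k on account of
  \<open>bs\<close>; as a member of the other set it contains a subrepresentation that forces many
  on account of \<open>bs'\<close>.\<close>

lemma excess_le:
  assumes eq: "filt (normal_word as m bs) = (filt (normal_word as' m' bs') :: 'k::alg_closed_field krep set)"
    and sorted: "sorted bs'"
  shows "excess (Suc k) bs' \<le> excess (Suc k) bs"
proof -
  obtain \<gamma> and X :: "'k krep" where X: "X \<in> filt (normal_word as m bs)" "X \<in> Rep \<gamma>"
    and bound: "sol_bound k \<gamma> X (excess (Suc k) bs)"
    using filt_bound_normal_word[of k as m bs, where 'k = 'k] unfolding filt_bound_def by blast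
  \<comment> \<open>Sortedness puts the entries \<open>b \<le> k\<close> first in
    \<open>bs'\<close>, hence their factors last in the word.\<close>
  define sm where "sm = takeWhile (\<lambda>b. b \<le> k) bs'"
  define lg where "lg = dropWhile (\<lambda>b. b \<le> k) bs'"
  have bs': "bs' = sm @ lg" by (simp add: sm_def lg_def)
  have sm: "b \<le> k" if "b \<in> set sm" for b using set_takeWhileD that unfolding sm_def by metis
  have lg: "k < b" if "b \<in> set lg" for b
  proof -
    from that have "lg \<noteq> []" by auto
    then have "\<not> hd lg \<le> k" unfolding lg_def by (rule hd_dropWhile)
    moreover have "sorted lg" using sorted unfolding bs' by (simp add: sorted_append)
    ultimately show ?thesis using that by (cases lg) auto
  qed
  let ?w = "concat (map ppw as') @ rrw m' @ concat (map qqw (rev lg))"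
  have w: "normal_word as' m' bs' = ?w @ concat (map qqw (rev sm))"
    by (simp add: normal_word_def bs')
  have "X \<in> ext_prod (filt ?w) (filt (concat (map qqw (rev sm))))"
    using X(1) unfolding eq w filt_append[of ?w] .
  then have "X \<in> ext_prod (Rep (word_dim ?w)) (Rep (word_dim (concat (map qqw (rev sm)))))"
    using ext_prod_mono[OF filt_subset_Rep filt_subset_Rep] by blast
  from sol_bound_subrep[OF bound X(2) this]
  have "(k + 1) * fst (word_dim (concat (map qqw (rev sm)))) \<le>
    (k + 2) * snd (word_dim (concat (map qqw (rev sm)))) + excess (Suc k) bs" .
  moreover have "(k + 1) * fst (word_dim (concat (map qqw (rev sm)))) =
    (k + 2) * snd (word_dim (concat (map qqw (rev sm)))) + excess (Suc k) sm"
    using sm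
  proof (induction sm)
    case (Cons b sm)
    then have "b \<le> k" by simp
    \<comment> \<open>Nothing is truncated for \<open>b \<le> k\<close>, so counting gives the
      contribution of \<open>b\<close> to \<open>excess\<close> exactly.\<close>
    then have "(k + 1) * Suc b = (k + 2) * b + (Suc k - b)"
      by (simp add: algebra_simps Suc_diff_le)
    with Cons show ?case by (simp add: excess_def algebra_simps)
  qed (simp add: excess_def)
  moreover have "excess (Suc k) bs' = excess (Suc k) sm"
  proof -
    have "excess (Suc k) lg = 0" using lg by (auto simp: excess_def sum_list_eq_0_iff Suc_leI)
    then show ?thesis by (simp add: excess_def bs')
  qed
  ultimately show ?thesis by simp
qed

lemma excess_Suc: "excess (Suc n) bs = excess n bs + length (filter (\<lambda>b. b \<le> n) bs)"
  by (induction bs) (auto simp: excess_def)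

lemma length_filter_le_Suc:
  "length (filter (\<lambda>b. b \<le> Suc n) bs) = length (filter (\<lambda>b. b \<le> n) bs) + count (mset bs) (Suc n)"
  by (induction bs) (auto simp: le_Suc_eq)

text \<open>The first differences of \<open>excess\<close> count the entries up to a given size, and
  the differences of these counts are the multiplicities.\<close>

lemma sorted_eq_of_excess_eq:
  assumes eq: "\<And>k. excess (Suc k) bs = excess (Suc k) bs'" and "sorted bs" "sorted bs'"
  shows "bs = bs'"
proof -
  \<comment> \<open>\<open>excess 0\<close> is always zero, which supplies the value missing from
    the hypothesis.\<close>
  have "excess n bs = excess n bs'" for n
    using eq by (cases n) (simp_all add: excess_def sum_list_eq_0_iff)
  then have len: "length (filter (\<lambda>b. b \<le> n) bs) = length (filter (\<lambda>b. b \<le> n) bs')" for n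
    using excess_Suc[of n bs] excess_Suc[of n bs'] by simp
  have zero: "length (filter (\<lambda>b. b \<le> 0) xs) = count (mset xs) 0" for xs :: "nat list"
    by (induction xs) auto
  have "count (mset bs) n = count (mset bs') n" for n
    using len[of n] len[of "n - 1"] length_filter_le_Suc[of "n - 1"] zero by (cases n) auto
  then have "mset bs = mset bs'" by (rule multiset_eqI)
  then show ?thesis using assms(2,3) by (metis properties_for_sort)
qed

lemma filt_normal_word_inject:
  assumes eq: "filt (normal_word as m bs) = (filt (normal_word as' m' bs') :: 'k::alg_closed_field krep set)"
    and sorted: "sorted as" "sorted as'" "sorted bs" "sorted bs'"
  shows "as = as' \<and> m = m' \<and> bs = bs'"
proof -
  have bs: "bs = bs'"
    by (rule sorted_eq_of_excess_eq[OF antisym sorted(3,4)])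
      (rule excess_le[OF eq[symmetric] sorted(3)], rule excess_le[OF eq sorted(4)])
  have eq': "filt (normal_word bs m as) = (filt (normal_word bs' m' as') :: 'k krep set)"
    using arg_cong[OF eq, of "image transpose_rep"] by (simp add: transpose_rep_filt dual_word_normal_word)
  have as: "as = as'"
    by (rule sorted_eq_of_excess_eq[OF antisym sorted(1,2)])
      (rule excess_le[OF eq'[symmetric] sorted(1)], rule excess_le[OF eq' sorted(2)])
  obtain X :: "'k krep" where "X \<in> filt (normal_word as m bs)"
    using filt_bound_normal_word unfolding filt_bound_def by blast
  then have "word_dim (normal_word as m bs) = word_dim (normal_word as' m' bs')"
    using filt_subset_Rep eq Rep_dim_unique by blast
  then have "m = m'" by (simp add: normal_word_def dim_add_def as bs)
  with as bs show ?thesis by blast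
qed

lemma filt_eq_iff: "(filt u :: 'k::alg_closed_field krep set) = filt v \<longleftrightarrow> u \<approx> v"
proof
  assume eq: "(filt u :: 'k krep set) = filt v"
  obtain as m bs where u: "sorted as" "sorted bs" "u \<approx> normal_word as m bs"
    using cong_sorted_normal_word by blast
  obtain as' m' bs' where v: "sorted as'" "sorted bs'" "v \<approx> normal_word as' m' bs'"
    using cong_sorted_normal_word by blast
  have "filt (normal_word as m bs) = (filt (normal_word as' m' bs') :: 'k krep set)"
    using eq filt_cong[OF u(3), where 'k = 'k] filt_cong[OF v(3), where 'k = 'k] by simp
  then have "normal_word as m bs = normal_word as' m' bs'"
    using filt_normal_word_inject u v by metis
  then show "u \<approx> v" using u(3) v(3) word_cong.sym kron_cong_trans by metis
qed (rule filt_cong)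

section \<open>The composition monoid as the set of values of words\<close>

lemma generated_eq_range_filt:
  "generated_set extension_monoid {Rep (1, 0), Rep (0, 1)} = (range filt :: 'k::field krep set set)"
proof (intro equalityI subsetI)
  fix S :: "'k krep set" assume "S \<in> generated_set extension_monoid {Rep (1, 0), Rep (0, 1)}"
  then show "S \<in> range filt"
  proof induction
    case one
    have "\<one>\<^bsub>extension_monoid\<^esub> = filt []" by (simp add: extension_monoid_def)
    then show ?case by blast
  next
    case (incl S)
    then have "S = filt [Vi] \<or> S = filt [Vj]"
      by (auto simp: ext_prod_unit_right iso_closed_Rep)
    then show ?case by blast
  next
    case (mult S T)
    then obtain u v where "S = filt u" "T = filt v" by blast
    then have "S \<otimes>\<^bsub>extension_monoid\<^esub> T = filt (u @ v)" by (simp add: extension_monoid_def filt_append)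
    then show ?case by blast
  qed
next
  fix S :: "'k krep set" assume "S \<in> range filt"
  then obtain w where S: "S = filt w" by blast
  have "filt w \<in> generated_set extension_monoid {Rep (1, 0), Rep (0, 1) :: 'k krep set}"
  proof (induction w)
    case Nil
    show ?case using generated_set.one[of extension_monoid] by (simp add: extension_monoid_def)
  next
    case (Cons x w)
    have "simple_class x \<in> generated_set extension_monoid {Rep (1, 0), Rep (0, 1) :: 'k krep set}"
      by (cases x) (auto intro: generated_set.incl)
    from generated_set.mult[OF this Cons] show ?case by (simp add: extension_monoid_def)
  qed
  then show "S \<in> generated_set extension_monoid {Rep (1, 0), Rep (0, 1)}" using S by simp
qed

text \<open>Every element is some \<open>filt w\<close>, hence closed under isomorphism, which gives
  the unit laws; associativity holds for arbitrary sets.\<close>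

lemma monoid_composition_monoid: "monoid (composition_monoid :: 'k::field krep set monoid)"
proof
  fix S T U :: "'k krep set"
  show "\<one>\<^bsub>composition_monoid\<^esub> \<in> carrier (composition_monoid :: 'k krep set monoid)"
    unfolding composition_monoid_simps generated_eq_range_filt using filt_simps(1) by blast
  show "S \<otimes>\<^bsub>composition_monoid\<^esub> T \<otimes>\<^bsub>composition_monoid\<^esub> U =
    S \<otimes>\<^bsub>composition_monoid\<^esub> (T \<otimes>\<^bsub>composition_monoid\<^esub> U)"
    by (simp add: ext_prod_assoc)
  assume "S \<in> carrier composition_monoid"
  then obtain u where S: "S = filt u" unfolding composition_monoid_simps generated_eq_range_filt by blast
  show "\<one>\<^bsub>composition_monoid\<^esub> \<otimes>\<^bsub>composition_monoid\<^esub> S = S"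
    "S \<otimes>\<^bsub>composition_monoid\<^esub> \<one>\<^bsub>composition_monoid\<^esub> = S"
    by (simp_all add: S ext_prod_unit_left ext_prod_unit_right iso_closed_filt)
  assume "T \<in> carrier composition_monoid"
  then obtain v where T: "T = filt v" unfolding composition_monoid_simps generated_eq_range_filt by blast
  show "S \<otimes>\<^bsub>composition_monoid\<^esub> T \<in> carrier composition_monoid"
    unfolding composition_monoid_simps generated_eq_range_filt S T filt_append[symmetric] by blast
qed

theorem theorem12:
  shows "has_presentation
    (composition_monoid :: 'k::{alg_closed_field, field_char_0} krep set monoid)
    simple_class
    ({(wpow wi m @ wpow wj (m + 1) @ wpow wi (m + 1) @ wpow wj (m + 2),
       wpow wi (2 * m + 1) @ wpow wj (2 * m + 3)) | m. m \<ge> 0} \<union>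
     {(wpow wi (n + 2) @ wpow wj (n + 1) @ wpow wi (n + 1) @ wpow wj n,
       wpow wi (2 * n + 3) @ wpow wj (2 * n + 1)) | n. n \<ge> 0} \<union>
     {(wpow (wi @ wj) m, wpow wi m @ wpow wj m) | m. m \<ge> 1})"
  unfolding kron_rels_def[symmetric] has_presentation_def filt_def[symmetric]
proof (intro conjI allI)
  show "range simple_class \<subseteq> carrier (composition_monoid :: 'k krep set monoid)"
  proof clarify
    fix x show "simple_class x \<in> carrier (composition_monoid :: 'k krep set monoid)"
      by (cases x) (auto intro: generated_set.incl)
  qed
  show "range (filt :: _ \<Rightarrow> 'k krep set) = carrier composition_monoid"
    unfolding composition_monoid_simps generated_eq_range_filt ..
qed (rule monoid_composition_monoid filt_eq_iff)+

end
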